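(* Let $\beta>0$ and let $\mu,\nu\in(-1,1]$ satisfy $|\mu-\nu|>\alpha/2$. Suppose that $\alpha\in(0,2)$, $\frac1\alpha<r\leq\infty$, and that $1\leq p<q\leq\infty$ are such that $$\frac1p-\frac1q<\frac{\beta}{d}\left(1-\frac{1}{\alpha}\frac{1}{r}\right).$$ Then $$\|w(t,\cdot)\|_{L^{q}(\mathbb{R}^{d})}\lesssim t^{\frac{\alpha}{\beta}d\left(\frac{\beta}{d}-\left(\frac1p-\frac1q\right)\right)-\frac1r}\,\|F\|_{L^{r}([0,\infty);L^{p}(\mathbb{R}^{d}))}.$$
   Context: Here $d\geq 1$ is the dimension, $t>0$, $1/\infty=0$, and $A\lesssim B$ means $A\leq CB$ with a constant $C>0$ independent of $t$ and $F$. The function $w$ is a solution of the inhomogeneous Cauchy problem $e^{\mu\pi i}\partial_t^{\alpha}w(t,x)=e^{\nu\pi i}(-\Delta)^{\beta/2}w(t,x)+F(t,x)$ for $(t,x)\in(0,\infty)\times\mathbb{R}^d$, $w(0,x)=0$ for $x\in\mathbb{R}^d$, given (explicitly derived for regular enough $F$) by $$w(t,x)=e^{-\mu\pi i}\int_{0}^{t}(t-s)^{\alpha-1}\,W_{\alpha,\mu,\nu}(t-s,\cdot)\ast F(s,\cdot)(x)\,ds,$$ where $\ast$ is convolution in $x\in\mathbb{R}^d$ and the kernel is the inverse Fourier transform $$W_{\alpha,\mu,\nu}(t,x)=\int_{\mathbb{R}^{d}}e^{2\pi i x\cdot\xi}E_{\alpha,\alpha}\big(e^{(\nu-\mu)\pi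 i}t^{\alpha}|\xi|^{\beta}\big)\,d\xi .$$ $E_{\alpha,\alpha}(z)=\sum_{k=0}^{\infty}\frac{z^{k}}{\Gamma(\alpha k+\alpha)}$ is the Mittag-Leffler function. $\partial_t^{\alpha}$ is the Caputo derivative of order $\alpha$, defined by $\partial_t^{\alpha}U(t)=\frac{1}{\Gamma(1-\alpha)}\int_0^t\frac{U'(\tau)}{(t-\tau)^{\alpha}}\,d\tau$, and $(-\Delta)^{\beta/2}$ is the Fourier multiplier with symbol $|\xi|^{\beta}$. $\|F\|_{L^{r}([0,\infty);L^{p}(\mathbb{R}^{d}))}$ is the $L^r([0,\infty))$ norm of $s\mapsto\|F(s,\cdot)\|_{L^p(\mathbb{R}^d)}$.
   Formalization: Adds |μ−ν| < 2−α/2 (otherwise the symbol grows exponentially and W is undefined, or at equality the estimate fails, e.g. Schrödinger with p=2, q=r=∞) and r ≥ 1 (the estimate is false for r<1); W is the inverse Fourier transform in the tempered-distribution sense. *)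

theory Defs
  imports "HOL-Probability.Essential_Supremum"
begin

definition mittag_leffler :: "real \<Rightarrow> real \<Rightarrow> complex \<Rightarrow> complex" where
  "mittag_leffler a b z = (\<Sum>k. z ^ k / complex_of_real (Gamma (a * real k + b)))"

(* Schwartz functions.  Read coinductively: all iterated partial derivatives exist,
   are differentiable, and decay faster than every power of the norm. *)
coinductive schwartz :: "('a::euclidean_space \<Rightarrow> complex) \<Rightarrow> bool" where
  "\<lbrakk>\<And>x. \<phi> differentiable (at x);
    \<And>k::nat. bounded (range (\<lambda>x. norm x ^ k *\<^sub>R \<phi> x));
    \<And>b. b \<in> Basis \<Longrightarrow> schwartz (\<lambda>x. frechet_derivative \<phi> (at x) b)\<rbrakk>
   \<Longrightarrow> schwartz \<phi>"

(* The functions that act on Schwartz functions by an absolutely convergent integral. *)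
definition tempered :: "('a::euclidean_space \<Rightarrow> complex) \<Rightarrow> bool" where
  "tempered f \<longleftrightarrow> f \<in> borel_measurable lborel \<and>
     (\<forall>\<phi>. schwartz \<phi> \<longrightarrow> integrable lborel (\<lambda>x. f x * \<phi> x))"

(* K is the inverse Fourier transform of m as a tempered distribution:
   <K, phi> = <m, F^{-1} phi> for all Schwartz phi, where
   F^{-1} phi (xi) = integral of e^{2 pi i x.xi} phi(x) dx. *)
definition is_inverse_fourier ::
    "('a::euclidean_space \<Rightarrow> complex) \<Rightarrow> ('a \<Rightarrow> complex) \<Rightarrow> bool" where
  "is_inverse_fourier m K \<longleftrightarrow> tempered m \<and> tempered K \<and>
     (\<forall>\<phi>. schwartz \<phi> \<longrightarrow>
        (\<integral>x. K x * \<phi> x \<partial>lborel) =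
        (\<integral>\<xi>. m \<xi> * (\<integral>x. cis (2 * pi * (x \<bullet> \<xi>)) * \<phi> x \<partial>lborel) \<partial>lborel))"

(* For integrable m this is, up to a null set, the function
   x |-> integral of e^{2 pi i x.xi} m(xi) dxi.  The distributional reading is needed because
   E_{a,a} decays only like |z|^{-2}, so the symbol E_{a,a}(c |xi|^b) is not integrable
   when 2 b <= d, and the Bochner integral would then be 0 by convention.
   The choice is unique up to a null set, which does not affect convolutions. *)
definition inverse_fourier :: "('a::euclidean_space \<Rightarrow> complex) \<Rightarrow> 'a \<Rightarrow> complex" where
  "inverse_fourier m = (SOME K. is_inverse_fourier m K)"

definition kernel_W ::
    "real \<Rightarrow> real \<Rightarrow> real \<Rightarrow> real \<Rightarrow> real \<Rightarrow> 'a::euclidean_space \<Rightarrow> complex" where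
  "kernel_W \<alpha> \<beta> \<mu> \<nu> t =
     inverse_fourier (\<lambda>\<xi>. mittag_leffler \<alpha> \<alpha>
       (cis ((\<nu> - \<mu>) * pi) * complex_of_real (t powr \<alpha> * norm \<xi> powr \<beta>)))"

definition conv :: "('a::euclidean_space \<Rightarrow> complex) \<Rightarrow> ('a \<Rightarrow> complex) \<Rightarrow> 'a \<Rightarrow> complex" where
  "conv f g x = (\<integral>y. f (x - y) * g y \<partial>lborel)"

definition sol_w ::
    "real \<Rightarrow> real \<Rightarrow> real \<Rightarrow> real \<Rightarrow> (real \<Rightarrow> 'a::euclidean_space \<Rightarrow> complex) \<Rightarrow>
     real \<Rightarrow> 'a \<Rightarrow> complex" where
  "sol_w \<alpha> \<beta> \<mu> \<nu> F t x =
     cis (- \<mu> * pi) *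
     (LINT s:{0..t}|lborel. complex_of_real ((t - s) powr (\<alpha> - 1)) *
        conv (kernel_W \<alpha> \<beta> \<mu> \<nu> (t - s)) (F s) x)"

(* Lebesgue exponents are ennreals, and 1/\<infinity> = 0. *)
definition recip :: "ennreal \<Rightarrow> real" where
  "recip p = enn2real (1 / p)"

(* Power with a positive exponent. *)
definition epow :: "ennreal \<Rightarrow> real \<Rightarrow> ennreal" where
  "epow x a = (if x = \<infinity> then \<infinity> else ennreal (enn2real x powr a))"

(* The L^p norm, stated for extended nonnegative functions so that it can be iterated. *)
definition Lp_norm :: "ennreal \<Rightarrow> 'b measure \<Rightarrow> ('b \<Rightarrow> ennreal) \<Rightarrow> ennreal" where
  "Lp_norm p M g =
     (if p = \<infinity> then esssup M g
      else epow (\<integral>\<^sup>+x. epow (g x) (enn2real p) \<partial>M) (recip p))"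

definition space_norm :: "ennreal \<Rightarrow> ('a::euclidean_space \<Rightarrow> complex) \<Rightarrow> ennreal" where
  "space_norm p f = Lp_norm p lborel (\<lambda>x. ennreal (norm (f x)))"

definition mixed_norm ::
    "ennreal \<Rightarrow> ennreal \<Rightarrow> (real \<Rightarrow> 'a::euclidean_space \<Rightarrow> complex) \<Rightarrow> ennreal" where
  "mixed_norm r p F = Lp_norm r (restrict_space lborel {0..}) (\<lambda>s. space_norm p (F s))"

end

theory Submission
  imports Defs "HOL-Complex_Analysis.Complex_Analysis" "HOL-Probability.Probability" "HOL-Real_Asymp.Real_Asymp"
begin

text \<open>
  By the residue theorem, the Mittag-Leffler function on the ray in question is a Mellin-Barnes
  integral of powers \<open>norm \<xi> powr (- \<beta> s)\<close> over any line \<open>Re s = \<gamma>\<close> with \<open>0 < \<gamma> < 1\<close>; the condition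
  \<open>\<alpha> / 2 < \<bar>\<mu> - \<nu>\<bar> < 2 - \<alpha> / 2\<close> is what makes its density decay exponentially. Each power is the
  Fourier transform of an explicit Riesz kernel, whose Gamma quotient grows only polynomially along the
  line. So the kernel is bounded by a multiple of \<open>norm x powr (\<beta> \<gamma> - d)\<close>, where the kernels belonging to
  different \<open>\<gamma>\<close> agree almost everywhere. Taking one \<open>\<gamma>\<close> on each side of \<open>d \<theta> / \<beta>\<close>, where
  \<open>\<theta> = 1 / p - 1 / q > 0\<close>, puts the kernel into \<open>L\<close> to the power \<open>1 / (1 - \<theta>)\<close>; if \<open>\<theta> = 1\<close>, the symbol
  is integrable and the kernel bounded. Scaling and Young's inequality give the factor
  \<open>(t - s) powr (\<alpha> - 1 - \<alpha> d \<theta> / \<beta>)\<close> at time \<open>s\<close>, and Minkowski's inequality and Hoelder's inequality in \<open>s\<close>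
  finish the proof.
\<close>

section \<open>Growth of the Gamma function on vertical lines\<close>

text \<open>The obstacle is that the symbol need not be integrable, so the kernel is given only as
  some function representing a distribution, and all that is known of it is its pairing with
  Schwartz functions. Powers of the norm have inverse transforms that are explicit functions, and a
  superposition of them turns the kernel into an absolutely convergent integral. Two facts make this
  useful. Uniqueness of the distributional inverse transform, tested on Gaussians only, identifies
  the explicit kernel with the chosen one and the kernels of different lines with each other.
  Homogeneity lets t and \<open>norm \<xi>\<close> enter through powers alone, so the kernel at time
  1 determines all others by dilation and the constants are uniform in t. The hypotheses fit the
  strip: raised to the power 1 / (1 - \<theta>), the bound on the line \<gamma> is critical at
  \<gamma> = d \<theta> / \<beta>, and \<theta> < \<beta> / d places this value below 1. The sharper
  condition involving r is the one that makes the resulting weight in time integrable to the power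
  dual to r.\<close>

lemma cmod_Complex_ratio_mono:
  assumes "0 < a" "a \<le> b"
  shows "a / cmod (Complex a y) \<le> b / cmod (Complex b y)"
proof -
  have "a\<^sup>2 * (b\<^sup>2 + y\<^sup>2) \<le> b\<^sup>2 * (a\<^sup>2 + y\<^sup>2)"
    using assms mult_right_mono[OF power_mono[of a b 2], of "y\<^sup>2"] by (simp add: algebra_simps)
  hence "(a * cmod (Complex b y))\<^sup>2 \<le> (b * cmod (Complex a y))\<^sup>2"
    by (simp add: power_mult_distrib cmod_power2)
  hence "a * cmod (Complex b y) \<le> b * cmod (Complex a y)"
    by (rule power2_le_imp_le) (use assms in auto)
  moreover have "cmod (Complex a y) > 0" "cmod (Complex b y) > 0"
    using assms by (auto simp: complex_eq_iff)
  ultimately show ?thesis by (simp add: pos_divide_le_eq pos_le_divide_eq mult.commute)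
qed

text \<open>Euler's limit formula turns the quotient into a limit of products of factors (c + k) /
  |c + k + i y|, and each factor increases with c. This carries a lower bound from the line Re = 1
  to every line to its right.\<close>

lemma norm_Gamma_vertical_mono:
  assumes "0 < a" "a \<le> b"
  shows "cmod (Gamma (Complex a y)) / Gamma a \<le> cmod (Gamma (Complex b y)) / Gamma b"
proof -
  define R where "R = (\<lambda>c n. cmod (Gamma_series (Complex c y) n) / Gamma_series c n)"
  have lim: "R c \<longlonglongrightarrow> cmod (Gamma (Complex c y)) / Gamma c" if "c > 0" for c
    unfolding R_def using that
    by (intro tendsto_intros) (auto simp: Gamma_eq_zero_iff)
  have R: "R c n = (\<Prod>k\<le>n. (c + real k) / cmod (Complex (c + real k) y))" if "c > 0" for c n
  proof -
    have "Complex c y + of_nat k = Complex (c + k) y" for k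
      by (simp add: complex_eq_iff)
    hence "cmod (pochhammer (Complex c y) (n + 1)) = (\<Prod>k\<le>n. cmod (Complex (c + real k) y))"
      by (simp add: pochhammer_prod prod_norm atLeast0LessThan lessThan_Suc_atMost del: prod.lessThan_Suc)
    moreover have "pochhammer c (n + 1) = (\<Prod>k\<le>n. c + real k)"
      by (simp add: pochhammer_prod atLeast0LessThan lessThan_Suc_atMost del: prod.lessThan_Suc)
    moreover have "norm (exp (Complex c y * of_real (ln (real n)))) = exp (c * ln (real n))"
      by simp
    ultimately show ?thesis
      by (simp add: R_def Gamma_series_def norm_mult norm_divide prod_dividef del: norm_exp_eq_Re)
  qed
  have "R a n \<le> R b n" for n
    using assms by (auto simp: R intro!: prod_mono cmod_Complex_ratio_mono divide_nonneg_nonneg)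
  thus ?thesis using lim assms by (intro LIMSEQ_le[OF lim lim]) auto
qed

text \<open>Since 1 - i y is the conjugate of 1 + i y, the reflection formula gives the exact value
  |Gamma (1 + i y)|^2 = pi y / sinh (pi y). The estimate sinh u \<le> u exp u then keeps the
  exponential rate.\<close>

lemma norm_Gamma_one_plus_imaginary:
  "exp (- pi * \<bar>y\<bar> / 2) \<le> cmod (Gamma (Complex 1 y))"
proof (cases "y = 0")
  case True
  then show ?thesis by (simp add: complex_of_real_def[symmetric] flip: one_complex.code)
next
  case False
  define u where "u = pi * \<bar>y\<bar>"
  have u: "u > 0" using False by (simp add: u_def)
  let ?w = "\<i> * of_real y"
  have w: "?w \<noteq> 0" using False by simp
  have sinh: "cmod (sin (of_real pi * ?w)) \<le> u * exp u"
  proof -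
    have "sin (of_real pi * ?w) = sin (\<i> * of_real (pi * y))" by (simp add: mult_ac)
    also have "\<dots> = \<i> * of_real ((exp (pi * y) - inverse (exp (pi * y))) / 2)"
      by (subst sin_i_times) (simp add: exp_of_real del: of_real_mult)
    finally have "cmod (sin (of_real pi * ?w)) = \<bar>exp (pi * y) - exp (- (pi * y))\<bar> / 2"
      by (simp only: norm_mult norm_of_real) (simp add: exp_minus)
    also have "\<dots> = (exp u - exp (- u)) / 2"
    proof (cases "y \<ge> 0")
      case True
      hence "exp (- (pi * y)) \<le> exp (pi * y)" by simp
      thus ?thesis using True by (simp add: u_def)
    next
      case False
      hence "pi * y < 0" by (simp add: mult_pos_neg)
      thus ?thesis using False by (simp add: u_def abs_if)
    qed
    also have "\<dots> \<le> u * exp u"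
    proof -
      have "1 - exp (- 2 * u) \<le> 2 * u" using exp_ge_add_one_self[of "- 2 * u"] by simp
      hence "(1 - exp (- 2 * u)) * exp u \<le> 2 * u * exp u" by (intro mult_right_mono) auto
      moreover have "exp (- 2 * u) * exp u = exp (- u)" by (simp flip: exp_add)
      ultimately show ?thesis by (simp add: algebra_simps)
    qed
    finally show ?thesis .
  qed
  have sin0: "sin (of_real pi * ?w) \<noteq> 0"
    using False unfolding sin_eq_0 by (auto simp: complex_eq_iff)
  have 1: "Gamma (1 + ?w) = ?w * Gamma ?w"
    using w by (subst add.commute, intro Gamma_plus1)
      (auto elim!: nonpos_Ints_cases' simp: complex_eq_iff)
  have 2: "1 - ?w = cnj (1 + ?w)" by simp
  have "cmod (Gamma (1 + ?w)) = cmod (Gamma (1 - ?w))"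
    by (simp only: 2 cnj_Gamma[symmetric] complex_mod_cnj)
  hence "(cmod (Gamma (1 + ?w)))\<^sup>2 = cmod (?w * (Gamma ?w * Gamma (1 - ?w)))"
    by (simp add: power2_eq_square 1 norm_mult)
  also have "\<dots> = \<bar>y\<bar> * pi / cmod (sin (of_real pi * ?w))"
    by (subst Gamma_reflection_complex) (simp add: norm_mult norm_divide)
  also have "\<dots> \<ge> \<bar>y\<bar> * pi / (u * exp u)"
    using sinh sin0 u by (intro divide_left_mono) auto
  also have "\<bar>y\<bar> * pi / (u * exp u) = exp (- u)"
    using False by (simp add: u_def exp_minus field_simps)
  also have "exp (- u) = (exp (- u / 2))\<^sup>2" by (simp flip: exp_of_nat_mult)
  finally have "exp (- u / 2) \<le> cmod (Gamma (1 + ?w))"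
    by (rule power2_le_imp_le) simp
  moreover have "1 + ?w = Complex 1 y" by (simp add: complex_eq_iff)
  ultimately show ?thesis by (simp add: u_def)
qed

lemma norm_rGamma_le:
  assumes "1 \<le> x"
  shows "cmod (rGamma (Complex x y)) \<le> exp (pi * \<bar>y\<bar> / 2) / Gamma x"
proof -
  have "exp (- pi * \<bar>y\<bar> / 2) \<le> cmod (Gamma (Complex x y)) / Gamma x"
    using norm_Gamma_vertical_mono[of 1 x y] norm_Gamma_one_plus_imaginary[of y] assms by simp
  moreover have G: "Gamma x > 0" using assms by (intro Gamma_real_pos) auto
  ultimately have "exp (- pi * \<bar>y\<bar> / 2) * Gamma x \<le> cmod (Gamma (Complex x y))"
    by (simp add: field_simps)
  moreover from this have "cmod (Gamma (Complex x y)) > 0"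
    using G by (rule_tac less_le_trans) auto
  ultimately have "1 / cmod (Gamma (Complex x y)) \<le> 1 / (exp (- pi * \<bar>y\<bar> / 2) * Gamma x)"
    using G by (intro divide_left_mono mult_pos_pos) auto
  thus ?thesis
    by (simp add: rGamma_inverse_Gamma norm_inverse norm_divide exp_minus field_simps)
qed

text \<open>One step of the functional equation reaches real parts below 1, at the price of a linear
  factor. In the Mellin-Barnes integrand the argument \<alpha> (1 - s) can have a small positive
  real part.\<close>

lemma norm_rGamma_le':
  assumes "0 < x"
  shows "cmod (rGamma (Complex x y)) \<le> (x + \<bar>y\<bar>) * exp (pi * \<bar>y\<bar> / 2) / Gamma (x + 1)"
proof -
  have "Complex x y + 1 = Complex (x + 1) y" by (simp add: complex_eq_iff)
  hence "rGamma (Complex x y) = Complex x y * rGamma (Complex (x + 1) y)"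
    using rGamma_plus1[of "Complex x y"] by simp
  hence "cmod (rGamma (Complex x y)) = cmod (Complex x y) * cmod (rGamma (Complex (x + 1) y))"
    by (simp add: norm_mult)
  also have "\<dots> \<le> (x + \<bar>y\<bar>) * (exp (pi * \<bar>y\<bar> / 2) / Gamma (x + 1))"
    using assms cmod_le[of "Complex x y"] by (intro mult_mono norm_rGamma_le) auto
  finally show ?thesis by simp
qed

text \<open>The exponential decay of the two Gamma factors cancels.\<close>

lemma norm_Gamma_ratio_polynomial:
  assumes "0 < a" "0 < b"
  obtains C N where "0 < C"
    "\<And>y. cmod (Gamma (Complex a y)) \<le> C * (1 + \<bar>y\<bar>) ^ N * cmod (Gamma (Complex b y))"
proof -
  \<comment> \<open>Shifting b by N puts it to the right of a, so that the monotonicity between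
    vertical lines applies. Undoing the shift costs N linear factors, hence the power of 1 +
    |y|.\<close>
  obtain N :: nat where N: "a \<le> b + real N" using real_arch_simple[of "a - b"] by (auto simp: algebra_simps)
  define C where "C = Gamma a / Gamma (b + N) * (b + N + 1) ^ N"
  have pos: "Gamma a > 0" "Gamma (b + N) > 0" using assms by (auto intro: Gamma_real_pos)
  have "cmod (Gamma (Complex a y)) \<le> C * (1 + \<bar>y\<bar>) ^ N * cmod (Gamma (Complex b y))" for y
  proof -
    have "cmod (Gamma (Complex a y)) / Gamma a \<le> cmod (Gamma (Complex (b + N) y)) / Gamma (b + N)"
      using assms N by (intro norm_Gamma_vertical_mono) auto
    hence 1: "cmod (Gamma (Complex a y)) \<le> Gamma a / Gamma (b + N) * cmod (Gamma (Complex (b + N) y))"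
      using pos by (simp add: field_simps)
    have nz: "Complex b y \<notin> \<int>\<^sub>\<le>\<^sub>0" using assms by (auto elim!: nonpos_Ints_cases' simp: complex_eq_iff)
    have "Complex b y + of_nat N = Complex (b + N) y" by (simp add: complex_eq_iff)
    hence "Gamma (Complex (b + N) y) = pochhammer (Complex b y) N * Gamma (Complex b y)"
      using pochhammer_Gamma[OF nz, of N] nz by (simp add: Gamma_eq_zero_iff)
    hence 2: "cmod (Gamma (Complex (b + N) y)) = cmod (pochhammer (Complex b y) N) * cmod (Gamma (Complex b y))"
      by (simp add: norm_mult)
    have "cmod (pochhammer (Complex b y) N) = (\<Prod>i<N. cmod (Complex b y + of_nat i))"
      by (simp add: pochhammer_prod prod_norm atLeast0LessThan)
    also have "\<dots> \<le> (\<Prod>i<N. (b + N + 1) * (1 + \<bar>y\<bar>))"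
    proof (intro prod_mono conjI)
      fix i assume "i \<in> {..<N}"
      have "cmod (Complex b y + of_nat i) \<le> b + real i + \<bar>y\<bar>"
        using cmod_le[of "Complex b y + of_nat i"] assms by simp
      also have "\<dots> \<le> (b + N + 1) * (1 + \<bar>y\<bar>)"
      proof -
        have "0 \<le> (b + N) * \<bar>y\<bar>" using assms by auto
        thus ?thesis using \<open>i \<in> {..<N}\<close> by (simp add: algebra_simps)
      qed
      finally show "cmod (Complex b y + of_nat i) \<le> (b + N + 1) * (1 + \<bar>y\<bar>)" .
    qed auto
    finally have 3: "cmod (pochhammer (Complex b y) N) \<le> (b + N + 1) ^ N * (1 + \<bar>y\<bar>) ^ N"
      by (simp add: power_mult_distrib)
    have "cmod (Gamma (Complex a y)) \<le>
        Gamma a / Gamma (b + N) * (((b + N + 1) ^ N * (1 + \<bar>y\<bar>) ^ N) * cmod (Gamma (Complex b y)))"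
      using 1 3 pos unfolding 2 by (elim order_trans) (intro mult_left_mono mult_right_mono; auto)
    thus ?thesis by (simp add: C_def mult_ac)
  qed
  moreover have "C > 0" using pos assms unfolding C_def by (intro mult_pos_pos divide_pos_pos zero_less_power) auto
  ultimately show ?thesis using that by blast
qed

text \<open>Only the window from M to M + 1 of Euler's integral is kept. As M is free, Gamma
  outgrows every geometric sequence, which later makes the left side of the contour vanish in the
  limit.\<close>

lemma Gamma_real_ge_power:
  assumes "1 \<le> x" "0 < M"
  shows "M powr (x - 1) * exp (- (M + 1)) \<le> Gamma (x::real)"
proof -
  define c where "c = M powr (x - 1) * exp (- (M + 1))"
  have "((\<lambda>t. c) has_integral c) {M..M+1}"
    by (rule has_integral_eq_rhs[OF has_integral_const_real]) simp
  hence i: "((\<lambda>t. if t \<in> {M..M+1} then c else 0) has_integral c) UNIV"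
    by (simp only: has_integral_restrict_UNIV)
  have j: "((\<lambda>t. if t \<in> {0..} then t powr (x - 1) / exp t else 0) has_integral Gamma x) UNIV"
    using Gamma_integral_real[of x] assms by (simp only: has_integral_restrict_UNIV)
  show ?thesis
  proof (rule has_integral_le[OF i[unfolded c_def] j])
    fix t :: real
    have "M powr (x - 1) * exp (- (M + 1)) \<le> t powr (x - 1) * exp (- t)" if "t \<in> {M..M+1}"
      using that assms by (intro mult_mono powr_mono2) auto
    thus "(if t \<in> {M..M+1} then M powr (x - 1) * exp (- (M + 1)) else 0)
        \<le> (if t \<in> {0..} then t powr (x - 1) / exp t else 0)"
      using assms by (auto simp: exp_minus field_simps)
  qed
qed

section \<open>Gaussian integrals\<close>

lemma
  fixes f :: "'a::euclidean_space \<Rightarrow> real \<Rightarrow> complex"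
  assumes "\<And>b. b \<in> Basis \<Longrightarrow> integrable lborel (f b)"
  shows integrable_lborel_prod: "integrable lborel (\<lambda>x. \<Prod>b\<in>Basis. f b (x \<bullet> b))"
    and integral_lborel_prod: "(\<integral>x. (\<Prod>b\<in>Basis. f b (x \<bullet> b)) \<partial>lborel) = (\<Prod>b\<in>Basis. (\<integral>x. f b x \<partial>lborel))"
proof -
  interpret product_sigma_finite "\<lambda>_::'a. lborel :: real measure" ..
  let ?T = "\<lambda>g. \<Sum>b\<in>Basis. g b *\<^sub>R (b::'a)"
  have f: "f b \<in> borel_measurable borel" if "b \<in> Basis" for b
    using assms[OF that] by auto
  have T[measurable]: "?T \<in> measurable (\<Pi>\<^sub>M b\<in>Basis. lborel) borel" by measurable
  have F: "(\<lambda>x. \<Prod>b\<in>Basis. f b (x \<bullet> b)) \<in> borel_measurable borel"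
  proof (rule borel_measurable_prod)
    fix b :: 'a assume "b \<in> Basis"
    thus "(\<lambda>x. f b (x \<bullet> b)) \<in> borel_measurable borel"
      by (intro measurable_compose[OF _ f]) auto
  qed
  have eq: "(\<Prod>b\<in>Basis. f b (?T g \<bullet> b)) = (\<Prod>b\<in>Basis. f b (g b))" for g
    by (intro prod.cong refl) simp
  show "integrable lborel (\<lambda>x. \<Prod>b\<in>Basis. f b (x \<bullet> b))"
    by (subst lborel_eq, subst integrable_distr_eq[OF T F], unfold eq)
       (intro product_integrable_prod assms; simp)
  have "(\<integral>x. (\<Prod>b\<in>Basis. f b (x \<bullet> b)) \<partial>lborel) = (\<integral>g. (\<Prod>b\<in>Basis. f b (g b)) \<partial>(\<Pi>\<^sub>M b\<in>Basis. lborel))"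
    by (subst lborel_eq, subst integral_distr[OF T F], unfold eq) simp
  also have "\<dots> = (\<Prod>b\<in>Basis. (\<integral>x. f b x \<partial>lborel))"
    by (intro product_integral_prod assms) auto
  finally show "(\<integral>x. (\<Prod>b\<in>Basis. f b (x \<bullet> b)) \<partial>lborel) = (\<Prod>b\<in>Basis. (\<integral>x. f b x \<partial>lborel))" .
qed

text \<open>This is the characteristic function of the standard normal distribution after the
  substitution by \<open>c\<close>, which turns exp (- pi v x^2) into exp (- (c x)^2 / 2);
  \<open>t\<close> is the frequency in the new variable.\<close>

lemma
  fixes v y :: real
  assumes v: "v > 0"
  shows integrable_gaussian_cis: "integrable lborel (\<lambda>x. complex_of_real (exp (- pi * v * x\<^sup>2)) * cis (2 * pi * (x * y)))"
    and integral_gaussian_cis: "(\<integral>x. complex_of_real (exp (- pi * v * x\<^sup>2)) * cis (2 * pi * (x * y)) \<partial>lborel) =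
      complex_of_real (v powr (- 1 / 2) * exp (- pi * y\<^sup>2 / v))"
proof -
  define c where "c = sqrt (2 * pi * v)"
  define t where "t = 2 * pi * y / c"
  have c: "c > 0" "c\<^sup>2 = 2 * pi * v" using v by (auto simp: c_def)
  define f where "f = (\<lambda>x. complex_of_real (std_normal_density x) * iexp (t * x))"
  have mf[measurable]: "f \<in> borel_measurable borel" unfolding f_def by measurable
  have "integrable std_normal_distribution (\<lambda>x. iexp (t * x))"
    using real_dist_normal_dist unfolding real_distribution_def
    by (intro finite_measure.integrable_const_bound[of _ _ 1]) (auto simp: prob_space_def real_distribution_axioms_def)
  hence intf: "integrable lborel f"
    unfolding f_def by (subst (asm) integrable_density) (auto simp: scaleR_conv_of_real)
  have "char std_normal_distribution t = (\<integral>x. f x \<partial>lborel)"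
    unfolding char_def f_def by (subst integral_density) (auto simp: scaleR_conv_of_real)
  hence If: "(\<integral>x. f x \<partial>lborel) = complex_of_real (exp (- (t\<^sup>2) / 2))"
    by (simp add: char_std_normal_distribution)
  have eq: "f (0 + c * x) = of_real (1 / sqrt (2 * pi)) * (complex_of_real (exp (- pi * v * x\<^sup>2)) * cis (2 * pi * (x * y)))" for x
  proof -
    have "- (c * x)\<^sup>2 / 2 = - pi * v * x\<^sup>2" by (simp add: power_mult_distrib c)
    hence "std_normal_density (c * x) = 1 / sqrt (2 * pi) * exp (- pi * v * x\<^sup>2)"
      by (simp only: std_normal_density_def)
    moreover have "t * (c * x) = 2 * pi * (x * y)" using c by (simp add: t_def)
    hence "iexp (t * (c * x)) = cis (2 * pi * (x * y))" by (simp only: cis_conv_exp)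
    ultimately show ?thesis
      by (simp only: f_def add_0 of_real_mult mult.assoc)
  qed
  have "integrable lborel (\<lambda>x. f (0 + c * x))"
    using intf c by (intro lborel_integrable_real_affine) auto
  hence "integrable lborel (\<lambda>x. of_real (sqrt (2 * pi)) * f (0 + c * x))" by simp
  thus "integrable lborel (\<lambda>x. complex_of_real (exp (- pi * v * x\<^sup>2)) * cis (2 * pi * (x * y)))"
  proof -
    have "of_real (sqrt (2 * pi)) * (of_real (1 / sqrt (2 * pi)) * Z) = Z" for Z :: complex by simp
    thus ?thesis using \<open>integrable lborel (\<lambda>x. of_real (sqrt (2 * pi)) * f (0 + c * x))\<close>
      by (simp only: eq)
  qed
  have "(\<integral>x. f x \<partial>lborel) = c *\<^sub>R (\<integral>x. f (0 + c * x) \<partial>lborel)"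
    using c by (subst lborel_integral_real_affine[of c f 0]) auto
  also have "(\<integral>x. f (0 + c * x) \<partial>lborel) =
      of_real (1 / sqrt (2 * pi)) * (\<integral>x. complex_of_real (exp (- pi * v * x\<^sup>2)) * cis (2 * pi * (x * y)) \<partial>lborel)"
    unfolding eq by (rule integral_mult_right_zero)
  finally have "(\<integral>x. f x \<partial>lborel) =
     of_real (c / sqrt (2 * pi)) * (\<integral>x. complex_of_real (exp (- pi * v * x\<^sup>2)) * cis (2 * pi * (x * y)) \<partial>lborel)"
    by (simp add: scaleR_conv_of_real)
  also have "c / sqrt (2 * pi) = sqrt v" by (simp add: c_def real_sqrt_mult)
  finally have "of_real (sqrt v) * (\<integral>x. complex_of_real (exp (- pi * v * x\<^sup>2)) * cis (2 * pi * (x * y)) \<partial>lborel)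
      = complex_of_real (exp (- (t\<^sup>2) / 2))" by (simp add: If)
  moreover have "t\<^sup>2 / 2 = pi * y\<^sup>2 / v"
    unfolding t_def power_divide c(2) using v by (simp add: power2_eq_square field_simps)
  ultimately have "(\<integral>x. complex_of_real (exp (- pi * v * x\<^sup>2)) * cis (2 * pi * (x * y)) \<partial>lborel)
      = complex_of_real (exp (- (pi * y\<^sup>2 / v))) / of_real (sqrt v)"
    using v by (simp add: field_simps)
  moreover have "v powr (- 1 / 2) = 1 / sqrt v"
    using v by (simp add: powr_minus_divide powr_half_sqrt)
  ultimately show "(\<integral>x. complex_of_real (exp (- pi * v * x\<^sup>2)) * cis (2 * pi * (x * y)) \<partial>lborel) =
      complex_of_real (v powr (- 1 / 2) * exp (- pi * y\<^sup>2 / v))"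
    by simp
qed

lemma integrable_exp_minus_abs:
  assumes "c > 0"
  shows "integrable lborel (\<lambda>x::real. exp (- c * \<bar>x\<bar>))"
proof -
  have "integrable lborel (\<lambda>x::real. indicator {0..} x * exp (- c * x))" (is "integrable _ ?g")
  proof (rule integrableI_nonneg)
    have "(\<integral>\<^sup>+ x. ennreal (?g x) \<partial>lborel) = ennreal (exp (- c * 0) / c)"
      using has_integral_exp_minus_to_infinity[OF assms, of 0]
      by (subst nn_integral_has_integral_lebesgue) auto
    thus "(\<integral>\<^sup>+ x. ennreal (?g x) \<partial>lborel) < \<infinity>" by simp
  qed auto
  hence "integrable lborel (\<lambda>x. ?g x + ?g (0 + (-1) * x))"
    by (intro Bochner_Integration.integrable_add lborel_integrable_real_affine) auto
  thus ?thesis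
    by (rule Bochner_Integration.integrable_bound) (auto simp: indicator_def)
qed

lemma exp_norm_sq_eq_prod:
  fixes x :: "'a::euclidean_space"
  shows "exp (a * (norm x)\<^sup>2) = (\<Prod>b\<in>Basis. exp (a * (x \<bullet> b)\<^sup>2))"
  unfolding power2_norm_eq_inner euclidean_inner[of x x]
  by (simp add: sum_distrib_left exp_sum power2_eq_square)

lemma cis_sum: "finite A \<Longrightarrow> cis (\<Sum>a\<in>A. f a) = (\<Prod>a\<in>A. cis (f a))"
  by (induction rule: finite_induct) (auto simp: cis_mult[symmetric])

lemma
  fixes x :: "'a::euclidean_space"
  assumes v: "v > 0"
  shows integrable_gaussian_cis_euclidean:
      "integrable lborel (\<lambda>\<xi>. complex_of_real (exp (- pi * v * (norm \<xi>)\<^sup>2)) * cis (2 * pi * (x \<bullet> \<xi>)))"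
    and integral_gaussian_cis_euclidean:
      "(\<integral>\<xi>. complex_of_real (exp (- pi * v * (norm \<xi>)\<^sup>2)) * cis (2 * pi * (x \<bullet> \<xi>)) \<partial>lborel) =
       complex_of_real (v powr (- real DIM('a) / 2) * exp (- pi * (norm x)\<^sup>2 / v))"
proof -
  let ?f = "\<lambda>b u. complex_of_real (exp (- pi * v * u\<^sup>2)) * cis (2 * pi * (u * (x \<bullet> b)))"
  have eq: "complex_of_real (exp (- pi * v * (norm \<xi>)\<^sup>2)) * cis (2 * pi * (x \<bullet> \<xi>)) = (\<Prod>b\<in>Basis. ?f b (\<xi> \<bullet> b))" for \<xi>
    by (subst exp_norm_sq_eq_prod, subst (1) euclidean_inner)
       (simp add: prod.distrib cis_sum sum_distrib_left mult_ac)
  show "integrable lborel (\<lambda>\<xi>. complex_of_real (exp (- pi * v * (norm \<xi>)\<^sup>2)) * cis (2 * pi * (x \<bullet> \<xi>)))"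
    unfolding eq using integrable_gaussian_cis[OF v] by (intro integrable_lborel_prod) auto
  have "(\<integral>\<xi>. complex_of_real (exp (- pi * v * (norm \<xi>)\<^sup>2)) * cis (2 * pi * (x \<bullet> \<xi>)) \<partial>lborel)
      = (\<Prod>b\<in>Basis. (\<integral>u. ?f b u \<partial>lborel))"
    unfolding eq by (rule integral_lborel_prod) (rule integrable_gaussian_cis[OF v])
  also have "\<dots> = (\<Prod>b\<in>(Basis::'a set). complex_of_real (v powr (- 1 / 2) * exp (- pi * (x \<bullet> b)\<^sup>2 / v)))"
    by (intro prod.cong refl integral_gaussian_cis v)
  also have "\<dots> = complex_of_real ((v powr (- 1 / 2)) ^ DIM('a) * (\<Prod>b\<in>(Basis::'a set). exp (- pi / v * (x \<bullet> b)\<^sup>2)))"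
    by (simp add: prod.distrib field_simps)
  also have "(\<Prod>b\<in>(Basis::'a set). exp (- pi / v * (x \<bullet> b)\<^sup>2)) = exp (- pi / v * (norm x)\<^sup>2)"
    by (rule exp_norm_sq_eq_prod[symmetric])
  also have "(v powr (- 1 / 2)) ^ DIM('a) = v powr (- real DIM('a) / 2)"
    using v by (simp add: powr_powr flip: powr_realpow)
  finally show "(\<integral>\<xi>. complex_of_real (exp (- pi * v * (norm \<xi>)\<^sup>2)) * cis (2 * pi * (x \<bullet> \<xi>)) \<partial>lborel) =
       complex_of_real (v powr (- real DIM('a) / 2) * exp (- pi * (norm x)\<^sup>2 / v))"
    by simp
qed

lemma
  assumes v: "v > 0"
  shows integrable_gaussian: "integrable lborel (\<lambda>x::'a::euclidean_space. exp (- pi * v * (norm x)\<^sup>2))"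
    and integral_gaussian: "(\<integral>x. exp (- pi * v * (norm (x::'a))\<^sup>2) \<partial>lborel) = v powr (- real DIM('a) / 2)"
    and nn_integral_gaussian: "(\<integral>\<^sup>+x. ennreal (exp (- pi * v * (norm (x::'a))\<^sup>2)) \<partial>lborel) = ennreal (v powr (- real DIM('a) / 2))"
proof -
  have "integrable lborel (\<lambda>x::'a. complex_of_real (exp (- pi * v * (norm x)\<^sup>2)))"
    using integrable_gaussian_cis_euclidean[OF v, of "0::'a"] by simp
  thus 1: "integrable lborel (\<lambda>x::'a. exp (- pi * v * (norm x)\<^sup>2))"
    by (simp only: complex_of_real_integrable_eq)
  have "complex_of_real (\<integral>x. exp (- pi * v * (norm (x::'a))\<^sup>2) \<partial>lborel) = complex_of_real (v powr (- real DIM('a) / 2))"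
    using integral_gaussian_cis_euclidean[OF v, of "0::'a"]
    by (subst integral_complex_of_real[symmetric]) simp
  thus 2: "(\<integral>x. exp (- pi * v * (norm (x::'a))\<^sup>2) \<partial>lborel) = v powr (- real DIM('a) / 2)"
    by (simp only: of_real_eq_iff)
  show "(\<integral>\<^sup>+x. ennreal (exp (- pi * v * (norm (x::'a))\<^sup>2)) \<partial>lborel) = ennreal (v powr (- real DIM('a) / 2))"
    using 1 2 by (subst nn_integral_eq_integral) auto
qed

text \<open>In the parameter \<open>y = ln v\<close>, scaling of \<open>v\<close> becomes a translation
  and inversion of \<open>v\<close> a reflection.\<close>

lemma has_bochner_integral_Gamma_exp:
  assumes z: "Re z > 0"
  shows "has_bochner_integral lborel (\<lambda>y. exp (of_real y * z) * of_real (exp (- exp y))) (Gamma z)"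
proof -
  let ?f = "\<lambda>t. of_real t powr (z - 1) / complex_of_real (exp t)"
  have "?f absolutely_integrable_on {0<..} \<and> integral {0<..} ?f = Gamma z"
    using absolutely_integrable_Gamma_integral'[OF z] Gamma_integral_complex'[OF z]
    by (auto simp: integral_unique)
  moreover have "exp ` (UNIV::real set) = {0<..}"
    by (auto simp: image_iff) (metis exp_ln)
  ultimately have "(\<lambda>y. \<bar>exp y\<bar> *\<^sub>R ?f (exp y)) absolutely_integrable_on UNIV \<and>
      integral UNIV (\<lambda>y. \<bar>exp y\<bar> *\<^sub>R ?f (exp y)) = Gamma z"
    by (subst has_absolute_integral_change_of_variables_real) (auto intro!: derivative_eq_intros inj_onI)
  moreover have "\<bar>exp y\<bar> *\<^sub>R ?f (exp y) = exp (of_real y * z) * of_real (exp (- exp y))" for y :: real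
  proof -
    have "of_real (exp y) powr (z - 1) = exp (of_real y * (z - 1))"
      by (simp add: powr_def exp_of_real[symmetric] mult.commute)
    hence "\<bar>exp y\<bar> *\<^sub>R ?f (exp y) = (of_real (exp y) * exp (of_real y * (z - 1))) * of_real (exp (- exp y))"
      by (simp add: scaleR_conv_of_real exp_minus divide_inverse)
    also have "of_real (exp y) * exp (of_real y * (z - 1)) = exp (of_real y * z)"
      by (simp add: exp_of_real[symmetric] exp_add[symmetric] algebra_simps)
    finally show ?thesis .
  qed
  ultimately have 1: "(\<lambda>y. exp (of_real y * z) * of_real (exp (- exp y))) absolutely_integrable_on UNIV"
    and 2: "integral UNIV (\<lambda>y. exp (of_real y * z) * of_real (exp (- exp y))) = Gamma z"
    by simp_all
  have [measurable]: "(\<lambda>y. exp (of_real y * z) * complex_of_real (exp (- exp y))) \<in> borel_measurable borel"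
    by measurable
  have 3: "integrable lborel (\<lambda>y. exp (of_real y * z) * complex_of_real (exp (- exp y)))"
    using 1 by (simp add: set_integrable_def integrable_completion)
  have "(\<integral>y. exp (of_real y * z) * of_real (exp (- exp y)) \<partial>lborel) = Gamma z"
    using 2 integral_lborel[OF 3] by simp
  thus ?thesis using 3 by (simp add: has_bochner_integral_iff)
qed

lemma has_bochner_integral_Gamma_exp_scaled:
  assumes z: "Re z > 0" and \<sigma>: "\<sigma> > 0"
  shows "has_bochner_integral lborel (\<lambda>y. exp (of_real y * z) * of_real (exp (- \<sigma> * exp y))) (Gamma z * of_real \<sigma> powr (- z))"
proof -
  let ?g = "\<lambda>y. exp (of_real y * z) * complex_of_real (exp (- exp y))"
  have "has_bochner_integral lborel (\<lambda>y. ?g (ln \<sigma> + 1 * y)) (Gamma z)"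
    using lborel_has_bochner_integral_real_affine_iff[of 1 ?g "Gamma z" "ln \<sigma>"] has_bochner_integral_Gamma_exp[OF z]
    by simp
  hence "has_bochner_integral lborel (\<lambda>y. ?g (ln \<sigma> + 1 * y) * of_real \<sigma> powr (- z)) (Gamma z * of_real \<sigma> powr (- z))"
    by (rule has_bochner_integral_mult_left)
  moreover have "?g (ln \<sigma> + 1 * y) * of_real \<sigma> powr (- z) = exp (of_real y * z) * of_real (exp (- \<sigma> * exp y))" for y
    using \<sigma> by (simp add: exp_add powr_def Ln_of_real ring_distribs mult_ac exp_minus)
  ultimately show ?thesis by simp
qed

lemma has_bochner_integral_Gamma_exp_real:
  fixes z \<sigma> :: real
  assumes z: "z > 0" and \<sigma>: "\<sigma> > 0"
  shows "has_bochner_integral lborel (\<lambda>y. exp (y * z) * exp (- \<sigma> * exp y)) (Gamma z * \<sigma> powr (- z))"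
proof -
  have "has_bochner_integral lborel (\<lambda>y. Re (exp (of_real y * of_real z) * of_real (exp (- \<sigma> * exp y))))
      (Re (Gamma (of_real z) * of_real \<sigma> powr (- of_real z)))"
    by (rule has_bochner_integral_Re, rule has_bochner_integral_Gamma_exp_scaled) (use assms in auto)
  moreover have "Re (Gamma (of_real z) * of_real \<sigma> powr (- of_real z)) = Gamma z * \<sigma> powr (- z)"
  proof -
    have "complex_of_real \<sigma> powr (- of_real z) = of_real (\<sigma> powr (- z))"
      using powr_of_real[of \<sigma> "- z"] \<sigma> by simp
    thus ?thesis by (simp add: Gamma_complex_of_real)
  qed
  moreover have "Re (exp (of_real y * of_real z) * of_real (exp (- \<sigma> * exp y))) = exp (y * z) * exp (- \<sigma> * exp y)" for y
  proof -
    have "exp (of_real y * of_real z) = complex_of_real (exp (y * z))"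
      by (simp add: exp_of_real[symmetric])
    thus ?thesis by simp
  qed
  ultimately show ?thesis by simp
qed

section \<open>The Mellin-Barnes integral of the Mittag-Leffler function\<close>

text \<open>Both bounds come from |sin (pi z)|^2 = (cosh (2 pi y) - cos (2 pi x)) / 2. The first
  holds on a whole vertical line but degenerates at integer x; the second is uniform in x and serves
  the horizontal sides of the contour, which pass above and below the poles.\<close>

lemma norm_sin_pi_ge:
  "\<bar>sin (pi * x)\<bar> / 2 * exp (pi * \<bar>y\<bar>) \<le> cmod (sin (of_real pi * Complex x y))" (is ?A)
  and norm_sin_pi_ge': "\<bar>y\<bar> \<ge> 1 \<Longrightarrow> 1 / 4 * exp (pi * \<bar>y\<bar>) \<le> cmod (sin (of_real pi * Complex x y))"
    (is "_ \<Longrightarrow> ?B")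
proof -
  define P where "P = exp (2 * (pi * \<bar>y\<bar>))"
  define S where "S = (sin (pi * x))\<^sup>2"
  have P1: "P \<ge> 1" by (simp add: P_def)
  have S: "0 \<le> S" "S \<le> 1" by (auto simp: S_def abs_square_le_1)
  have sq: "(exp (pi * \<bar>y\<bar>))\<^sup>2 = P" by (simp add: P_def flip: exp_of_nat_mult)
  have "exp (2 * (pi * y)) + inverse (exp (2 * (pi * y))) = P + 1 / P"
    by (cases "y \<ge> 0") (simp_all add: P_def abs_if exp_minus field_simps)
  moreover have "cos (2 * (pi * x)) = 1 - 2 * S"
    by (simp add: S_def cos_double_sin)
  ultimately have main: "(cmod (sin (of_real pi * Complex x y)))\<^sup>2 = (P + 1 / P - 2 + 4 * S) / 4"
    by (simp add: norm_sin_squared)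
  have "P + 1 / P - 2 = (P - 1)\<^sup>2 / P" using P1 by (simp add: field_simps power2_eq_square)
  hence "0 \<le> P + 1 / P - 2" using P1 by simp
  \<comment> \<open>This combination equals P + 1 / P - 2 + 4 S - S P, which is four times the
    difference of the squares to be compared.\<close>
  hence "0 \<le> (1 - S) * (P + 1 / P - 2) + S * (1 / P + 2)"
    using S P1 by (intro add_nonneg_nonneg mult_nonneg_nonneg) auto
  moreover have "(1 - S) * (P + Q - 2) + S * (Q + 2) = P + Q - 2 + 4 * S - S * P" for Q
    by (simp add: algebra_simps)
  ultimately have "S / 4 * P \<le> (P + 1 / P - 2 + 4 * S) / 4" by simp
  moreover have "(\<bar>sin (pi * x)\<bar> / 2 * exp (pi * \<bar>y\<bar>))\<^sup>2 = S / 4 * P"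
    by (simp add: power_mult_distrib sq S_def power_divide)
  ultimately show ?A by - (rule power2_le_imp_le, auto simp: main)
  show ?B if "\<bar>y\<bar> \<ge> 1"
  proof -
    have "2 * pi * 1 \<le> 2 * pi * \<bar>y\<bar>" using that by (intro mult_left_mono) auto
    hence "6 \<le> 2 * (pi * \<bar>y\<bar>)" using pi_gt3 by linarith
    hence "7 \<le> P" using exp_ge_add_one_self[of "2 * (pi * \<bar>y\<bar>)"] unfolding P_def by linarith
    moreover have "0 \<le> 1 / P" using P1 by simp
    ultimately have "1 / 16 * P \<le> (P + 1 / P - 2 + 4 * S) / 4" using S by argo
    moreover have "(1 / 4 * exp (pi * \<bar>y\<bar>))\<^sup>2 = 1 / 16 * P"
      by (simp add: power_mult_distrib sq power_divide)
    ultimately show ?B by - (rule power2_le_imp_le, auto simp: main)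
  qed
qed

text \<open>Since \<open>pi / sin (pi * s) = Gamma s * Gamma (1 - s)\<close>, the residues at \<open>s = - k\<close> are the terms of the
  Mittag-Leffler series at \<open>- exp \<omega>\<close>.\<close>

definition mb_integrand :: "real \<Rightarrow> complex \<Rightarrow> complex \<Rightarrow> complex" where
  "mb_integrand \<alpha> \<omega> s =
     of_real pi * rGamma (of_real \<alpha> * (1 - s)) * exp (- s * \<omega>) / sin (of_real pi * s)"

text \<open>The exponential rates decide: the sine gives decay pi |y|, the reciprocal Gamma factor
  growth \<alpha> pi |y| / 2, and exp (- s \<omega>) growth at most |Im \<omega>| |y|. The remaining
  rate is positive exactly under the angle condition. \<open>M\<close> is a parameter so that either
  sine bound can be inserted.\<close>

lemma norm_mb_integrand_le:
  assumes "\<alpha> > 0" "x < 1" "M > 0"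
    and M: "M * exp (pi * \<bar>y\<bar>) \<le> cmod (sin (of_real pi * Complex x y))"
  shows "cmod (mb_integrand \<alpha> \<omega> (Complex x y)) \<le>
    pi / M * exp (- x * Re \<omega>) / Gamma (\<alpha> * (1 - x) + 1) * (\<alpha> * (1 - x) + \<alpha> * \<bar>y\<bar>) *
    exp (- (pi - \<alpha> * pi / 2 - \<bar>Im \<omega>\<bar>) * \<bar>y\<bar>)"
proof -
  let ?G = "Gamma (\<alpha> * (1 - x) + 1)"
  have G: "?G > 0" using assms by (intro Gamma_real_pos) (simp add: add_pos_pos)
  have "of_real \<alpha> * (1 - Complex x y) = Complex (\<alpha> * (1 - x)) (- (\<alpha> * y))"
    by (simp add: complex_eq_iff)
  hence 1: "cmod (rGamma (of_real \<alpha> * (1 - Complex x y))) \<le>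
      (\<alpha> * (1 - x) + \<alpha> * \<bar>y\<bar>) * exp (pi * (\<alpha> * \<bar>y\<bar>) / 2) / ?G"
    using norm_rGamma_le'[of "\<alpha> * (1 - x)" "- (\<alpha> * y)"] assms by (simp add: abs_mult)
  have "y * Im \<omega> \<le> \<bar>y\<bar> * \<bar>Im \<omega>\<bar>" by (metis abs_ge_self abs_mult)
  hence 2: "cmod (exp (- Complex x y * \<omega>)) \<le> exp (- x * Re \<omega> + \<bar>y\<bar> * \<bar>Im \<omega>\<bar>)"
    by simp
  have "cmod (mb_integrand \<alpha> \<omega> (Complex x y)) =
      pi * cmod (rGamma (of_real \<alpha> * (1 - Complex x y))) * cmod (exp (- Complex x y * \<omega>))
        / cmod (sin (of_real pi * Complex x y))"
    by (simp add: mb_integrand_def norm_mult norm_divide)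
  also have "\<dots> \<le> pi * ((\<alpha> * (1 - x) + \<alpha> * \<bar>y\<bar>) * exp (pi * (\<alpha> * \<bar>y\<bar>) / 2) / ?G)
      * exp (- x * Re \<omega> + \<bar>y\<bar> * \<bar>Im \<omega>\<bar>) / (M * exp (pi * \<bar>y\<bar>))"
    using assms G by (intro frac_le mult_mono 1 2 M mult_nonneg_nonneg divide_nonneg_nonneg) auto
  also have "\<dots> = pi / M / ?G * (\<alpha> * (1 - x) + \<alpha> * \<bar>y\<bar>) *
      (exp (pi * (\<alpha> * \<bar>y\<bar>) / 2) * exp (- x * Re \<omega> + \<bar>y\<bar> * \<bar>Im \<omega>\<bar>) / exp (pi * \<bar>y\<bar>))"
    by (simp add: field_simps)
  also have "exp (pi * (\<alpha> * \<bar>y\<bar>) / 2) * exp (- x * Re \<omega> + \<bar>y\<bar> * \<bar>Im \<omega>\<bar>) / exp (pi * \<bar>y\<bar>)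
      = exp (- x * Re \<omega>) * exp (- (pi - \<alpha> * pi / 2 - \<bar>Im \<omega>\<bar>) * \<bar>y\<bar>)"
    by (simp add: field_simps flip: exp_add exp_diff)
  finally show ?thesis by (simp add: mult_ac)
qed

lemma residue_mb_integrand:
  assumes "\<alpha> > 0"
  shows "residue (mb_integrand \<alpha> \<omega>) (- of_nat k) = (- exp \<omega>) ^ k / of_real (Gamma (\<alpha> * real k + \<alpha>))"
proof -
  define f where "f = (\<lambda>s. of_real pi * rGamma (of_real \<alpha> * (1 - s)) * exp (- s * \<omega>))"
  have arg: "of_real \<alpha> * (1 - (- of_nat k)) = (complex_of_real (\<alpha> * real k + \<alpha>))"
    by (simp add: algebra_simps)
  have pos: "\<alpha> * real k + \<alpha> > 0" using assms by (intro add_nonneg_pos) auto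
  have rG: "rGamma (complex_of_real (\<alpha> * real k + \<alpha>)) = 1 / of_real (Gamma (\<alpha> * real k + \<alpha>))"
    by (simp only: rGamma_inverse_Gamma Gamma_complex_of_real) (simp add: inverse_eq_divide)
  have cosk: "cos (of_real pi * (- of_nat k)) = ((-1) ^ k :: complex)"
  proof -
    have "cos (of_real pi * (- of_nat k)) = cos (complex_of_real (pi * real k))" by simp
    also have "\<dots> = of_real (cos (pi * real k))" by (simp only: cos_of_real)
    finally show ?thesis by simp
  qed
  have sink: "sin (of_real pi * (- of_nat k)) = (0::complex)"
  proof -
    have "sin (of_real pi * (- of_nat k)) = - sin (complex_of_real (pi * real k))" by simp
    also have "\<dots> = - of_real (sin (pi * real k))" by (simp only: sin_of_real)
    finally show ?thesis by simp
  qed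
  have sink': "sin (of_real pi * of_nat k) = (0::complex)" and cosk': "cos (of_real pi * of_nat k) = ((-1) ^ k :: complex)"
    using sink cosk by simp_all
  have fk: "f (- of_nat k) = of_real pi * (exp \<omega> ^ k / of_real (Gamma (\<alpha> * real k + \<alpha>)))"
    unfolding f_def arg rG by (simp add: exp_of_nat_mult[symmetric])
  have "Gamma (\<alpha> * real k + \<alpha>) > 0" using pos by (rule Gamma_real_pos)
  hence "f (- of_nat k) \<noteq> 0" unfolding fk by simp
  hence "residue (\<lambda>s. f s / sin (of_real pi * s)) (- of_nat k) = f (- of_nat k) / (of_real pi * (-1) ^ k)"
    by (intro residue_simple_pole_deriv[where s = UNIV])
       (auto simp: f_def sink' cosk' intro!: holomorphic_intros derivative_eq_intros)
  also have "\<dots> = (- exp \<omega>) ^ k / of_real (Gamma (\<alpha> * real k + \<alpha>))"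
    by (cases "even k") (simp_all add: fk)
  finally show ?thesis by (simp add: mb_integrand_def[abs_def] f_def)
qed

lemma mb_integrand_holomorphic:
  assumes "\<And>z. z \<in> A \<Longrightarrow> z \<notin> \<int>"
  shows "mb_integrand \<alpha> \<omega> holomorphic_on A"
proof -
  have "sin (of_real pi * z) \<noteq> 0" if "z \<in> A" for z :: complex
  proof
    assume "sin (of_real pi * z) = 0"
    then obtain n :: int where "of_real pi * z = of_real (of_int n * pi)"
      unfolding sin_eq_0 by auto
    hence "z = of_int n" by simp
    thus False using assms[OF that] by simp
  qed
  thus ?thesis unfolding mb_integrand_def[abs_def]
    by (intro holomorphic_intros) auto
qed

text \<open>The left side of the rectangle stands midway between two poles, so exactly the poles 0,
  ..., -N lie inside. The vertical sides are kept as integrals; \<open>B\<close> is needed on the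
  horizontal sides alone.\<close>

lemma mb_contour:
  fixes N :: nat and \<omega> :: complex
  assumes "\<alpha> > 0" "0 < \<gamma>" "\<gamma> < 1" "T > 0"
    and B: "\<And>x y. - real N - 1 / 2 \<le> x \<Longrightarrow> x \<le> \<gamma> \<Longrightarrow> \<bar>y\<bar> = T \<Longrightarrow> cmod (mb_integrand \<alpha> \<omega> (Complex x y)) \<le> B"
  shows "cmod (2 * pi * (\<Sum>k\<le>N. (- exp \<omega>) ^ k / of_real (Gamma (\<alpha> * real k + \<alpha>))) -
      (integral {-T..T} (\<lambda>y. mb_integrand \<alpha> \<omega> (Complex \<gamma> y)) -
       integral {-T..T} (\<lambda>y. mb_integrand \<alpha> \<omega> (Complex (- real N - 1 / 2) y)))) \<le> 2 * B * (real N + 2)"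
proof -
  let ?F = "mb_integrand \<alpha> \<omega>"
  define c where "c = - real N - 1 / 2"
  \<comment> \<open>Both edges of the strip are the next zeros of the sine outside the rectangle, so
    the only integers in it are the enclosed poles.\<close>
  define S where "S = {z. - real N - 1 < Re z} \<inter> {z. Re z < 1}"
  define pts where "pts = (\<lambda>k. - of_nat k :: complex) ` {..N}"
  define a1 a2 a3 a4 where "a1 = Complex c (-T)" and "a2 = Complex \<gamma> (-T)"
    and "a3 = Complex \<gamma> T" and "a4 = Complex c T"
  let ?r = "rectpath a1 a3"
  have c: "c < \<gamma>" using assms by (simp add: c_def)
  have c1: "- real N - 1 < c" by (simp add: c_def)
  have c2: "c \<noteq> - real k" for k
  proof
    assume "c = - real k"
    hence "real (2 * N + 1) = real (2 * k)" by (simp add: c_def field_simps)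
    hence "2 * N + 1 = 2 * k" by (simp only: of_nat_eq_iff)
    thus False by presburger
  qed
  have Ints: "z \<in> pts" if "z \<in> S" "z \<in> \<int>" for z
  proof -
    obtain n where n: "z = of_int n" using \<open>z \<in> \<int>\<close> by (auto elim: Ints_cases)
    hence "- real N - 1 < of_int n" "of_int n < (1::real)" using that by (auto simp: S_def)
    hence "- int N - 1 < n" "n < 1" by linarith+
    hence "n = - int (nat (- n))" "nat (- n) \<le> N" by auto
    hence "z = - of_nat (nat (- n))" unfolding n by (metis of_int_minus of_int_of_nat_eq)
    thus ?thesis using \<open>nat (- n) \<le> N\<close> by (auto simp: pts_def)
  qed
  have pim: "path_image ?r = {z. Re z \<in> {c, \<gamma>} \<and> Im z \<in> {-T..T}} \<union> {z. Im z \<in> {-T, T} \<and> Re z \<in> {c..\<gamma>}}"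
    unfolding a1_def a3_def using assms c by (subst path_image_rectpath) auto
  have sub: "path_image ?r \<subseteq> S - pts"
    unfolding pim using assms c c1 by (auto simp: S_def pts_def c2 c2[symmetric])
  have holo: "?F holomorphic_on S - pts"
    using Ints by (intro mb_integrand_holomorphic) auto
  have cont: "continuous_on (path_image ?r) ?F"
    by (rule holomorphic_on_imp_continuous_on, rule holomorphic_on_subset[OF holo sub])
  have segs: "path_image ?r = closed_segment a1 a2 \<union> closed_segment a2 a3 \<union> closed_segment a3 a4 \<union> closed_segment a4 a1"
    unfolding rectpath_def Let_def a1_def a2_def a3_def a4_def by (simp add: path_image_join Un_assoc)
  have ci: "?F contour_integrable_on (linepath u v)"
    if "closed_segment u v \<subseteq> path_image ?r" for u v
    using continuous_on_subset[OF cont that] by (rule contour_integrable_continuous_linepath)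
  have "contour_integral ?r ?F = 2 * pi * \<i> * (\<Sum>p\<in>pts. winding_number ?r p * residue ?F p)"
  proof (rule Residue_theorem[OF _ _ _ holo _ _ sub])
    show "open S" unfolding S_def by (intro open_Int open_halfspace_Re_gt open_halfspace_Re_lt)
    show "connected S" unfolding S_def
      by (intro convex_connected convex_Int convex_halfspace_Re_gt convex_halfspace_Re_lt)
    show "finite pts" by (simp add: pts_def)
    show "\<forall>z. z \<notin> S \<longrightarrow> winding_number ?r z = 0"
    proof (intro allI impI winding_number_rectpath_outside)
      fix z assume "z \<notin> S"
      thus "z \<notin> cbox a1 a3" using c1 assms by (auto simp: S_def a1_def a3_def in_cbox_complex_iff)
    qed (use c assms in \<open>auto simp: a1_def a3_def\<close>)
  qed auto
  also have "(\<Sum>p\<in>pts. winding_number ?r p * residue ?F p) = (\<Sum>p\<in>pts. residue ?F p)"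
  proof (intro sum.cong refl)
    fix p assume "p \<in> pts"
    hence "p \<in> box a1 a3" using assms
      by (auto simp: pts_def a1_def a3_def in_box_complex_iff c_def)
    thus "winding_number ?r p * residue ?F p = residue ?F p" by (simp add: winding_number_rectpath)
  qed
  also have "(\<Sum>p\<in>pts. residue ?F p) = (\<Sum>k\<le>N. (- exp \<omega>) ^ k / of_real (Gamma (\<alpha> * real k + \<alpha>)))"
    (is "_ = ?sum")
    unfolding pts_def by (subst sum.reindex) (auto simp: inj_on_def residue_mb_integrand assms)
  finally have 1: "contour_integral ?r ?F = 2 * pi * \<i> * ?sum" .
  have rp: "?r = linepath a1 a2 +++ linepath a2 a3 +++ linepath a3 a4 +++ linepath a4 a1"
    unfolding rectpath_def Let_def a1_def a2_def a3_def a4_def by simp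
  have cis: "?F contour_integrable_on linepath a1 a2" "?F contour_integrable_on linepath a2 a3"
    "?F contour_integrable_on linepath a3 a4" "?F contour_integrable_on linepath a4 a1"
    using segs by (auto intro!: ci)
  have 2: "contour_integral ?r ?F = contour_integral (linepath a1 a2) ?F + (contour_integral (linepath a2 a3) ?F
      + (contour_integral (linepath a3 a4) ?F + contour_integral (linepath a4 a1) ?F))"
    unfolding rp using cis by (simp add: contour_integrable_join)
  have 3: "contour_integral (linepath a2 a3) ?F = \<i> * integral {-T..T} (\<lambda>y. ?F (Complex \<gamma> y))"
    using assms by (intro contour_integral_linepath_same_Re) (auto simp: a2_def a3_def)
  \<comment> \<open>The boundary runs down the left side, hence the difference of the two vertical
    integrals in the statement.\<close>
  have "contour_integral (linepath a4 a1) ?F = - contour_integral (linepath a1 a4) ?F"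
    using segs by (intro contour_integral_reverse_linepath continuous_on_subset[OF cont]) auto
  also have "contour_integral (linepath a1 a4) ?F = \<i> * integral {-T..T} (\<lambda>y. ?F (Complex c y))"
    using assms by (intro contour_integral_linepath_same_Re) (auto simp: a1_def a4_def)
  finally have 4: "contour_integral (linepath a4 a1) ?F = - (\<i> * integral {-T..T} (\<lambda>y. ?F (Complex c y)))" .
  have B0: "B \<ge> 0" using B[of \<gamma> T] c assms norm_ge_zero order_trans unfolding c_def
    by (metis abs_of_pos less_imp_le order_refl)
  have h: "cmod (contour_integral (linepath u v) ?F) \<le> B * cmod (v - u)"
    if uv: "(u, v) = (a1, a2) \<or> (u, v) = (a3, a4)" for u v
  proof (rule contour_integral_bound_linepath[OF _ B0])
    show "?F contour_integrable_on linepath u v" using uv cis by auto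
    fix z assume "z \<in> closed_segment u v"
    moreover have "closed_segment u v = {z. Im z = Im u \<and> Re z \<in> {c..\<gamma>}}"
      using uv c by (auto simp: a1_def a2_def a3_def a4_def closed_segment_same_Im closed_segment_commute
          closed_segment_eq_real_ivl)
    moreover have "\<bar>Im u\<bar> = T" using uv assms by (auto simp: a1_def a3_def)
    ultimately have "cmod (?F (Complex (Re z) (Im z))) \<le> B" by (intro B) (auto simp: c_def)
    thus "cmod (?F z) \<le> B" by simp
  qed
  have len: "cmod (a2 - a1) \<le> real N + 2" "cmod (a4 - a3) \<le> real N + 2"
    using assms cmod_le[of "a2 - a1"] cmod_le[of "a4 - a3"]
    by (auto simp: a1_def a2_def a3_def a4_def c_def)
  let ?I = "integral {-T..T} (\<lambda>y. ?F (Complex \<gamma> y)) - integral {-T..T} (\<lambda>y. ?F (Complex c y))"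
  have "\<i> * (2 * pi * ?sum - ?I) = contour_integral (linepath a1 a2) ?F + contour_integral (linepath a3 a4) ?F"
    using 1 2 3 4 by (simp add: algebra_simps)
  hence "cmod (\<i> * (2 * pi * ?sum - ?I)) \<le> cmod (contour_integral (linepath a1 a2) ?F) + cmod (contour_integral (linepath a3 a4) ?F)"
    using norm_triangle_ineq by metis
  also have "\<dots> \<le> B * (real N + 2) + B * (real N + 2)"
    using h[of a1 a2] h[of a3 a4] len B0
    by (intro add_mono) (auto elim!: order_trans intro!: mult_left_mono)
  also have "\<dots> = 2 * B * (real N + 2)" by simp
  finally show ?thesis by (simp only: norm_mult norm_ii mult_1_left c_def)
qed

lemma integrable_poly_exp_minus_abs:
  assumes "c > 0"
  shows "integrable lborel (\<lambda>x::real. (1 + \<bar>x\<bar>) ^ N * exp (- c * \<bar>x\<bar>))"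
proof -
  \<comment> \<open>\<open>e\<close> is so small that (1 + |x|)^N \<le> (1 / e)^N exp (c |x| / 2):
    half of the exponential decay pays for the polynomial.\<close>
  define e where "e = min 1 (c / (2 * (real N + 1)))"
  have e: "0 < e" "e \<le> 1" using assms by (auto simp: e_def)
  have Ne: "real N * e \<le> c / 2"
  proof -
    have "real N * e \<le> real N * (c / (2 * (real N + 1)))" by (intro mult_left_mono) (auto simp: e_def)
    also have "\<dots> \<le> c / 2" using assms by (simp add: field_simps)
    finally show ?thesis .
  qed
  have "integrable lborel (\<lambda>x::real. (1 / e) ^ N * exp (- (c / 2) * \<bar>x\<bar>))"
    by (intro integrable_mult_right integrable_exp_minus_abs) (use assms in auto)
  thus ?thesis
  proof (rule Bochner_Integration.integrable_bound)
    show "AE x in lborel. norm ((1 + \<bar>x\<bar>) ^ N * exp (- c * \<bar>x\<bar>)) \<le> norm ((1 / e) ^ N * exp (- (c / 2) * \<bar>x\<bar>))"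
    proof (rule AE_I2)
      fix x :: real
      have "e * (1 + \<bar>x\<bar>) \<le> 1 + e * \<bar>x\<bar>" using e by (simp add: algebra_simps)
      also have "\<dots> \<le> exp (e * \<bar>x\<bar>)" by (rule exp_ge_add_one_self)
      finally have "1 + \<bar>x\<bar> \<le> (1 / e) * exp (e * \<bar>x\<bar>)" using e by (simp add: field_simps)
      hence "(1 + \<bar>x\<bar>) ^ N \<le> ((1 / e) * exp (e * \<bar>x\<bar>)) ^ N" by (intro power_mono) auto
      also have "\<dots> = (1 / e) ^ N * exp (real N * e * \<bar>x\<bar>)"
        by (simp add: power_mult_distrib power_divide mult_ac flip: exp_of_nat_mult)
      also have "\<dots> \<le> (1 / e) ^ N * exp (c / 2 * \<bar>x\<bar>)"
        using e mult_right_mono[OF Ne, of "\<bar>x\<bar>"] by (intro mult_left_mono) auto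
      finally have "(1 + \<bar>x\<bar>) ^ N * exp (- c * \<bar>x\<bar>) \<le> (1 / e) ^ N * exp (c / 2 * \<bar>x\<bar>) * exp (- c * \<bar>x\<bar>)"
        by (intro mult_right_mono) auto
      also have "\<dots> = (1 / e) ^ N * exp (- (c / 2) * \<bar>x\<bar>)"
        by (simp add: mult.assoc flip: exp_add)
      finally show "norm ((1 + \<bar>x\<bar>) ^ N * exp (- c * \<bar>x\<bar>)) \<le> norm ((1 / e) ^ N * exp (- (c / 2) * \<bar>x\<bar>))"
        using e by simp
    qed
  qed auto
qed


lemma norm_mb_integrand_vertical_le:
  fixes \<omega> :: complex
  assumes "\<alpha> > 0" "x < 1" "sin (pi * x) \<noteq> 0"
  shows "cmod (mb_integrand \<alpha> \<omega> (Complex x y)) \<le>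
    2 * pi / \<bar>sin (pi * x)\<bar> * exp (- x * Re \<omega>) / Gamma (\<alpha> * (1 - x) + 1) * (\<alpha> * (1 - x) + \<alpha>) *
    ((1 + \<bar>y\<bar>) * exp (- (pi - \<alpha> * pi / 2 - \<bar>Im \<omega>\<bar>) * \<bar>y\<bar>))"
proof -
  let ?\<delta> = "pi - \<alpha> * pi / 2 - \<bar>Im \<omega>\<bar>"
  have G: "Gamma (\<alpha> * (1 - x) + 1) > 0" using assms by (intro Gamma_real_pos) (simp add: add_pos_pos)
  have "cmod (mb_integrand \<alpha> \<omega> (Complex x y)) \<le> pi / (\<bar>sin (pi * x)\<bar> / 2) * exp (- x * Re \<omega>) / Gamma (\<alpha> * (1 - x) + 1) *
      (\<alpha> * (1 - x) + \<alpha> * \<bar>y\<bar>) * exp (- ?\<delta> * \<bar>y\<bar>)"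
    using assms by (intro norm_mb_integrand_le norm_sin_pi_ge) auto
  also have "\<dots> \<le> pi / (\<bar>sin (pi * x)\<bar> / 2) * exp (- x * Re \<omega>) / Gamma (\<alpha> * (1 - x) + 1) *
      ((\<alpha> * (1 - x) + \<alpha>) * (1 + \<bar>y\<bar>)) * exp (- ?\<delta> * \<bar>y\<bar>)"
  proof (intro mult_right_mono mult_left_mono)
    have "(\<alpha> * (1 - x) + \<alpha>) * (1 + \<bar>y\<bar>) = \<alpha> * (1 - x) + \<alpha> * \<bar>y\<bar> + (\<alpha> + \<alpha> * (1 - x) * \<bar>y\<bar>)"
      by (simp add: algebra_simps)
    moreover have "0 \<le> \<alpha> + \<alpha> * (1 - x) * \<bar>y\<bar>"
      using assms by (intro add_nonneg_nonneg mult_nonneg_nonneg) auto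
    ultimately show "\<alpha> * (1 - x) + \<alpha> * \<bar>y\<bar> \<le> (\<alpha> * (1 - x) + \<alpha>) * (1 + \<bar>y\<bar>)"
      by linarith
  qed (use G in auto)
  finally show ?thesis by (simp add: mult_ac)
qed

text \<open>The bound on the integral is explicit in x, since x = -N - 1/2 is later sent to minus
  infinity, while the remaining integral over y does not depend on x.\<close>

lemma
  fixes \<omega> :: complex
  assumes "\<alpha> > 0" and Im: "\<bar>Im \<omega>\<bar> < pi - \<alpha> * pi / 2" and "x < 1" "sin (pi * x) \<noteq> 0"
  shows integrable_mb_integrand: "integrable lborel (\<lambda>y. mb_integrand \<alpha> \<omega> (Complex x y))"
    and mb_integrand_tendsto: "(\<lambda>n. integral {- real n..real n} (\<lambda>y. mb_integrand \<alpha> \<omega> (Complex x y)))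
      \<longlonglongrightarrow> (\<integral>y. mb_integrand \<alpha> \<omega> (Complex x y) \<partial>lborel)"
    and norm_integral_mb_integrand: "cmod (\<integral>y. mb_integrand \<alpha> \<omega> (Complex x y) \<partial>lborel) \<le>
      2 * pi / \<bar>sin (pi * x)\<bar> * exp (- x * Re \<omega>) / Gamma (\<alpha> * (1 - x) + 1) * (\<alpha> * (1 - x) + \<alpha>) *
      (\<integral>y. (1 + \<bar>y\<bar>) * exp (- (pi - \<alpha> * pi / 2 - \<bar>Im \<omega>\<bar>) * \<bar>y\<bar>) \<partial>lborel)"
proof -
  let ?F = "\<lambda>y. mb_integrand \<alpha> \<omega> (Complex x y)"
  define D where "D = 2 * pi / \<bar>sin (pi * x)\<bar> * exp (- x * Re \<omega>) / Gamma (\<alpha> * (1 - x) + 1) * (\<alpha> * (1 - x) + \<alpha>)"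
  define \<delta> where "\<delta> = pi - \<alpha> * pi / 2 - \<bar>Im \<omega>\<bar>"
  have bound: "cmod (?F y) \<le> D * ((1 + \<bar>y\<bar>) * exp (- \<delta> * \<bar>y\<bar>))" for y
    unfolding D_def \<delta>_def using assms by (intro norm_mb_integrand_vertical_le) auto
  have int0: "integrable lborel (\<lambda>y. (1 + \<bar>y\<bar>) * exp (- \<delta> * \<bar>y\<bar>))"
    using integrable_poly_exp_minus_abs[of \<delta> 1] Im by (simp add: \<delta>_def)
  hence int: "integrable lborel (\<lambda>y. D * ((1 + \<bar>y\<bar>) * exp (- \<delta> * \<bar>y\<bar>)))" by simp
  have contF: "continuous_on UNIV ?F"
  proof -
    have "sin (of_real pi * Complex x y) \<noteq> 0" for y
      using norm_sin_pi_ge[of x y] assms(4)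
      by (auto simp: mult_le_0_iff)
    thus ?thesis unfolding mb_integrand_def Complex_eq
      by (intro continuous_intros continuous_on_compose2[OF continuous_on_rGamma[of UNIV]]) auto
  qed
  hence [measurable]: "?F \<in> borel_measurable borel" by (rule borel_measurable_continuous_onI)
  show intF: "integrable lborel ?F"
    using int by (rule Bochner_Integration.integrable_bound) (simp, intro AE_I2, simp only: real_norm_def order_trans[OF bound abs_ge_self])
  have "(\<lambda>n. \<integral>y. indicator {- real n..real n} y *\<^sub>R ?F y \<partial>lborel) \<longlonglongrightarrow> (\<integral>y. ?F y \<partial>lborel)"
  proof (rule integral_dominated_convergence[OF _ _ int])
    show "AE y in lborel. (\<lambda>n. indicator {- real n..real n} y *\<^sub>R ?F y) \<longlonglongrightarrow> ?F y"
    proof (rule AE_I2)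
      fix y :: real
      obtain m :: nat where m: "\<bar>y\<bar> \<le> real m" using real_arch_simple by blast
      have "eventually (\<lambda>n. indicator {- real n..real n} y *\<^sub>R ?F y = ?F y) sequentially"
        using eventually_ge_at_top[of m]
      proof eventually_elim
        case (elim n)
        hence "real m \<le> real n" by simp
        thus ?case using m by (auto simp: indicator_def)
      qed
      thus "(\<lambda>n. indicator {- real n..real n} y *\<^sub>R ?F y) \<longlonglongrightarrow> ?F y" by (rule tendsto_eventually)
    qed
    show "AE y in lborel. norm (indicator {- real n..real n} y *\<^sub>R ?F y) \<le> D * ((1 + \<bar>y\<bar>) * exp (- \<delta> * \<bar>y\<bar>))" for n
      using bound order_trans[OF norm_ge_zero bound] by (simp add: indicator_def)
  qed auto
  moreover have "(\<integral>y. indicator {- real n..real n} y *\<^sub>R ?F y \<partial>lborel) = integral {- real n..real n} ?F" for n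
    using set_borel_integral_eq_integral(2)[of "{- real n..real n}" ?F]
      set_integrable_subset[of lborel UNIV ?F "{- real n..real n}"] intF
    by (simp add: set_lebesgue_integral_def set_integrable_def)
  ultimately show "(\<lambda>n. integral {- real n..real n} ?F) \<longlonglongrightarrow> (\<integral>y. ?F y \<partial>lborel)" by simp
  have "cmod (\<integral>y. ?F y \<partial>lborel) \<le> (\<integral>y. D * ((1 + \<bar>y\<bar>) * exp (- \<delta> * \<bar>y\<bar>)) \<partial>lborel)"
    by (rule order_trans[OF integral_norm_bound integral_mono[OF integrable_norm[OF intF] int bound]])
  thus "cmod (\<integral>y. ?F y \<partial>lborel) \<le> 2 * pi / \<bar>sin (pi * x)\<bar> * exp (- x * Re \<omega>) / Gamma (\<alpha> * (1 - x) + 1) * (\<alpha> * (1 - x) + \<alpha>) *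
      (\<integral>y. (1 + \<bar>y\<bar>) * exp (- (pi - \<alpha> * pi / 2 - \<bar>Im \<omega>\<bar>) * \<bar>y\<bar>) \<partial>lborel)"
    by (simp add: D_def \<delta>_def)
qed

text \<open>The first of two limits: the height of the rectangle goes to infinity with N fixed, so
  the constants may depend on N and only the decay in y matters.\<close>

lemma mb_finite_sum:
  fixes \<omega> :: complex
  assumes "\<alpha> > 0" and Im: "\<bar>Im \<omega>\<bar> < pi - \<alpha> * pi / 2" and "0 < \<gamma>" "\<gamma> < 1"
  shows "2 * pi * (\<Sum>k\<le>N. (- exp \<omega>) ^ k / of_real (Gamma (\<alpha> * real k + \<alpha>))) =
      (\<integral>y. mb_integrand \<alpha> \<omega> (Complex \<gamma> y) \<partial>lborel) -
      (\<integral>y. mb_integrand \<alpha> \<omega> (Complex (- real N - 1 / 2) y) \<partial>lborel)"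
proof -
  define \<delta> where "\<delta> = pi - \<alpha> * pi / 2 - \<bar>Im \<omega>\<bar>"
  have \<delta>: "\<delta> > 0" using Im by (simp add: \<delta>_def)
  define c where "c = - real N - 1 / 2"
  \<comment> \<open>1/4 is the sine bound for |y| \<ge> 1, which is uniform across the poles; exp 2
    bounds 1 / Gamma for arguments at least 1; and |x| \<le> N + 1 on the rectangle.\<close>
  define D where "D = pi / (1 / 4) * exp ((real N + 1) * \<bar>Re \<omega>\<bar>) * exp 2"
  define B where "B = (\<lambda>n. D * (\<alpha> * (real N + 2) + \<alpha> * real n) * exp (- \<delta> * real n))"
  let ?I = "\<lambda>x n. integral {- real n..real n} (\<lambda>y. mb_integrand \<alpha> \<omega> (Complex x y))"
  let ?S = "2 * pi * (\<Sum>k\<le>N. (- exp \<omega>) ^ k / of_real (Gamma (\<alpha> * real k + \<alpha>)))"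
  have le: "cmod (?S - (?I \<gamma> n - ?I c n)) \<le> 2 * B n * (real N + 2)" if "n \<ge> 1" for n
  proof -
    have "cmod (mb_integrand \<alpha> \<omega> (Complex x y)) \<le> B n"
      if x: "- real N - 1 / 2 \<le> x" "x \<le> \<gamma>" and y: "\<bar>y\<bar> = real n" for x y
    proof -
      have a: "1 \<le> \<alpha> * (1 - x) + 1" using assms x by simp
      have "exp (- 2) \<le> Gamma (\<alpha> * (1 - x) + 1)"
        using Gamma_real_ge_power[OF a, of 1] by simp
      hence G: "1 / Gamma (\<alpha> * (1 - x) + 1) \<le> exp 2"
        using a by (simp add: exp_minus field_simps Gamma_real_pos)
      have G0: "Gamma (\<alpha> * (1 - x) + 1) > 0" using a by (intro Gamma_real_pos) auto
      have "- x * Re \<omega> \<le> \<bar>x\<bar> * \<bar>Re \<omega>\<bar>" by (metis abs_ge_self abs_minus_cancel abs_mult)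
      also have "\<dots> \<le> (real N + 1) * \<bar>Re \<omega>\<bar>" using x assms by (intro mult_right_mono) auto
      finally have e: "exp (- x * Re \<omega>) \<le> exp ((real N + 1) * \<bar>Re \<omega>\<bar>)" by simp
      have "cmod (mb_integrand \<alpha> \<omega> (Complex x y)) \<le> pi / (1 / 4) * exp (- x * Re \<omega>) / Gamma (\<alpha> * (1 - x) + 1)
          * (\<alpha> * (1 - x) + \<alpha> * \<bar>y\<bar>) * exp (- (pi - \<alpha> * pi / 2 - \<bar>Im \<omega>\<bar>) * \<bar>y\<bar>)"
        using assms x y \<open>n \<ge> 1\<close> by (intro norm_mb_integrand_le norm_sin_pi_ge') auto
      also have "\<dots> = pi / (1 / 4) * exp (- x * Re \<omega>) * (1 / Gamma (\<alpha> * (1 - x) + 1))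
          * (\<alpha> * (1 - x) + \<alpha> * real n) * exp (- \<delta> * real n)"
        using y by (simp add: \<delta>_def)
      also have "\<dots> \<le> pi / (1 / 4) * exp ((real N + 1) * \<bar>Re \<omega>\<bar>) * exp 2
          * (\<alpha> * (real N + 2) + \<alpha> * real n) * exp (- \<delta> * real n)"
        using assms x G0 G
        by (intro mult_mono mult_left_mono[OF e] e add_mono mult_left_mono[where c = \<alpha>] mult_nonneg_nonneg order_refl
            add_nonneg_nonneg) auto
      finally show ?thesis by (simp add: B_def D_def)
    qed
    thus ?thesis unfolding c_def using assms that by (intro mb_contour) auto
  qed
  have sinc: "sin (pi * c) \<noteq> 0"
  proof -
    have "sin (pi * c) = - sin (pi / 2 + real N * pi)"
      by (simp add: c_def algebra_simps flip: sin_minus)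
    also have "\<dots> = - ((- 1) ^ N)" by (simp add: sin_add)
    finally show ?thesis by simp
  qed
  have sing: "sin (pi * \<gamma>) \<noteq> 0"
    using sin_gt_zero[of "pi * \<gamma>"] assms by simp
  have lim1: "(\<lambda>n. ?S - (?I \<gamma> n - ?I c n)) \<longlonglongrightarrow> ?S - ((\<integral>y. mb_integrand \<alpha> \<omega> (Complex \<gamma> y) \<partial>lborel) -
      (\<integral>y. mb_integrand \<alpha> \<omega> (Complex c y) \<partial>lborel))"
    using assms sinc sing by (intro tendsto_intros mb_integrand_tendsto) (auto simp: c_def)
  have "B \<longlonglongrightarrow> 0"
    unfolding B_def using \<delta> by real_asymp
  have "(\<lambda>n. ?S - (?I \<gamma> n - ?I c n)) \<longlonglongrightarrow> 0"
  proof (rule Lim_null_comparison)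
    show "eventually (\<lambda>n. cmod (?S - (?I \<gamma> n - ?I c n)) \<le> 2 * B n * (real N + 2)) sequentially"
      using eventually_ge_at_top[of 1] by eventually_elim (rule le)
    show "(\<lambda>n. 2 * B n * (real N + 2)) \<longlonglongrightarrow> 0"
      by (rule tendsto_eq_intros \<open>B \<longlonglongrightarrow> 0\<close> refl)+ simp
  qed
  hence "?S - ((\<integral>y. mb_integrand \<alpha> \<omega> (Complex \<gamma> y) \<partial>lborel) -
      (\<integral>y. mb_integrand \<alpha> \<omega> (Complex c y) \<partial>lborel)) = 0"
    using lim1 LIMSEQ_unique by blast
  thus ?thesis by (simp add: c_def)
qed

text \<open>The second limit: N goes to infinity and the integral over the left side tends to 0.
  Hence the partial sums converge, and convergence of the series in \<open>mittag_leffler\<close>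
  comes out together with its value.\<close>

theorem mittag_leffler_Mellin_Barnes:
  fixes \<omega> :: complex
  assumes "\<alpha> > 0" and Im: "\<bar>Im \<omega>\<bar> < pi - \<alpha> * pi / 2" and "0 < \<gamma>" "\<gamma> < 1"
  shows "mittag_leffler \<alpha> \<alpha> (- exp \<omega>) = (\<integral>y. mb_integrand \<alpha> \<omega> (Complex \<gamma> y) \<partial>lborel) / (2 * pi)"
proof -
  define c where "c = (\<lambda>N::nat. - real N - 1 / 2)"
  let ?R = "\<lambda>N. (\<integral>y. mb_integrand \<alpha> \<omega> (Complex (c N) y) \<partial>lborel)"
  define J where "J = (\<integral>y. (1 + \<bar>y\<bar>) * exp (- (pi - \<alpha> * pi / 2 - \<bar>Im \<omega>\<bar>) * \<bar>y\<bar>) \<partial>lborel)"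
  have J: "J \<ge> 0" by (simp add: J_def)
  \<comment> \<open>With this base the lower bound for Gamma at \<alpha> (1 - c N) + 1 contains exp
    ((|Re \<omega>| + 1) (N + 3/2)), which beats exp (- c N Re \<omega>) and leaves a spare factor
    exp (- (N + 3/2)).\<close>
  define M where "M = exp ((\<bar>Re \<omega>\<bar> + 1) / \<alpha>)"
  define b where "b = (\<lambda>N. 2 * pi * exp (M + 1) * exp (- (real N + 3 / 2)) * (\<alpha> * (real N + 5 / 2)) * J)"
  have R: "cmod (?R N) \<le> b N" for N
  proof -
    have "sin (pi * c N) = - sin (pi / 2 + real N * pi)"
      by (simp add: c_def algebra_simps flip: sin_minus)
    also have "\<dots> = - ((- 1) ^ N)" by (simp add: sin_add)
    finally have sinc: "\<bar>sin (pi * c N)\<bar> = 1" by simp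
    let ?w = "\<alpha> * (1 - c N) + 1"
    have w: "?w \<ge> 1" using assms by (simp add: c_def)
    have G0: "Gamma ?w > 0" using w by (intro Gamma_real_pos) auto
    have "M powr (?w - 1) = exp ((\<bar>Re \<omega>\<bar> + 1) * (real N + 3 / 2))"
      using assms by (simp add: M_def powr_def c_def)
    hence G: "exp ((\<bar>Re \<omega>\<bar> + 1) * (real N + 3 / 2)) * exp (- (M + 1)) \<le> Gamma ?w"
      using Gamma_real_ge_power[OF w, of M] by (simp add: M_def)
    have "- c N * Re \<omega> = (real N + 1 / 2) * Re \<omega>" by (simp add: c_def)
    also have "\<dots> \<le> (real N + 1 / 2) * \<bar>Re \<omega>\<bar>" by (intro mult_left_mono) auto
    also have "\<dots> \<le> (real N + 3 / 2) * \<bar>Re \<omega>\<bar>" by (intro mult_right_mono) auto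
    finally have "- c N * Re \<omega> \<le> (real N + 3 / 2) * \<bar>Re \<omega>\<bar>" .
    hence "exp (- c N * Re \<omega>) / Gamma ?w \<le> exp ((real N + 3 / 2) * \<bar>Re \<omega>\<bar>) / (exp ((\<bar>Re \<omega>\<bar> + 1) * (real N + 3 / 2)) * exp (- (M + 1)))"
      using G by (intro frac_le) auto
    also have "\<dots> = exp (M + 1) * exp (- (real N + 3 / 2))"
      by (simp add: algebra_simps flip: exp_add exp_diff)
    finally have E: "exp (- c N * Re \<omega>) / Gamma ?w \<le> exp (M + 1) * exp (- (real N + 3 / 2))" .
    have "cmod (?R N) \<le> 2 * pi / \<bar>sin (pi * c N)\<bar> * exp (- c N * Re \<omega>) / Gamma ?w * (\<alpha> * (1 - c N) + \<alpha>) * J"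
      unfolding J_def using assms sinc
      by (intro norm_integral_mb_integrand) (auto simp: c_def)
    also have "\<dots> = 2 * pi * (exp (- c N * Re \<omega>) / Gamma ?w) * (\<alpha> * (real N + 5 / 2)) * J"
      using sinc by (simp add: c_def algebra_simps)
    also have "\<dots> \<le> 2 * pi * (exp (M + 1) * exp (- (real N + 3 / 2))) * (\<alpha> * (real N + 5 / 2)) * J"
      using J assms by (intro mult_right_mono mult_left_mono E) auto
    finally show ?thesis by (simp add: b_def mult_ac)
  qed
  have "(\<lambda>N. exp (- (real N + 3 / 2)) * (real N + 5 / 2)) \<longlonglongrightarrow> 0" by real_asymp
  hence "(\<lambda>N. (2 * pi * exp (M + 1) * \<alpha> * J) * (exp (- (real N + 3 / 2)) * (real N + 5 / 2))) \<longlonglongrightarrow> 0"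
    by (rule tendsto_mult_right_zero)
  hence "b \<longlonglongrightarrow> 0" by (simp add: b_def mult_ac)
  hence R0: "?R \<longlonglongrightarrow> 0" by (rule Lim_null_comparison[rotated]) (use R in auto)
  let ?I = "(\<integral>y. mb_integrand \<alpha> \<omega> (Complex \<gamma> y) \<partial>lborel)"
  have "(\<Sum>k\<le>N. (- exp \<omega>) ^ k / of_real (Gamma (\<alpha> * real k + \<alpha>))) = (?I - ?R N) / (2 * pi)" for N
    using mb_finite_sum[OF assms, of N] by (simp add: c_def field_simps)
  moreover have "(\<lambda>N. (?I - ?R N) / (2 * pi)) \<longlonglongrightarrow> (?I - 0) / (2 * pi)"
    by (intro tendsto_intros R0) auto
  ultimately have "(\<lambda>k. (- exp \<omega>) ^ k / of_real (Gamma (\<alpha> * real k + \<alpha>))) sums (?I / (2 * pi))"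
    by (simp add: sums_def_le)
  thus ?thesis unfolding mittag_leffler_def by (rule sums_unique[symmetric])
qed

section \<open>Integrability of powers and of Schwartz functions\<close>

text \<open>Gamma s (1 + |x|^2)^(-s) is a mixture of the Gaussians exp (- (1 + |x|^2) exp y).
  Tonelli and the Gaussian integral leave the Gamma integral at s - d/2, which is positive by
  assumption.\<close>

lemma integrable_inverse_one_plus_norm:
  assumes s: "s > DIM('a) / 2"
  shows "integrable lborel (\<lambda>x::'a::euclidean_space. (1 + (norm x)\<^sup>2) powr (- s))"
proof (rule integrableI_nonneg)
  let ?d = "real DIM('a)"
  have s0: "s > 0" using s by (rule le_less_trans[rotated]) simp
  have G: "Gamma s > 0" using s0 by (rule Gamma_real_pos)
  have "ennreal (Gamma s) * (\<integral>\<^sup>+x. ennreal ((1 + (norm (x::'a))\<^sup>2) powr (- s)) \<partial>lborel)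
      = (\<integral>\<^sup>+x. ennreal (Gamma s * (1 + (norm (x::'a))\<^sup>2) powr (- s)) \<partial>lborel)"
    using G by (subst nn_integral_cmult[symmetric]) (auto simp: ennreal_mult)
  also have "\<dots> = (\<integral>\<^sup>+(x::'a). (\<integral>\<^sup>+y. ennreal (exp (y * s) * exp (- (1 + (norm x)\<^sup>2) * exp y)) \<partial>lborel) \<partial>lborel)"
  proof (intro nn_integral_cong)
    fix x :: 'a
    have "has_bochner_integral lborel (\<lambda>y. exp (y * s) * exp (- (1 + (norm x)\<^sup>2) * exp y)) (Gamma s * (1 + (norm x)\<^sup>2) powr (- s))"
      using s0 by (intro has_bochner_integral_Gamma_exp_real) (auto intro: add_pos_nonneg)
    thus "ennreal (Gamma s * (1 + (norm x)\<^sup>2) powr (- s)) =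
        (\<integral>\<^sup>+y. ennreal (exp (y * s) * exp (- (1 + (norm x)\<^sup>2) * exp y)) \<partial>lborel)"
      by (subst nn_integral_eq_integral) (auto simp: has_bochner_integral_iff)
  qed
  also have "\<dots> = (\<integral>\<^sup>+y. (\<integral>\<^sup>+(x::'a). ennreal (exp (y * s) * exp (- (1 + (norm x)\<^sup>2) * exp y)) \<partial>lborel) \<partial>lborel)"
    by (rule lborel_pair.Fubini') measurable
  also have "\<dots> = (\<integral>\<^sup>+y. ennreal (pi powr (?d / 2)) * ennreal (exp (y * (s - ?d / 2)) * exp (- 1 * exp y)) \<partial>lborel)"
  proof (intro nn_integral_cong)
    fix y :: real
    have "(\<integral>\<^sup>+(x::'a). ennreal (exp (y * s) * exp (- (1 + (norm x)\<^sup>2) * exp y)) \<partial>lborel) =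
        (\<integral>\<^sup>+(x::'a). ennreal (exp (y * s) * exp (- exp y)) * ennreal (exp (- pi * (exp y / pi) * (norm x)\<^sup>2)) \<partial>lborel)"
    proof (intro nn_integral_cong)
      fix x :: 'a
      have "- (1 + (norm x)\<^sup>2) * exp y = - exp y + - pi * (exp y / pi) * (norm x)\<^sup>2"
        by (simp add: algebra_simps)
      hence "exp (y * s) * exp (- (1 + (norm x)\<^sup>2) * exp y) =
          exp (y * s) * exp (- exp y) * exp (- pi * (exp y / pi) * (norm x)\<^sup>2)"
        by (simp only: exp_add mult.assoc)
      thus "ennreal (exp (y * s) * exp (- (1 + (norm x)\<^sup>2) * exp y)) =
          ennreal (exp (y * s) * exp (- exp y)) * ennreal (exp (- pi * (exp y / pi) * (norm x)\<^sup>2))"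
        by (simp only: ennreal_mult''[OF exp_ge_zero])
    qed
    also have "\<dots> = ennreal (exp (y * s) * exp (- exp y)) * ennreal ((exp y / pi) powr (- ?d / 2))"
      by (subst nn_integral_cmult, measurable) (subst nn_integral_gaussian, auto)
    also have "\<dots> = ennreal (exp (y * s) * exp (- exp y) * (exp y / pi) powr (- ?d / 2))"
      by (simp add: ennreal_mult)
    also have "(exp y / pi) powr (- ?d / 2) = exp (- (y * ?d / 2)) * pi powr (?d / 2)"
    proof -
      have "- ?d / 2 * ln (exp y / pi) = - (y * ?d / 2) + ?d / 2 * ln pi"
        by (simp add: ln_div field_simps)
      thus ?thesis by (simp only: powr_def exp_add) simp
    qed
    also have "exp (y * s) * exp (- exp y) * (exp (- (y * ?d / 2)) * pi powr (?d / 2)) =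
        pi powr (?d / 2) * (exp (y * (s - ?d / 2)) * exp (- 1 * exp y))"
    proof -
      have "y * (s - ?d / 2) = y * s + - (y * ?d / 2)" by (simp add: algebra_simps)
      thus ?thesis by (simp only: exp_add) simp
    qed
    finally show "(\<integral>\<^sup>+(x::'a). ennreal (exp (y * s) * exp (- (1 + (norm x)\<^sup>2) * exp y)) \<partial>lborel) =
        ennreal (pi powr (?d / 2)) * ennreal (exp (y * (s - ?d / 2)) * exp (- 1 * exp y))"
      by (simp add: ennreal_mult)
  qed
  also have "\<dots> = ennreal (pi powr (?d / 2)) * (\<integral>\<^sup>+y. ennreal (exp (y * (s - ?d / 2)) * exp (- 1 * exp y)) \<partial>lborel)"
    by (rule nn_integral_cmult) measurable
  also have "\<dots> < \<infinity>"
  proof -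
    have "integrable lborel (\<lambda>y. exp (y * (s - ?d / 2)) * exp (- 1 * exp y))"
      using has_bochner_integral_Gamma_exp_real[of "s - ?d / 2" 1] s by (simp add: has_bochner_integral_iff)
    thus ?thesis by (subst nn_integral_eq_integral) (auto simp: ennreal_mult_less_top)
  qed
  finally show "(\<integral>\<^sup>+x. ennreal ((1 + (norm (x::'a))\<^sup>2) powr (- s)) \<partial>lborel) < \<infinity>"
    using G by (auto simp: ennreal_mult_less_top)
qed auto

text \<open>The same mixture with s = a / 2. Integration in x leaves a multiple of exp (y s) (1 +
  exp y)^(-d/2), which decays as y tends to minus infinity because s > 0, and to plus infinity
  because s < d/2; \<open>c\<close> is the smaller of the two rates.\<close>

lemma integrable_norm_powr_gaussian:
  fixes a :: real
  assumes a: "0 < a" "a < DIM('a)"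
  shows "integrable lborel (\<lambda>x::'a::euclidean_space. norm x powr (- a) * exp (- (norm x)\<^sup>2))"
proof (rule integrableI_nonneg)
  let ?d = "real DIM('a)"
  define s where "s = a / 2"
  have s0: "s > 0" "s < ?d / 2" using a by (auto simp: s_def)
  have G: "Gamma s > 0" using s0 by (intro Gamma_real_pos) auto
  define c where "c = min s (?d / 2 - s)"
  have c: "c > 0" using s0 by (simp add: c_def)
  have "ennreal (Gamma s) * (\<integral>\<^sup>+x. ennreal (norm (x::'a) powr (- a) * exp (- (norm x)\<^sup>2)) \<partial>lborel)
      = (\<integral>\<^sup>+x. ennreal (Gamma s * (norm (x::'a) powr (- a) * exp (- (norm x)\<^sup>2))) \<partial>lborel)"
    using G by (subst nn_integral_cmult[symmetric]) (auto simp: ennreal_mult)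
  \<comment> \<open>Only an inequality: at x = 0 the left side is 0 by the value of
    \<open>0 powr (- a)\<close>, while the mixture diverges there.\<close>
  also have "\<dots> \<le> (\<integral>\<^sup>+(x::'a). (\<integral>\<^sup>+y. ennreal (exp (y * s) * exp (- (norm x)\<^sup>2 * exp y) * exp (- (norm x)\<^sup>2)) \<partial>lborel) \<partial>lborel)"
  proof (intro nn_integral_mono)
    fix x :: 'a
    show "ennreal (Gamma s * (norm x powr (- a) * exp (- (norm x)\<^sup>2))) \<le>
        (\<integral>\<^sup>+y. ennreal (exp (y * s) * exp (- (norm x)\<^sup>2 * exp y) * exp (- (norm x)\<^sup>2)) \<partial>lborel)"
    proof (cases "x = 0")
      case False
      have "has_bochner_integral lborel (\<lambda>y. exp (y * s) * exp (- (norm x)\<^sup>2 * exp y)) (Gamma s * (norm x)\<^sup>2 powr (- s))"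
        using s0 False by (intro has_bochner_integral_Gamma_exp_real) auto
      hence "has_bochner_integral lborel (\<lambda>y. exp (y * s) * exp (- (norm x)\<^sup>2 * exp y) * exp (- (norm x)\<^sup>2))
          (Gamma s * (norm x)\<^sup>2 powr (- s) * exp (- (norm x)\<^sup>2))"
        by (rule has_bochner_integral_mult_left)
      moreover have "(norm x)\<^sup>2 powr (- s) = norm x powr (- a)"
        using False by (simp add: s_def powr_powr flip: powr_numeral)
      ultimately show ?thesis
        by (subst nn_integral_eq_integral) (auto simp: has_bochner_integral_iff mult.assoc)
    qed simp
  qed
  also have "\<dots> = (\<integral>\<^sup>+y. (\<integral>\<^sup>+(x::'a). ennreal (exp (y * s) * exp (- (norm x)\<^sup>2 * exp y) * exp (- (norm x)\<^sup>2)) \<partial>lborel) \<partial>lborel)"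
    by (rule lborel_pair.Fubini') measurable
  also have "\<dots> \<le> (\<integral>\<^sup>+y. ennreal (pi powr (?d / 2)) * ennreal (exp (- c * \<bar>y\<bar>)) \<partial>lborel)"
  proof (intro nn_integral_mono)
    fix y :: real
    have "(\<integral>\<^sup>+(x::'a). ennreal (exp (y * s) * exp (- (norm x)\<^sup>2 * exp y) * exp (- (norm x)\<^sup>2)) \<partial>lborel) =
        (\<integral>\<^sup>+(x::'a). ennreal (exp (y * s)) * ennreal (exp (- pi * ((1 + exp y) / pi) * (norm x)\<^sup>2)) \<partial>lborel)"
    proof (intro nn_integral_cong)
      fix x :: 'a
      have "- pi * ((1 + exp y) / pi) * (norm x)\<^sup>2 = - (1 + exp y) * (norm x)\<^sup>2"
        by simp
      also have "\<dots> = - (norm x)\<^sup>2 * exp y + - (norm x)\<^sup>2"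
        by (simp add: ring_distribs)
      finally have "- pi * ((1 + exp y) / pi) * (norm x)\<^sup>2 = - (norm x)\<^sup>2 * exp y + - (norm x)\<^sup>2" .
      hence "exp (y * s) * exp (- (norm x)\<^sup>2 * exp y) * exp (- (norm x)\<^sup>2) =
          exp (y * s) * exp (- pi * ((1 + exp y) / pi) * (norm x)\<^sup>2)"
        by (simp only: exp_add mult.assoc)
      thus "ennreal (exp (y * s) * exp (- (norm x)\<^sup>2 * exp y) * exp (- (norm x)\<^sup>2)) =
          ennreal (exp (y * s)) * ennreal (exp (- pi * ((1 + exp y) / pi) * (norm x)\<^sup>2))"
        by (simp only: ennreal_mult'[OF exp_ge_zero])
    qed
    also have "\<dots> = ennreal (exp (y * s)) * ennreal (((1 + exp y) / pi) powr (- ?d / 2))"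
    proof -
      have "0 < (1 + exp y) / pi" by (intro divide_pos_pos add_pos_pos) auto
      thus ?thesis by (subst nn_integral_cmult, measurable) (subst nn_integral_gaussian, auto)
    qed
    also have "\<dots> = ennreal (exp (y * s) * ((1 + exp y) / pi) powr (- ?d / 2))"
      by (simp add: ennreal_mult)
    also have "\<dots> \<le> ennreal (pi powr (?d / 2) * exp (- c * \<bar>y\<bar>))"
    proof (intro ennreal_leI)
      have "((1 + exp y) / pi) powr (- ?d / 2) = pi powr (?d / 2) * (1 + exp y) powr (- (?d / 2))"
      proof -
        have "0 < 1 + exp y" by (intro add_pos_pos) auto
        hence "- ?d / 2 * ln ((1 + exp y) / pi) = ?d / 2 * ln pi + - (?d / 2) * ln (1 + exp y)"
          by (simp add: ln_div field_simps)
        moreover have "(1 + exp y) / pi \<noteq> 0" "1 + exp y \<noteq> 0" using \<open>0 < 1 + exp y\<close> by auto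
        ultimately show ?thesis by (simp only: powr_def exp_add if_False) simp
      qed
      moreover have "exp (y * s) * (1 + exp y) powr (- (?d / 2)) \<le> exp (- c * \<bar>y\<bar>)"
      proof (cases "y \<ge> 0")
        case True
        have "(1 + exp y) powr (- (?d / 2)) \<le> exp y powr (- (?d / 2))"
          by (intro powr_mono2') auto
        hence "exp (y * s) * (1 + exp y) powr (- (?d / 2)) \<le> exp (y * s) * exp y powr (- (?d / 2))"
          by (intro mult_left_mono) auto
        also have "\<dots> = exp (y * (s - ?d / 2))"
          by (simp add: exp_powr_real mult_exp_exp algebra_simps)
        also have "y * (s - ?d / 2) \<le> y * (- c)" using True by (intro mult_left_mono) (auto simp: c_def)
        finally show ?thesis using True by (simp add: mult.commute)
      next
        case False
        have "(1 + exp y) powr (- (?d / 2)) \<le> 1 powr (- (?d / 2))"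
          by (intro powr_mono2') auto
        hence "exp (y * s) * (1 + exp y) powr (- (?d / 2)) \<le> exp (y * s) * 1"
          by (intro mult_left_mono) auto
        also have "y * s \<le> y * c" using False by (intro mult_left_mono_neg) (auto simp: c_def)
        finally show ?thesis using False by (simp add: mult.commute)
      qed
      ultimately show "exp (y * s) * ((1 + exp y) / pi) powr (- ?d / 2) \<le> pi powr (?d / 2) * exp (- c * \<bar>y\<bar>)"
        by (simp add: mult.left_commute mult_left_mono)
    qed
    finally show "(\<integral>\<^sup>+(x::'a). ennreal (exp (y * s) * exp (- (norm x)\<^sup>2 * exp y) * exp (- (norm x)\<^sup>2)) \<partial>lborel) \<le>
        ennreal (pi powr (?d / 2)) * ennreal (exp (- c * \<bar>y\<bar>))"
      by (simp add: ennreal_mult)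
  qed
  also have "\<dots> = ennreal (pi powr (?d / 2)) * (\<integral>\<^sup>+y. ennreal (exp (- c * \<bar>y\<bar>)) \<partial>lborel)"
    by (rule nn_integral_cmult) measurable
  also have "\<dots> < \<infinity>"
    using integrable_exp_minus_abs[OF c] by (subst nn_integral_eq_integral) (auto simp: ennreal_mult_less_top)
  finally show "(\<integral>\<^sup>+x. ennreal (norm (x::'a) powr (- a) * exp (- (norm x)\<^sup>2)) \<partial>lborel) < \<infinity>"
    using G by (auto simp: ennreal_mult_less_top)
qed auto

lemma integrable_norm_powr_decay:
  fixes g :: "'a::euclidean_space \<Rightarrow> real" and a :: real
  assumes a: "0 \<le> a" "a < DIM('a)" and s: "s > DIM('a) / 2"
    and [measurable]: "g \<in> borel_measurable borel" and g: "\<And>x. \<bar>g x\<bar> \<le> C * (1 + (norm x)\<^sup>2) powr (- s)"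
  shows "integrable lborel (\<lambda>x. norm x powr (- a) * g x)"
proof (rule Bochner_Integration.integrable_bound)
  \<comment> \<open>The comparison near the origin wants a positive exponent. For a = 0 it is
    replaced by 1/2, which is below every dimension.\<close>
  define b where "b = (if a = 0 then 1 / 2 else a)"
  have "1 \<le> real DIM('a)" using DIM_positive[where 'a='a] by linarith
  hence half: "1 / 2 < real DIM('a)" by linarith
  have b: "0 < b" "b < DIM('a)" using a half by (auto simp only: b_def split: if_splits)
  have C: "0 \<le> C"
  proof -
    have "\<bar>g 0\<bar> \<le> C * (1 + (norm (0::'a))\<^sup>2) powr (- s)" by (rule g)
    thus ?thesis by simp
  qed
  show "integrable lborel (\<lambda>x::'a. C * exp 1 * (norm x powr (- b) * exp (- (norm x)\<^sup>2)) + C * (1 + (norm x)\<^sup>2) powr (- s))"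
    by (intro Bochner_Integration.integrable_add integrable_mult_right integrable_norm_powr_gaussian b
        integrable_inverse_one_plus_norm s)
  show "AE x in lborel. norm (norm x powr (- a) * g x) \<le>
      norm (C * exp 1 * (norm x powr (- b) * exp (- (norm x)\<^sup>2)) + C * (1 + (norm x)\<^sup>2) powr (- s))"
  proof (rule AE_I2)
    fix x :: 'a
    let ?A = "C * exp 1 * (norm x powr (- b) * exp (- (norm x)\<^sup>2))" and ?B = "C * (1 + (norm x)\<^sup>2) powr (- s)"
    have AB: "0 \<le> ?A" "0 \<le> ?B" using C by auto
    have "norm (norm x powr (- a) * g x) = norm x powr (- a) * \<bar>g x\<bar>" by (simp add: abs_mult)
    also have "\<dots> \<le> ?A + ?B"
    proof (cases "norm x \<le> 1")
      case True
      have s0: "s \<ge> 0" using s by (rule order_trans[OF _ less_imp_le, rotated]) simp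
      have "(1 + (norm x)\<^sup>2) powr (- s) \<le> 1 powr (- s)" using s0 by (intro powr_mono2') auto
      hence "\<bar>g x\<bar> \<le> C * 1" using g[of x] C by (elim order_trans) (intro mult_left_mono; simp)
      moreover have "norm x powr (- a) \<le> norm x powr (- b)"
      proof (cases "x = 0")
        case False
        thus ?thesis using True a by (intro powr_mono') (auto simp: b_def)
      qed simp
      ultimately have "norm x powr (- a) * \<bar>g x\<bar> \<le> norm x powr (- b) * (C * 1)"
        by (intro mult_mono) auto
      also have "\<dots> \<le> norm x powr (- b) * (C * exp (1 - (norm x)\<^sup>2))"
        using True C by (intro mult_left_mono) (auto simp: power_le_one)
      also have "\<dots> = ?A" by (simp add: exp_diff exp_minus field_simps)
      finally show ?thesis using AB by linarith
    next
      case False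
      hence "norm x powr (- a) \<le> 1 powr (- a)" using a by (intro powr_mono2') auto
      hence "norm x powr (- a) * \<bar>g x\<bar> \<le> 1 * ?B" using g[of x] by (intro mult_mono) auto
      thus ?thesis using AB by linarith
    qed
    also have "\<dots> \<le> norm (?A + ?B)" by simp
    finally show "norm (norm x powr (- a) * g x) \<le> norm (?A + ?B)" .
  qed
qed measurable

section \<open>Decay and integrability of Schwartz functions\<close>

lemma
  assumes "schwartz \<phi>"
  shows schwartz_differentiable: "\<phi> differentiable (at x)"
    and schwartz_bounded: "bounded (range (\<lambda>x. norm x ^ k *\<^sub>R \<phi> x))"
    and schwartz_derivative: "b \<in> Basis \<Longrightarrow> schwartz (\<lambda>x. frechet_derivative \<phi> (at x) b)"
  using assms by (auto elim: schwartz.cases)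

lemma schwartz_continuous: "schwartz \<phi> \<Longrightarrow> continuous_on UNIV \<phi>"
  by (intro continuous_at_imp_continuous_on ballI differentiable_imp_continuous_within schwartz_differentiable)

lemma schwartz_measurable [measurable_dest]: "schwartz \<phi> \<Longrightarrow> \<phi> \<in> borel_measurable borel"
  by (intro borel_measurable_continuous_onI schwartz_continuous)

text \<open>The moments of order 0 and 2 n suffice, by (1 + |x|^2)^n \<le> 2^n (1 + |x|^(2 n)). The
  hypothesis is decay rather than \<open>schwartz\<close>, because the bound is also applied to
  inverse Fourier transforms, for which decay and measurability are what is established.\<close>

lemma decay_of_powers:
  fixes g :: "'a::euclidean_space \<Rightarrow> complex"
  assumes "\<And>k::nat. bounded (range (\<lambda>x. norm x ^ k *\<^sub>R g x))"
  obtains C where "0 \<le> C" "\<And>x. norm (g x) \<le> C * (1 + (norm x)\<^sup>2) powr (- real n)"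
proof -
  obtain A where A: "\<And>x. norm (norm x ^ 0 *\<^sub>R g x) \<le> A"
    using assms[of 0] unfolding bounded_iff by auto
  obtain B where B: "\<And>x. norm (norm x ^ (2 * n) *\<^sub>R g x) \<le> B"
    using assms[of "2 * n"] unfolding bounded_iff by auto
  have "norm (g x) \<le> (2 ^ n * (\<bar>A\<bar> + \<bar>B\<bar>)) * (1 + (norm x)\<^sup>2) powr (- real n)" for x
  proof -
    let ?u = "1 + (norm x)\<^sup>2"
    have "?u ^ n \<le> (2 * max 1 ((norm x)\<^sup>2)) ^ n" by (intro power_mono) auto
    also have "\<dots> = 2 ^ n * (max 1 ((norm x)\<^sup>2)) ^ n" by (rule power_mult_distrib)
    also have "(max 1 ((norm x)\<^sup>2)) ^ n \<le> 1 + norm x ^ (2 * n)"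
      by (cases "1 \<le> (norm x)\<^sup>2") (auto simp: max_def power_mult)
    finally have "?u ^ n \<le> 2 ^ n * (1 + norm x ^ (2 * n))" by simp
    hence "?u ^ n * norm (g x) \<le> 2 ^ n * (1 + norm x ^ (2 * n)) * norm (g x)"
      by (intro mult_right_mono) auto
    also have "\<dots> = 2 ^ n * (norm (norm x ^ 0 *\<^sub>R g x) + norm (norm x ^ (2 * n) *\<^sub>R g x))"
      by (simp add: algebra_simps)
    also have "\<dots> \<le> 2 ^ n * (\<bar>A\<bar> + \<bar>B\<bar>)"
      using A[of x] B[of x] by (intro mult_left_mono add_mono) auto
    finally have "?u ^ n * norm (g x) \<le> 2 ^ n * (\<bar>A\<bar> + \<bar>B\<bar>)" .
    moreover have "?u > 0" by (rule add_pos_nonneg) auto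
    ultimately show ?thesis by (simp add: powr_minus powr_realpow field_simps)
  qed
  thus ?thesis by (intro that[of "2 ^ n * (\<bar>A\<bar> + \<bar>B\<bar>)"]) auto
qed

lemma integrable_norm_powr_rapid_decay:
  fixes g :: "'a::euclidean_space \<Rightarrow> complex" and a :: real
  assumes "\<And>k::nat. bounded (range (\<lambda>x. norm x ^ k *\<^sub>R g x))" and [measurable]: "g \<in> borel_measurable borel"
    and "0 \<le> a" "a < DIM('a)"
  shows "integrable lborel (\<lambda>x. norm x powr (- a) * norm (g x))"
proof -
  obtain C where C: "\<And>x. norm (g x) \<le> C * (1 + (norm x)\<^sup>2) powr (- real DIM('a))"
    using decay_of_powers[OF assms(1), of "DIM('a)"] by metis
  show ?thesis using C assms
    by (intro integrable_norm_powr_decay[where s = "real DIM('a)" and C = C]) auto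
qed

lemma integrable_rapid_decay:
  fixes g :: "'a::euclidean_space \<Rightarrow> complex"
  assumes "\<And>k::nat. bounded (range (\<lambda>x. norm x ^ k *\<^sub>R g x))" and [measurable]: "g \<in> borel_measurable borel"
  shows "integrable lborel g"
proof -
  have "integrable lborel (\<lambda>x. norm x powr (- 0) * norm (g x))"
    by (rule integrable_norm_powr_rapid_decay[OF assms]) auto
  hence "integrable lborel (\<lambda>x. norm (g x))"
  proof (rule integrable_cong_AE_imp)
    show "AE x in lborel. norm x powr (- 0) * norm (g x) = norm (g x)"
      using AE_lborel_singleton[of 0] by eventually_elim simp
  qed measurable
  thus ?thesis by (subst (asm) integrable_norm_iff) auto
qed

lemma schwartz_integrable: "schwartz \<phi> \<Longrightarrow> integrable lborel \<phi>"
  by (intro integrable_rapid_decay schwartz_bounded schwartz_measurable)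

section \<open>The Fourier transform of Schwartz functions\<close>

lemma lborel_integral_translate:
  fixes f :: "'a::euclidean_space \<Rightarrow> 'b::{banach, second_countable_topology}"
  assumes "f \<in> borel_measurable borel"
  shows "(\<integral>x. f (c + x) \<partial>lborel) = (\<integral>x. f x \<partial>lborel)"
    and "integrable lborel (\<lambda>x. f (c + x)) \<longleftrightarrow> integrable lborel f"
proof -
  have m: "(\<lambda>x. c + x) \<in> measurable lborel lborel" by simp
  have d: "distr lborel lborel ((+) c) = lborel"
    using lborel_distr_plus[of c] by (simp cong: distr_cong)
  have f: "f \<in> borel_measurable lborel" using assms by simp
  show "(\<integral>x. f (c + x) \<partial>lborel) = (\<integral>x. f x \<partial>lborel)"
    using integral_distr[OF m f] by (simp add: d)
  show "integrable lborel (\<lambda>x. f (c + x)) \<longleftrightarrow> integrable lborel f"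
    using integrable_distr_eq[OF m f] by (simp add: d)
qed

text \<open>Translation invariance gives \<open>\<integral> f (x + b) - f x = 0\<close>, and the integrand is the
  integral of the derivative along the segment from \<open>x\<close> to \<open>x + b\<close>.\<close>

lemma integral_directional_derivative_eq_0:
  fixes f g :: "'a::euclidean_space \<Rightarrow> complex"
  assumes f: "integrable lborel f" and g: "integrable lborel g" and contg: "continuous_on UNIV g"
    and deriv: "\<And>x. ((\<lambda>t. f (x + t *\<^sub>R b)) has_vector_derivative g x) (at 0)"
  shows "(\<integral>x. g x \<partial>lborel) = 0"
proof -
  have [measurable]: "f \<in> borel_measurable borel" "g \<in> borel_measurable borel" using f g by auto
  have d: "((\<lambda>t. f (x + t *\<^sub>R b)) has_vector_derivative g (x + s *\<^sub>R b)) (at s)" for x s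
  proof -
    have "((\<lambda>t. f ((x + s *\<^sub>R b) + t *\<^sub>R b)) has_vector_derivative g (x + s *\<^sub>R b)) (at (s - s))"
      using deriv[of "x + s *\<^sub>R b"] by simp
    hence "(((\<lambda>t. f ((x + s *\<^sub>R b) + t *\<^sub>R b)) \<circ> (\<lambda>t. t - s)) has_vector_derivative (1 *\<^sub>R g (x + s *\<^sub>R b))) (at s)"
      by (intro vector_diff_chain_at) (auto intro!: derivative_eq_intros)
    thus ?thesis by (simp add: o_def algebra_simps)
  qed
  have ftc: "(\<integral>s. indicator {0..1} s *\<^sub>R g (x + s *\<^sub>R b) \<partial>lborel) = f (b + x) - f x" for x
  proof -
    have "(\<integral>s. indicator {0..1} s *\<^sub>R g (x + s *\<^sub>R b) \<partial>lborel) = f (x + 1 *\<^sub>R b) - f (x + 0 *\<^sub>R b)"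
    proof (rule integral_FTC_Icc)
      show "((\<lambda>s. f (x + s *\<^sub>R b)) has_vector_derivative g (x + s *\<^sub>R b)) (at s within {0..1})" for s
        by (rule has_vector_derivative_at_within[OF d])
      show "continuous_on {0..1} (\<lambda>s. g (x + s *\<^sub>R b))"
        by (rule continuous_on_compose2[OF contg]) (auto intro!: continuous_intros)
    qed simp
    thus ?thesis by (simp add: add.commute)
  qed
  \<comment> \<open>The indicator bounds the range of s, and translation invariance gives the inner
    integral of the norm the same value for all s in that range, so Fubini applies.\<close>
  let ?h = "\<lambda>(s, x). indicator {0..1} s *\<^sub>R g (s *\<^sub>R b + x)"
  have inth: "integrable (lborel \<Otimes>\<^sub>M lborel) ?h"
  proof (rule lborel_pair.Fubini_integrable)
    show "?h \<in> borel_measurable (lborel \<Otimes>\<^sub>M lborel)" by measurable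
    have "(\<integral>x. norm (g (s *\<^sub>R b + x)) \<partial>lborel) = (\<integral>x. norm (g x) \<partial>lborel)" for s
      by (rule lborel_integral_translate) measurable
    hence "(\<lambda>s. \<integral>x. norm (?h (s, x)) \<partial>lborel) = (\<lambda>s. indicator {0..1} s *\<^sub>R (\<integral>x. norm (g x) \<partial>lborel))"
      by (auto simp: fun_eq_iff indicator_def)
    thus "integrable lborel (\<lambda>s. \<integral>x. norm (?h (s, x)) \<partial>lborel)" by simp
    show "AE s in lborel. integrable lborel (\<lambda>x. ?h (s, x))"
      using g by (auto simp: lborel_integral_translate(2))
  qed
  have "0 = (\<integral>x. f (b + x) - f x \<partial>lborel)"
    using f by (subst Bochner_Integration.integral_diff) (auto simp: lborel_integral_translate)
  also have "\<dots> = (\<integral>x. (\<integral>s. ?h (s, x) \<partial>lborel) \<partial>lborel)"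
  proof (intro Bochner_Integration.integral_cong refl)
    fix x
    show "f (b + x) - f x = (\<integral>s. ?h (s, x) \<partial>lborel)"
      using ftc[of x] by (simp add: add.commute)
  qed
  also have "\<dots> = (\<integral>s. (\<integral>x. ?h (s, x) \<partial>lborel) \<partial>lborel)"
    using lborel_pair.Fubini_integral[of "\<lambda>s x. ?h (s, x)"] inth by simp
  also have "\<dots> = (\<integral>s. indicator {0..1::real} s *\<^sub>R (\<integral>x. g x \<partial>lborel) \<partial>lborel)"
  proof -
    have inner: "(\<integral>x. ?h (s, x) \<partial>lborel) = indicator {0..1} s *\<^sub>R (\<integral>x. g x \<partial>lborel)" for s
      by (simp add: lborel_integral_translate(1))
    show ?thesis by (simp only: inner)
  qed
  also have "\<dots> = (\<integral>x. g x \<partial>lborel)" by simp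
  finally show ?thesis by simp
qed

definition fourier_inv :: "('a::euclidean_space \<Rightarrow> complex) \<Rightarrow> 'a \<Rightarrow> complex" where
  "fourier_inv \<phi> \<xi> = (\<integral>x. cis (2 * pi * (x \<bullet> \<xi>)) * \<phi> x \<partial>lborel)"

lemma integrable_cis_mult:
  fixes \<phi> :: "'a::euclidean_space \<Rightarrow> complex"
  assumes "integrable lborel \<phi>"
  shows "integrable lborel (\<lambda>x. cis (2 * pi * (x \<bullet> \<xi>)) * \<phi> x)"
proof (rule Bochner_Integration.integrable_bound[OF assms])
  have [measurable]: "\<phi> \<in> borel_measurable borel" using assms by auto
  show "(\<lambda>x. cis (2 * pi * (x \<bullet> \<xi>)) * \<phi> x) \<in> borel_measurable lborel"
    unfolding cis_conv_exp by measurable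
qed (simp add: norm_mult)

lemma norm_fourier_inv_le: "norm (fourier_inv \<phi> \<xi>) \<le> (\<integral>x. norm (\<phi> x) \<partial>lborel)"
  unfolding fourier_inv_def using integral_norm_bound[of lborel "\<lambda>x. cis (2 * pi * (x \<bullet> \<xi>)) * \<phi> x"]
  by (simp add: norm_mult)

lemma fourier_inv_measurable:
  fixes \<phi> :: "'a::euclidean_space \<Rightarrow> complex"
  assumes [measurable]: "\<phi> \<in> borel_measurable borel"
  shows "fourier_inv \<phi> \<in> borel_measurable borel"
proof -
  have "(\<lambda>(\<xi>, x). cis (2 * pi * (x \<bullet> \<xi>)) * \<phi> x) \<in> borel_measurable (borel \<Otimes>\<^sub>M lborel)"
    unfolding cis_conv_exp by measurable
  thus ?thesis unfolding fourier_inv_def[abs_def]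
    by (intro lborel.borel_measurable_lebesgue_integral) (simp add: case_prod_unfold)
qed

text \<open>Integration by parts: \<open>g\<close> is the derivative of the product of the character
  and \<phi> in the direction b, and its integral vanishes by translation invariance.\<close>

lemma fourier_inv_derivative:
  assumes \<phi>: "schwartz \<phi>" and b: "b \<in> Basis"
  shows "fourier_inv (\<lambda>x. frechet_derivative \<phi> (at x) b) \<xi> = - (2 * pi * \<i> * of_real (\<xi> \<bullet> b)) * fourier_inv \<phi> \<xi>"
proof -
  define \<phi>' where "\<phi>' = (\<lambda>x. frechet_derivative \<phi> (at x) b)"
  have \<phi>': "schwartz \<phi>'" unfolding \<phi>'_def using \<phi> b by (rule schwartz_derivative)
  define e where "e = (\<lambda>x. cis (2 * pi * (x \<bullet> \<xi>)))"
  define g where "g = (\<lambda>x. e x * \<phi>' x + 2 * pi * \<i> * of_real (\<xi> \<bullet> b) * (e x * \<phi> x))"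
  have i1: "integrable lborel (\<lambda>x. e x * \<phi> x)" and i2: "integrable lborel (\<lambda>x. e x * \<phi>' x)"
    unfolding e_def by (rule integrable_cis_mult[OF schwartz_integrable[OF \<phi>]],
        rule integrable_cis_mult[OF schwartz_integrable[OF \<phi>']])
  have "(\<integral>x. g x \<partial>lborel) = 0"
  proof (rule integral_directional_derivative_eq_0[where f = "\<lambda>x. e x * \<phi> x" and b = b])
    show "integrable lborel g" unfolding g_def using i1 i2 by auto
    show "continuous_on UNIV g" unfolding g_def e_def
      using schwartz_continuous[OF \<phi>] schwartz_continuous[OF \<phi>']
      by (auto intro!: continuous_intros)
    fix x
    have "(\<phi> has_derivative frechet_derivative \<phi> (at x)) (at (x + 0 *\<^sub>R b) within range (\<lambda>t. x + t *\<^sub>R b))"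
      using schwartz_differentiable[OF \<phi>] frechet_derivative_works by (auto intro: has_derivative_at_withinI)
    moreover have "((\<lambda>t. x + t *\<^sub>R b) has_vector_derivative b) (at 0)"
      by (auto intro!: derivative_eq_intros)
    ultimately have "((\<phi> \<circ> (\<lambda>t. x + t *\<^sub>R b)) has_vector_derivative \<phi>' x) (at 0)"
      unfolding \<phi>'_def using vector_derivative_diff_chain_within by blast
    hence 1: "((\<lambda>t. \<phi> (x + t *\<^sub>R b)) has_vector_derivative \<phi>' x) (at 0)" by (simp add: o_def)
    have "((\<lambda>t. cis (2 * pi * ((x + t *\<^sub>R b) \<bullet> \<xi>))) has_vector_derivative
        (2 * pi * (\<xi> \<bullet> b)) *\<^sub>R (\<i> * e x)) (at 0)"
    proof -
      have "((\<lambda>t. 2 * pi * ((x + t *\<^sub>R b) \<bullet> \<xi>)) has_vector_derivative (2 * pi * (\<xi> \<bullet> b))) (at 0)"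
      proof -
        have "(\<lambda>t. 2 * pi * ((x + t *\<^sub>R b) \<bullet> \<xi>)) = (\<lambda>t. 2 * pi * (x \<bullet> \<xi>) + t * (2 * pi * (\<xi> \<bullet> b)))"
          by (simp add: fun_eq_iff inner_add_left inner_commute[of b] algebra_simps)
        thus ?thesis
          by (auto intro!: derivative_eq_intros simp: has_real_derivative_iff_has_vector_derivative[symmetric])
      qed
      moreover have "(cis has_vector_derivative (\<i> * cis t)) (at t)" for t
        by (auto simp: cis_conv_exp[abs_def] intro!: derivative_eq_intros has_vector_derivative_real_field)
      ultimately have "(cis \<circ> (\<lambda>t. 2 * pi * ((x + t *\<^sub>R b) \<bullet> \<xi>)) has_vector_derivative
          (2 * pi * (\<xi> \<bullet> b)) *\<^sub>R (\<i> * cis (2 * pi * ((x + 0 *\<^sub>R b) \<bullet> \<xi>)))) (at 0)"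
        by (intro vector_diff_chain_at)
      thus ?thesis by (simp add: o_def e_def)
    qed
    from has_vector_derivative_mult[OF this 1]
    show "((\<lambda>t. e (x + t *\<^sub>R b) * \<phi> (x + t *\<^sub>R b)) has_vector_derivative g x) (at 0)"
      by (simp add: g_def e_def scaleR_conv_of_real mult_ac)
  qed (fact i1)
  moreover have "(\<integral>x. g x \<partial>lborel) = fourier_inv \<phi>' \<xi> + 2 * pi * \<i> * of_real (\<xi> \<bullet> b) * fourier_inv \<phi> \<xi>"
    unfolding g_def using i1 i2 by (subst Bochner_Integration.integral_add) (auto simp: fourier_inv_def e_def)
  ultimately show ?thesis unfolding \<phi>'_def by (simp add: eq_neg_iff_add_eq_0)
qed

text \<open>Each derivative of \<phi> is traded for one factor \<open>\<xi> \<bullet> b\<close>, so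
  the induction has to vary \<phi>. The factor 2 pi exceeds 1 and is dropped.\<close>

lemma norm_fourier_inv_component_power:
  assumes \<phi>: "schwartz \<phi>" and b: "b \<in> Basis"
  shows "\<exists>C. \<forall>\<xi>. \<bar>\<xi> \<bullet> b\<bar> ^ k * norm (fourier_inv \<phi> \<xi>) \<le> C"
  using \<phi>
proof (induction k arbitrary: \<phi>)
  case 0
  thus ?case using norm_fourier_inv_le[of \<phi>] by auto
next
  case (Suc k)
  define \<phi>' where "\<phi>' = (\<lambda>x. frechet_derivative \<phi> (at x) b)"
  have \<phi>': "schwartz \<phi>'" unfolding \<phi>'_def using Suc.prems b by (rule schwartz_derivative)
  obtain C where C: "\<And>\<xi>. \<bar>\<xi> \<bullet> b\<bar> ^ k * norm (fourier_inv \<phi>' \<xi>) \<le> C" using Suc.IH[OF \<phi>'] by blast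
  have "\<bar>\<xi> \<bullet> b\<bar> ^ Suc k * norm (fourier_inv \<phi> \<xi>) \<le> C" for \<xi>
  proof -
    have "norm (fourier_inv \<phi>' \<xi>) = 2 * pi * (\<bar>\<xi> \<bullet> b\<bar> * norm (fourier_inv \<phi> \<xi>))"
      unfolding \<phi>'_def by (subst fourier_inv_derivative[OF Suc.prems b]) (simp add: norm_mult)
    moreover have "1 * (\<bar>\<xi> \<bullet> b\<bar> * norm (fourier_inv \<phi> \<xi>)) \<le> 2 * pi * (\<bar>\<xi> \<bullet> b\<bar> * norm (fourier_inv \<phi> \<xi>))"
      using pi_gt3 by (intro mult_right_mono) auto
    ultimately have "\<bar>\<xi> \<bullet> b\<bar> * norm (fourier_inv \<phi> \<xi>) \<le> norm (fourier_inv \<phi>' \<xi>)" by simp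
    hence "\<bar>\<xi> \<bullet> b\<bar> ^ k * (\<bar>\<xi> \<bullet> b\<bar> * norm (fourier_inv \<phi> \<xi>)) \<le> \<bar>\<xi> \<bullet> b\<bar> ^ k * norm (fourier_inv \<phi>' \<xi>)"
      by (intro mult_left_mono) auto
    also have "\<dots> \<le> C" by (rule C)
    finally show ?thesis by (simp add: mult_ac)
  qed
  thus ?case by blast
qed

lemma fourier_inv_rapid_decay:
  fixes \<phi> :: "'a::euclidean_space \<Rightarrow> complex"
  assumes \<phi>: "schwartz \<phi>"
  shows "bounded (range (\<lambda>\<xi>. norm \<xi> ^ k *\<^sub>R fourier_inv \<phi> \<xi>))"
proof -
  obtain C where C: "\<And>b \<xi>. b \<in> Basis \<Longrightarrow> \<bar>\<xi> \<bullet> b\<bar> ^ k * norm (fourier_inv \<phi> \<xi>) \<le> C b"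
    using norm_fourier_inv_component_power[OF \<phi>, of _ k] by metis
  let ?d = "real DIM('a)"
  have "norm (norm \<xi> ^ k *\<^sub>R fourier_inv \<phi> \<xi>) \<le> ?d ^ k * (\<Sum>b\<in>Basis. \<bar>C b\<bar>)" for \<xi>
  proof -
    \<comment> \<open>A coordinate of largest modulus controls the norm up to the dimension, which
      reduces the claim to a single coordinate.\<close>
    obtain b where b: "b \<in> Basis" "\<And>b'. b' \<in> Basis \<Longrightarrow> \<bar>\<xi> \<bullet> b'\<bar> \<le> \<bar>\<xi> \<bullet> b\<bar>"
    proof -
      have fin: "finite ((\<lambda>b. \<bar>\<xi> \<bullet> b\<bar>) ` Basis)" "(\<lambda>b. \<bar>\<xi> \<bullet> b\<bar>) ` (Basis :: 'a set) \<noteq> {}" by auto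
      from Max_in[OF this] obtain b where "Max ((\<lambda>b. \<bar>\<xi> \<bullet> b\<bar>) ` Basis) = \<bar>\<xi> \<bullet> b\<bar>" "b \<in> Basis"
        by (rule imageE)
      thus ?thesis using that Max_ge[OF fin(1)] by (metis imageI)
    qed
    have "norm \<xi> \<le> (\<Sum>b\<in>Basis. \<bar>\<xi> \<bullet> b\<bar>)" by (rule norm_le_l1)
    also have "\<dots> \<le> (\<Sum>b'\<in>(Basis::'a set). \<bar>\<xi> \<bullet> b\<bar>)" using b by (intro sum_mono) auto
    finally have "norm \<xi> \<le> ?d * \<bar>\<xi> \<bullet> b\<bar>" by simp
    hence "norm \<xi> ^ k \<le> (?d * \<bar>\<xi> \<bullet> b\<bar>) ^ k" by (intro power_mono) auto
    hence "norm \<xi> ^ k * norm (fourier_inv \<phi> \<xi>) \<le> (?d * \<bar>\<xi> \<bullet> b\<bar>) ^ k * norm (fourier_inv \<phi> \<xi>)"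
      by (intro mult_right_mono) auto
    also have "\<dots> = ?d ^ k * (\<bar>\<xi> \<bullet> b\<bar> ^ k * norm (fourier_inv \<phi> \<xi>))" by (simp add: power_mult_distrib)
    also have "\<dots> \<le> ?d ^ k * \<bar>C b\<bar>" using C[OF b(1), of \<xi>] by (intro mult_left_mono) auto
    also have "\<dots> \<le> ?d ^ k * (\<Sum>b\<in>Basis. \<bar>C b\<bar>)" using b by (intro mult_left_mono member_le_sum) auto
    finally show ?thesis by simp
  qed
  thus ?thesis unfolding bounded_iff by blast
qed

section \<open>Uniqueness of the distributional inverse Fourier transform\<close>

lemma measure_eqI_lborel_box:
  fixes M N :: "'a::euclidean_space measure"
  assumes "sets M = sets borel" "sets N = sets borel"
    and eq: "\<And>a b. emeasure M (box a b) = emeasure N (box a b)"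
    and fin: "\<And>a b. emeasure M (box a b) \<noteq> \<infinity>"
  shows "M = N"
proof (rule measure_eqI_generator_eq)
  let ?E = "range (\<lambda>(a, b). box a b :: 'a set)"
  show "Int_stable ?E" by (auto simp: Int_stable_def box_Int_box)
  show "?E \<subseteq> Pow UNIV" "sets M = sigma_sets UNIV ?E" "sets N = sigma_sets UNIV ?E"
    using assms(1,2) by (simp_all add: borel_eq_box)
  let ?A = "\<lambda>n::nat. box (- (real n *\<^sub>R One)) (real n *\<^sub>R One) :: 'a set"
  show "range ?A \<subseteq> ?E" "(\<Union>i. ?A i) = UNIV"
    unfolding UN_box_eq_UNIV by auto
  show "emeasure M (?A i) \<noteq> \<infinity>" for i by (rule fin)
  show "emeasure M X = emeasure N X" if "X \<in> ?E" for X using that eq by auto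
qed

text \<open>The positive and the negative part of \<open>H\<close> are densities of two measures
  that agree on boxes. Boxes generate the Borel sets, so the measures are equal, and then the
  densities agree almost everywhere.\<close>

lemma AE_zero_of_box_integrals_real:
  fixes H :: "'a::euclidean_space \<Rightarrow> real"
  assumes H: "integrable lborel H" and 0: "\<And>a b. (\<integral>x. indicator (box a b) x * H x \<partial>lborel) = 0"
  shows "AE x in lborel. H x = 0"
proof -
  have [measurable]: "H \<in> borel_measurable borel" using H by auto
  define P where "P = (\<lambda>x. ennreal (H x))"
  define N where "N = (\<lambda>x. ennreal (- H x))"
  have [measurable]: "P \<in> borel_measurable borel" "N \<in> borel_measurable borel" unfolding P_def N_def by measurable
  have "density lborel P = density lborel N"
  proof (rule measure_eqI_lborel_box)
    fix a b :: 'a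
    let ?I = "\<lambda>x. indicator (box a b) x * H x"
    have int: "integrable lborel ?I"
      using integrable_mult_indicator[OF _ H, of "box a b"] by simp
    have P: "emeasure (density lborel P) (box a b) = (\<integral>\<^sup>+x. ennreal (?I x) \<partial>lborel)"
      by (subst emeasure_density) (auto intro!: nn_integral_cong simp: P_def indicator_def)
    have N: "emeasure (density lborel N) (box a b) = (\<integral>\<^sup>+x. ennreal (- ?I x) \<partial>lborel)"
      by (subst emeasure_density) (auto intro!: nn_integral_cong simp: N_def indicator_def)
    have fP: "(\<integral>\<^sup>+x. ennreal (?I x) \<partial>lborel) \<noteq> \<infinity>" and fN: "(\<integral>\<^sup>+x. ennreal (- ?I x) \<partial>lborel) \<noteq> \<infinity>"
      using int by (auto simp: real_integrable_def)
    have "enn2real (\<integral>\<^sup>+x. ennreal (?I x) \<partial>lborel) = enn2real (\<integral>\<^sup>+x. ennreal (- ?I x) \<partial>lborel)"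
      using 0[of a b] real_lebesgue_integral_def[OF int] by simp
    hence "ennreal (enn2real (\<integral>\<^sup>+x. ennreal (?I x) \<partial>lborel)) = ennreal (enn2real (\<integral>\<^sup>+x. ennreal (- ?I x) \<partial>lborel))"
      by (rule arg_cong)
    hence "(\<integral>\<^sup>+x. ennreal (?I x) \<partial>lborel) = (\<integral>\<^sup>+x. ennreal (- ?I x) \<partial>lborel)"
      using fP fN by (simp add: ennreal_enn2real_if)
    thus "emeasure (density lborel P) (box a b) = emeasure (density lborel N) (box a b)" by (simp add: P N)
    show "emeasure (density lborel P) (box a b) \<noteq> \<infinity>" using fP by (simp add: P)
  qed auto
  hence "AE x in lborel. P x = N x"
    by (subst (asm) sigma_finite_measure.density_unique_iff[OF sigma_finite_lborel]) auto
  thus ?thesis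
  proof eventually_elim
    case (elim x)
    show ?case
    proof (cases "H x \<ge> 0")
      case True
      hence "P x = 0" using elim by (simp add: N_def ennreal_neg)
      thus ?thesis using True by (simp add: P_def ennreal_eq_0_iff)
    next
      case False
      hence "N x = 0" using elim by (simp add: P_def ennreal_neg)
      thus ?thesis using False by (simp add: N_def ennreal_eq_0_iff)
    qed
  qed
qed

lemma AE_zero_of_box_integrals:
  fixes H :: "'a::euclidean_space \<Rightarrow> complex"
  assumes H: "integrable lborel H" and 0: "\<And>a b. (\<integral>x. indicator (box a b) x *\<^sub>R H x \<partial>lborel) = 0"
  shows "AE x in lborel. H x = 0"
proof -
  have i: "integrable lborel (\<lambda>x. indicator (box a b) x *\<^sub>R H x)" for a b
    using integrable_mult_indicator[OF _ H, of "box a b"] by simp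
  have "AE x in lborel. Re (H x) = 0"
  proof (rule AE_zero_of_box_integrals_real)
    show "integrable lborel (\<lambda>x. Re (H x))" using H by (rule integrable_Re)
    show "(\<integral>x. indicator (box a b) x * Re (H x) \<partial>lborel) = 0" for a b
      using integral_Re[OF i, of a b] 0[of a b] by simp
  qed
  moreover have "AE x in lborel. Im (H x) = 0"
  proof (rule AE_zero_of_box_integrals_real)
    show "integrable lborel (\<lambda>x. Im (H x))" using H by (rule integrable_Im)
    show "(\<integral>x. indicator (box a b) x * Im (H x) \<partial>lborel) = 0" for a b
      using integral_Im[OF i, of a b] 0[of a b] by simp
  qed
  ultimately show ?thesis by eventually_elim (simp add: complex_eq_iff)
qed

section \<open>Gaussian averages of indicators of boxes\<close>

lemma lborel_integral_affine:
  fixes f :: "'a::euclidean_space \<Rightarrow> real"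
  assumes [measurable]: "f \<in> borel_measurable borel" and c: "c \<noteq> 0"
  shows "(\<integral>x. f (t + c *\<^sub>R x) \<partial>lborel) = (\<integral>x. f x \<partial>lborel) / \<bar>c\<bar> ^ DIM('a)"
proof -
  have "(\<integral>x. f x \<partial>lborel) = (\<integral>x. f x \<partial>density (distr lborel borel (\<lambda>x. t + c *\<^sub>R x)) (\<lambda>_. ennreal (\<bar>c\<bar> ^ DIM('a))))"
    using lborel_affine[OF c, of t] by (simp add: ennreal_power)
  also have "\<dots> = (\<integral>x. \<bar>c\<bar> ^ DIM('a) * f (t + c *\<^sub>R x) \<partial>lborel)"
    by (subst integral_density) (auto simp: integral_distr)
  finally show ?thesis using c by simp
qed

text \<open>After the substitution x = y + u / (n + 1) the Gaussian is fixed and only the indicator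
  varies with n. Off the boundary of the box the indicator is locally constant at y, so the
  integrand is eventually constant for each u.\<close>

lemma gaussian_average_tendsto:
  fixes a b y :: "'a::euclidean_space"
  assumes y: "y \<notin> cbox a b - box a b"
  shows "(\<lambda>n. real (Suc n) ^ DIM('a) * (\<integral>x. indicator (box a b) x * exp (- pi * (real (Suc n))\<^sup>2 * (norm (y - x))\<^sup>2) \<partial>lborel))
    \<longlonglongrightarrow> indicator (box a b) y"
proof -
  let ?A = "box a b"
  let ?g = "\<lambda>u::'a. exp (- pi * 1 * (norm u)\<^sup>2)"
  let ?F = "\<lambda>n u. indicator ?A (y + (1 / real (Suc n)) *\<^sub>R u) * ?g u"
  have eq: "real (Suc n) ^ DIM('a) * (\<integral>x. indicator ?A x * exp (- pi * (real (Suc n))\<^sup>2 * (norm (y - x))\<^sup>2) \<partial>lborel)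
      = (\<integral>u. ?F n u \<partial>lborel)" for n
  proof -
    let ?f = "\<lambda>x. indicator ?A x * exp (- pi * (real (Suc n))\<^sup>2 * (norm (y - x))\<^sup>2)"
    have f: "?f (y + (1 / real (Suc n)) *\<^sub>R u) = ?F n u" for u
      by (simp add: power_divide del: of_nat_Suc)
    have "(\<integral>u. ?F n u \<partial>lborel) = (\<integral>u. ?f (y + (1 / real (Suc n)) *\<^sub>R u) \<partial>lborel)"
      by (simp only: f)
    also have "\<dots> = (\<integral>x. ?f x \<partial>lborel) / \<bar>1 / real (Suc n)\<bar> ^ DIM('a)"
      by (rule lborel_integral_affine) auto
    finally show ?thesis by (simp add: power_divide del: of_nat_Suc)
  qed
  have "(\<lambda>n. \<integral>u. ?F n u \<partial>lborel) \<longlonglongrightarrow> (\<integral>u. indicator ?A y * ?g u \<partial>lborel)"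
  proof (rule integral_dominated_convergence[where w = ?g])
    show "integrable lborel ?g" by (rule integrable_gaussian) simp
    show "AE u in lborel. norm (?F n u) \<le> ?g u" for n by (auto simp: indicator_def)
    show "AE u in lborel. (\<lambda>n. ?F n u) \<longlonglongrightarrow> indicator ?A y * ?g u"
    proof (rule AE_I2)
      fix u :: 'a
      have l: "(\<lambda>n. y + (1 / real (Suc n)) *\<^sub>R u) \<longlonglongrightarrow> y + 0 *\<^sub>R u"
        by (intro tendsto_intros LIMSEQ_inverse_real_of_nat[unfolded inverse_eq_divide])
      have "eventually (\<lambda>n. indicator ?A (y + (1 / real (Suc n)) *\<^sub>R u) = (indicator ?A y :: real)) sequentially"
      proof (cases "y \<in> ?A")
        case True
        hence "eventually (\<lambda>n. y + (1 / real (Suc n)) *\<^sub>R u \<in> ?A) sequentially"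
          using l by (intro topological_tendstoD[OF _ open_box]) auto
        thus ?thesis by eventually_elim (use True in auto)
      next
        case False
        hence "y \<in> - cbox a b" using y by auto
        hence "eventually (\<lambda>n. y + (1 / real (Suc n)) *\<^sub>R u \<in> - cbox a b) sequentially"
          using l by (intro topological_tendstoD[OF _ open_Compl[OF closed_cbox]]) auto
        thus ?thesis by eventually_elim (use False box_subset_cbox[of a b] in \<open>auto simp: indicator_def\<close>)
      qed
      hence "eventually (\<lambda>n. ?F n u = indicator ?A y * ?g u) sequentially"
        by eventually_elim simp
      thus "(\<lambda>n. ?F n u) \<longlonglongrightarrow> indicator ?A y * ?g u" by (rule tendsto_eventually)
    qed
  qed measurable
  moreover have "(\<integral>u. indicator ?A y * ?g u \<partial>lborel) = indicator ?A y"
    using integral_gaussian[where 'a='a, of 1] by simp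
  ultimately show ?thesis by (simp only: eq)
qed

lemma gaussian_average_le_1:
  fixes a b y :: "'a::euclidean_space"
  shows "\<bar>real (Suc n) ^ DIM('a) * (\<integral>x. indicator (box a b) x * exp (- pi * (real (Suc n))\<^sup>2 * (norm (y - x))\<^sup>2) \<partial>lborel)\<bar> \<le> 1"
proof -
  let ?e = "\<lambda>x. exp (- pi * (real (Suc n))\<^sup>2 * (norm (y - x))\<^sup>2)"
  have shift: "(\<lambda>x. ?e (y + (-1) *\<^sub>R x)) = (\<lambda>x. exp (- pi * (real (Suc n))\<^sup>2 * (norm x)\<^sup>2))" by simp
  have "integrable lborel (\<lambda>x. exp (- pi * (real (Suc n))\<^sup>2 * (norm (x::'a))\<^sup>2))"
    by (rule integrable_gaussian) (simp del: of_nat_Suc)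
  hence "integrable lborel (\<lambda>x. exp (- pi * (real (Suc n))\<^sup>2 * (norm (- y + x))\<^sup>2))"
    by (subst lborel_integral_translate(2)) auto
  hence int: "integrable lborel ?e" by (simp add: norm_minus_commute)
  have "(\<integral>x. ?e x \<partial>lborel) = (\<integral>x. exp (- pi * (real (Suc n))\<^sup>2 * (norm (- y + x))\<^sup>2) \<partial>lborel)"
    by (simp add: norm_minus_commute)
  also have "\<dots> = (\<integral>x. exp (- pi * (real (Suc n))\<^sup>2 * (norm (x::'a))\<^sup>2) \<partial>lborel)"
    by (rule lborel_integral_translate(1)) measurable
  also have "\<dots> = ((real (Suc n))\<^sup>2) powr (- real DIM('a) / 2)"
    using integral_gaussian[where 'a='a, of "(real (Suc n))\<^sup>2"] by (simp del: of_nat_Suc)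
  also have "\<dots> = 1 / real (Suc n) ^ DIM('a)"
    by (simp add: powr_powr powr_minus_divide powr_realpow flip: powr_numeral del: of_nat_Suc)
  finally have I: "(\<integral>x. ?e x \<partial>lborel) = 1 / real (Suc n) ^ DIM('a)" .
  have "(\<integral>x. indicator (box a b) x * ?e x \<partial>lborel) \<le> (\<integral>x. ?e x \<partial>lborel)"
    using int integrable_mult_indicator[OF _ int, of "box a b"]
    by (intro integral_mono) (auto simp: indicator_def)
  moreover have "0 \<le> (\<integral>x. indicator (box a b) x * ?e x \<partial>lborel)" by simp
  ultimately show ?thesis unfolding I by (simp add: abs_mult field_simps del: of_nat_Suc)
qed

text \<open>Averaging the given identities over centres x in a box and letting the width shrink
  turns Gaussian test functions into the indicator of the box. Gaussians alone therefore separate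
  integrable functions.\<close>

lemma AE_zero_of_gaussian_integrals:
  fixes H :: "'a::euclidean_space \<Rightarrow> complex"
  assumes H: "integrable lborel H"
    and 0: "\<And>n x. n > 0 \<Longrightarrow> (\<integral>y. H y * of_real (exp (- pi * (real n)\<^sup>2 * (norm (y - x))\<^sup>2)) \<partial>lborel) = 0"
  shows "AE x in lborel. H x = 0"
proof (rule AE_zero_of_box_integrals[OF H])
  fix a b :: 'a
  let ?A = "box a b"
  have [measurable]: "H \<in> borel_measurable borel" using H by auto
  let ?e = "\<lambda>n y x. exp (- pi * (real (Suc n))\<^sup>2 * (norm (y - x))\<^sup>2)"
  define \<Phi> where "\<Phi> = (\<lambda>n y. real (Suc n) ^ DIM('a) * (\<integral>x. indicator ?A x * ?e n y x \<partial>lborel))"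
  have [measurable]: "\<Phi> n \<in> borel_measurable borel" for n
    unfolding \<Phi>_def by measurable
  have fin: "emeasure lborel ?A < \<infinity>" by (intro emeasure_bounded_finite) (auto intro: bounded_box)
  have z: "(\<integral>y. H y * of_real (\<Phi> n y) \<partial>lborel) = 0" for n
  proof -
    let ?k = "\<lambda>(y, x). H y * of_real (indicator ?A x * ?e n y x)"
    have intk: "integrable (lborel \<Otimes>\<^sub>M lborel) ?k"
    proof (rule Bochner_Integration.integrable_bound)
      have "integrable lborel (\<lambda>x. indicator ?A x :: real)" using fin by (simp add: integrable_indicator_iff)
      thus "integrable (lborel \<Otimes>\<^sub>M lborel) (\<lambda>(y, x). norm (H y) * indicator ?A x)"
      proof (intro lborel_pair.Fubini_integrable)
        assume i: "integrable lborel (\<lambda>x. indicator ?A x :: real)"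
        show "AE y in lborel. integrable lborel (\<lambda>x. case (y, x) of (y, x) \<Rightarrow> norm (H y) * indicator ?A x)"
          using i by auto
        show "integrable lborel (\<lambda>y. \<integral>x. norm (case (y, x) of (y, x) \<Rightarrow> norm (H y) * indicator ?A x) \<partial>lborel)"
          using H by (simp add: abs_mult)
      qed measurable
      show "AE z in lborel \<Otimes>\<^sub>M lborel. norm (?k z) \<le> norm ((\<lambda>(y, x). norm (H y) * indicator ?A x) z)"
        by (rule AE_I2) (auto simp: norm_mult indicator_def mult_left_le)
    qed measurable
    have "(\<integral>y. H y * of_real (\<Phi> n y) \<partial>lborel) = (\<integral>y. of_real (real (Suc n) ^ DIM('a)) * (\<integral>x. ?k (y, x) \<partial>lborel) \<partial>lborel)"
    proof (intro Bochner_Integration.integral_cong refl)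
      fix y
      have k: "(\<integral>x. ?k (y, x) \<partial>lborel) = H y * of_real (\<integral>x. indicator ?A x * ?e n y x \<partial>lborel)"
        by (simp only: case_prod_conv integral_mult_right_zero integral_complex_of_real)
      show "H y * of_real (\<Phi> n y) = of_real (real (Suc n) ^ DIM('a)) * (\<integral>x. ?k (y, x) \<partial>lborel)"
        unfolding k \<Phi>_def by (simp only: of_real_mult mult_ac)
    qed
    also have "\<dots> = of_real (real (Suc n) ^ DIM('a)) * (\<integral>y. (\<integral>x. ?k (y, x) \<partial>lborel) \<partial>lborel)"
      by (rule integral_mult_right_zero)
    also have "(\<integral>y. (\<integral>x. ?k (y, x) \<partial>lborel) \<partial>lborel) = (\<integral>x. (\<integral>y. ?k (y, x) \<partial>lborel) \<partial>lborel)"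
      using lborel_pair.Fubini_integral[of "\<lambda>y x. ?k (y, x)"] intk by simp
    also have "\<dots> = (\<integral>x. of_real (indicator ?A x) * (\<integral>y. H y * of_real (?e n y x) \<partial>lborel) \<partial>lborel)"
    proof (intro Bochner_Integration.integral_cong refl)
      fix x
      have "(\<integral>y. ?k (y, x) \<partial>lborel) = (\<integral>y. of_real (indicator ?A x) * (H y * of_real (?e n y x)) \<partial>lborel)"
        by (intro Bochner_Integration.integral_cong refl) (simp add: mult_ac)
      thus "(\<integral>y. ?k (y, x) \<partial>lborel) = of_real (indicator ?A x) * (\<integral>y. H y * of_real (?e n y x) \<partial>lborel)"
        by (simp only: integral_mult_right_zero)
    qed
    also have "\<dots> = 0" using 0[of "Suc n"] by simp
    finally show ?thesis by simp
  qed
  have "(\<lambda>n. \<integral>y. H y * of_real (\<Phi> n y) \<partial>lborel) \<longlonglongrightarrow> (\<integral>y. indicator ?A y *\<^sub>R H y \<partial>lborel)"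
  proof (rule integral_dominated_convergence[where w = "\<lambda>y. norm (H y)"])
    show "integrable lborel (\<lambda>y. norm (H y))" using H by (rule integrable_norm)
    show "AE y in lborel. norm (H y * of_real (\<Phi> n y)) \<le> norm (H y)" for n
    proof (rule AE_I2)
      fix y
      have "\<bar>\<Phi> n y\<bar> \<le> 1" unfolding \<Phi>_def by (rule gaussian_average_le_1)
      thus "norm (H y * of_real (\<Phi> n y)) \<le> norm (H y)" by (simp add: norm_mult mult_left_le)
    qed
    have "AE y in lborel. y \<notin> cbox a b - box a b"
      using null_sets_cbox_Diff_box[of a b] by (rule AE_not_in)
    thus "AE y in lborel. (\<lambda>n. H y * of_real (\<Phi> n y)) \<longlonglongrightarrow> indicator ?A y *\<^sub>R H y"
    proof eventually_elim
      case (elim y)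
      hence "(\<lambda>n. \<Phi> n y) \<longlonglongrightarrow> indicator ?A y" unfolding \<Phi>_def by (rule gaussian_average_tendsto)
      hence "(\<lambda>n. H y * of_real (\<Phi> n y)) \<longlonglongrightarrow> H y * of_real (indicator ?A y)" by (intro tendsto_intros)
      thus ?case by (simp add: scaleR_conv_of_real mult.commute)
    qed
  qed measurable
  thus "(\<integral>y. indicator ?A y *\<^sub>R H y \<partial>lborel) = 0"
    unfolding z by (simp add: LIMSEQ_const_iff)
qed

section \<open>Gaussians as Schwartz functions\<close>

lemma real_polynomial_function_polynomial_growth:
  fixes P :: "'a::euclidean_space \<Rightarrow> real"
  assumes "real_polynomial_function P"
  shows "\<exists>C N. 0 \<le> C \<and> (\<forall>x. \<bar>P x\<bar> \<le> C * (1 + norm x) ^ N)"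
  using assms
proof (induction rule: real_polynomial_function.induct)
  case (linear f)
  then obtain K where K: "\<And>x. norm (f x) \<le> norm x * K" "K \<ge> 0"
    using bounded_linear.nonneg_bounded by blast
  have "\<bar>f x\<bar> \<le> K * (1 + norm x) ^ 1" for x
    using K(1)[of x] K(2) by (simp add: algebra_simps)
  thus ?case using K(2) by blast
next
  case (const c)
  have "\<bar>c\<bar> \<le> \<bar>c\<bar> * (1 + norm (x::'a)) ^ 0" for x by simp
  thus ?case using abs_ge_zero by blast
next
  case (add f g)
  then obtain C N D M where C: "0 \<le> C" "\<And>x. \<bar>f x\<bar> \<le> C * (1 + norm x) ^ N"
    and D: "0 \<le> D" "\<And>x. \<bar>g x\<bar> \<le> D * (1 + norm x) ^ M" by metis
  have "\<bar>f x + g x\<bar> \<le> (C + D) * (1 + norm x) ^ (N + M)" for x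
  proof -
    have "(1 + norm x) ^ N \<le> (1 + norm x) ^ (N + M)" "(1 + norm x) ^ M \<le> (1 + norm x) ^ (N + M)"
      by (intro power_increasing; simp)+
    hence "C * (1 + norm x) ^ N + D * (1 + norm x) ^ M \<le> (C + D) * (1 + norm x) ^ (N + M)"
      using C(1) D(1) by (simp add: distrib_right add_mono mult_left_mono)
    thus ?thesis using C(2)[of x] D(2)[of x] by linarith
  qed
  thus ?case using C(1) D(1) by (meson add_nonneg_nonneg)
next
  case (mult f g)
  then obtain C N D M where C: "0 \<le> C" "\<And>x. \<bar>f x\<bar> \<le> C * (1 + norm x) ^ N"
    and D: "0 \<le> D" "\<And>x. \<bar>g x\<bar> \<le> D * (1 + norm x) ^ M" by metis
  have "\<bar>f x * g x\<bar> \<le> (C * D) * (1 + norm x) ^ (N + M)" for x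
  proof -
    have "\<bar>f x\<bar> * \<bar>g x\<bar> \<le> (C * (1 + norm x) ^ N) * (D * (1 + norm x) ^ M)"
      using C D by (intro mult_mono) auto
    thus ?thesis by (simp add: abs_mult power_add mult_ac)
  qed
  thus ?case using C(1) D(1) by (meson mult_nonneg_nonneg)
qed

text \<open>Polynomiality of each directional derivative is recorded along with differentiability,
  because the coinduction for \<open>schwartz\<close> must stay within polynomials times one
  Gaussian.\<close>

lemma real_polynomial_function_has_derivative:
  fixes P :: "'a::euclidean_space \<Rightarrow> real"
  assumes "real_polynomial_function P"
  shows "\<exists>D. (\<forall>x. (P has_derivative D x) (at x)) \<and> (\<forall>b. real_polynomial_function (\<lambda>x. D x b))"
  using assms
proof (induction rule: real_polynomial_function.induct)
  case (linear f)
  thus ?case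
    by (intro exI[of _ "\<lambda>x. f"]) (auto intro: bounded_linear_imp_has_derivative real_polynomial_function.intros)
next
  case (const c)
  thus ?case by (intro exI[of _ "\<lambda>x h. 0"]) (auto intro: real_polynomial_function.intros)
next
  case (add f g)
  then obtain D E where "\<And>x. (f has_derivative D x) (at x)" "\<And>x. (g has_derivative E x) (at x)"
    "\<And>b. real_polynomial_function (\<lambda>x. D x b)" "\<And>b. real_polynomial_function (\<lambda>x. E x b)" by metis
  thus ?case
    by (intro exI[of _ "\<lambda>x h. D x h + E x h"])
      (auto intro!: derivative_intros real_polynomial_function.intros(3))
next
  case (mult f g)
  then obtain D E where "\<And>x. (f has_derivative D x) (at x)" "\<And>x. (g has_derivative E x) (at x)"
    "\<And>b. real_polynomial_function (\<lambda>x. D x b)" "\<And>b. real_polynomial_function (\<lambda>x. E x b)" by metis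
  thus ?case using mult.hyps
    by (intro exI[of _ "\<lambda>x h. f x * E x h + D x h * g x"])
      (auto intro!: has_derivative_mult real_polynomial_function.intros(3,4))
qed

text \<open>With r = |x - x0| one has 1 + |x| \<le> (1 + |x0|) exp r, and m r - c r^2 \<le> m^2 / (4
  c) by completing the square.\<close>

lemma poly_gaussian_bounded:
  fixes x0 x :: "'a::euclidean_space"
  assumes c: "c > 0"
  shows "(1 + norm x) ^ m * exp (- c * (norm (x - x0))\<^sup>2) \<le> (1 + norm x0) ^ m * exp ((real m)\<^sup>2 / (4 * c))"
proof -
  let ?r = "norm (x - x0)"
  have "norm x \<le> norm x0 + ?r" by norm
  moreover have "0 \<le> norm x0 * ?r" by simp
  moreover have "(1 + norm x0) * (1 + ?r) = 1 + norm x0 + ?r + norm x0 * ?r" by (simp add: algebra_simps)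
  ultimately have "1 + norm x \<le> (1 + norm x0) * (1 + ?r)" by linarith
  also have "\<dots> \<le> (1 + norm x0) * exp ?r" by (intro mult_left_mono exp_ge_add_one_self) auto
  finally have "(1 + norm x) ^ m \<le> ((1 + norm x0) * exp ?r) ^ m" by (intro power_mono) auto
  hence "(1 + norm x) ^ m * exp (- c * ?r\<^sup>2) \<le> ((1 + norm x0) * exp ?r) ^ m * exp (- c * ?r\<^sup>2)"
    by (intro mult_right_mono) auto
  also have "\<dots> = (1 + norm x0) ^ m * exp (real m * ?r - c * ?r\<^sup>2)"
    by (simp add: power_mult_distrib exp_diff exp_minus divide_inverse flip: exp_of_nat_mult)
  also have "\<dots> \<le> (1 + norm x0) ^ m * exp ((real m)\<^sup>2 / (4 * c))"
  proof (intro mult_left_mono)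
    have "0 \<le> (2 * c * ?r - real m)\<^sup>2" by simp
    hence "real m * ?r - c * ?r\<^sup>2 \<le> (real m)\<^sup>2 / (4 * c)"
      using c by (simp add: field_simps power2_eq_square)
    thus "exp (real m * ?r - c * ?r\<^sup>2) \<le> exp ((real m)\<^sup>2 / (4 * c))" by simp
  qed auto
  finally show ?thesis .
qed

text \<open>Coinduction asks for a class closed under partial derivatives. A Gaussian by itself does
  not form one; the polynomials times a fixed Gaussian do.\<close>

lemma schwartz_poly_gaussian:
  fixes P :: "'a::euclidean_space \<Rightarrow> real" and x0 :: 'a
  assumes c: "c > 0" and P: "real_polynomial_function P"
  shows "schwartz (\<lambda>x. complex_of_real (P x * exp (- c * (norm (x - x0))\<^sup>2)))"
proof -
  define X where "X = (\<lambda>\<phi>. \<exists>P. real_polynomial_function P \<and> \<phi> = (\<lambda>x::'a. complex_of_real (P x * exp (- c * (norm (x - x0))\<^sup>2))))"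
  have "X (\<lambda>x. complex_of_real (P x * exp (- c * (norm (x - x0))\<^sup>2)))" unfolding X_def using P by blast
  thus ?thesis
  proof (coinduct rule: schwartz.coinduct)
    case (schwartz \<phi>)
    then obtain P where P: "real_polynomial_function P"
      and \<phi>: "\<phi> = (\<lambda>x. complex_of_real (P x * exp (- c * (norm (x - x0))\<^sup>2)))" unfolding X_def by blast
    obtain D where D: "\<And>x. (P has_derivative D x) (at x)" "\<And>b. real_polynomial_function (\<lambda>x. D x b)"
      using real_polynomial_function_has_derivative[OF P] by blast
    define E where "E = (\<lambda>x h. D x h - 2 * c * ((x - x0) \<bullet> h) * P x)"
    have d: "(\<phi> has_derivative (\<lambda>h. complex_of_real (E x h * exp (- c * (norm (x - x0))\<^sup>2)))) (at x)" for x
    proof -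
      have "((\<lambda>x. P x * exp (- c * ((x - x0) \<bullet> (x - x0)))) has_derivative
          (\<lambda>h. E x h * exp (- c * ((x - x0) \<bullet> (x - x0))))) (at x)"
        by (auto intro!: derivative_eq_intros D(1) simp: E_def algebra_simps inner_commute)
      hence "((\<lambda>x. complex_of_real (P x * exp (- c * ((x - x0) \<bullet> (x - x0))))) has_derivative
          (\<lambda>h. complex_of_real (E x h * exp (- c * ((x - x0) \<bullet> (x - x0)))))) (at x)"
        by (rule has_derivative_of_real)
      thus ?thesis by (simp add: \<phi> power2_norm_eq_inner)
    qed
    have fd: "frechet_derivative \<phi> (at x) = (\<lambda>h. complex_of_real (E x h * exp (- c * (norm (x - x0))\<^sup>2)))" for x
      using d by (rule frechet_derivative_at[symmetric])
    have E: "real_polynomial_function (\<lambda>x. E x b)" for b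
    proof -
      have "real_polynomial_function (\<lambda>x. D x b + (- 2 * c) * ((x \<bullet> b) + (- (x0 \<bullet> b))) * P x)"
        by (intro real_polynomial_function.intros D P bounded_linear_inner_left)
      thus ?thesis by (simp add: E_def inner_diff_left algebra_simps)
    qed
    have "bounded (range (\<lambda>x. norm x ^ k *\<^sub>R \<phi> x))" for k :: nat
    proof -
      obtain C N where C: "0 \<le> C" "\<And>x. \<bar>P x\<bar> \<le> C * (1 + norm x) ^ N"
        using real_polynomial_function_polynomial_growth[OF P] by blast
      have "norm (norm x ^ k *\<^sub>R \<phi> x) \<le> C * ((1 + norm x0) ^ (k + N) * exp ((real (k + N))\<^sup>2 / (4 * c)))" for x
      proof -
        let ?e = "exp (- c * (norm (x - x0))\<^sup>2)"
        have "norm (norm x ^ k *\<^sub>R \<phi> x) = norm x ^ k * (\<bar>P x\<bar> * ?e)"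
          by (simp add: \<phi> norm_mult abs_mult del: of_real_mult)
        also have "\<dots> \<le> (1 + norm x) ^ k * ((C * (1 + norm x) ^ N) * ?e)"
          using C by (intro mult_mono power_mono) auto
        also have "\<dots> = C * ((1 + norm x) ^ (k + N) * ?e)" by (simp add: power_add mult_ac)
        also have "\<dots> \<le> C * ((1 + norm x0) ^ (k + N) * exp ((real (k + N))\<^sup>2 / (4 * c)))"
          using C(1) by (intro mult_left_mono poly_gaussian_bounded c)
        finally show ?thesis .
      qed
      thus ?thesis unfolding bounded_iff by blast
    qed
    moreover have "\<phi> differentiable (at x)" for x using d unfolding differentiable_def by blast
    moreover have "X (\<lambda>x. frechet_derivative \<phi> (at x) b)" for b
      unfolding fd X_def using E by blast
    ultimately show ?case by blast
  qed
qed

lemma schwartz_gaussian: "c > 0 \<Longrightarrow> schwartz (\<lambda>x. complex_of_real (exp (- c * (norm (x - x0))\<^sup>2)))"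
  using schwartz_poly_gaussian[of c "\<lambda>x. 1" x0] by (simp add: real_polynomial_function.intros(2))

lemma schwartz_gaussian_product:
  fixes x0 :: "'a::euclidean_space"
  assumes "c > 0"
  shows "schwartz (\<lambda>x. complex_of_real (exp (- (norm x)\<^sup>2) * exp (- c * (norm (x - x0))\<^sup>2)))"
proof -
  \<comment> \<open>Completing the square: the product of the two Gaussians is \<open>A\<close>
    times one Gaussian of rate \<open>k\<close>, centred at the weighted mean \<open>z\<close> of 0
    and x0.\<close>
  define k where "k = 1 + c"
  define z where "z = (c / k) *\<^sub>R x0"
  define A where "A = exp (k * (z \<bullet> z) - c * (x0 \<bullet> x0))"
  have k: "k > 0" using assms by (simp add: k_def)
  have s: "schwartz (\<lambda>x. complex_of_real (A * exp (- k * (norm (x - z))\<^sup>2)))"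
    by (intro schwartz_poly_gaussian k real_polynomial_function.intros(2))
  have e: "A * exp (- k * (norm (x - z))\<^sup>2) = exp (- (norm x)\<^sup>2) * exp (- c * (norm (x - x0))\<^sup>2)" for x
  proof -
    have kz: "k * (x \<bullet> z) = c * (x \<bullet> x0)" using k by (simp add: z_def)
    have "(k * (z \<bullet> z) - c * (x0 \<bullet> x0)) + - k * (norm (x - z))\<^sup>2 = 2 * (k * (x \<bullet> z)) - k * (x \<bullet> x) - c * (x0 \<bullet> x0)"
      by (simp add: power2_norm_eq_inner inner_diff_left inner_diff_right inner_commute algebra_simps)
    also have "\<dots> = - (norm x)\<^sup>2 + - c * (norm (x - x0))\<^sup>2"
      unfolding kz by (simp add: k_def power2_norm_eq_inner inner_diff_left inner_diff_right inner_commute algebra_simps)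
    finally show ?thesis unfolding A_def by (simp only: exp_add[symmetric])
  qed
  show ?thesis using s by (simp only: e)
qed

lemma tempered_measurable: "tempered f \<Longrightarrow> f \<in> borel_measurable borel"
  by (simp add: tempered_def)

text \<open>A tempered function need not be integrable, so the difference is first multiplied by exp
  (- |x|^2). The product of this factor with a narrow Gaussian is still a Schwartz function, so the
  distributional identity applies to it.\<close>

lemma is_inverse_fourier_unique:
  fixes K1 K2 :: "'a::euclidean_space \<Rightarrow> complex"
  assumes "is_inverse_fourier m K1" "is_inverse_fourier m K2"
  shows "AE x in lborel. K1 x = K2 x"
proof -
  have t: "tempered K1" "tempered K2" using assms by (auto simp: is_inverse_fourier_def)
  define H where "H = (\<lambda>x. (K1 x - K2 x) * complex_of_real (exp (- (norm x)\<^sup>2)))"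
  have i: "integrable lborel (\<lambda>x. K x * \<phi> x)" if "schwartz \<phi>" "tempered K" for \<phi> and K :: "'a \<Rightarrow> complex"
    using that by (auto simp: tempered_def)
  have eq: "(\<integral>x. (K1 x - K2 x) * \<phi> x \<partial>lborel) = 0" if "schwartz \<phi>" for \<phi>
  proof -
    have "(\<integral>x. (K1 x - K2 x) * \<phi> x \<partial>lborel) = (\<integral>x. K1 x * \<phi> x \<partial>lborel) - (\<integral>x. K2 x * \<phi> x \<partial>lborel)"
      using i[OF that t(1)] i[OF that t(2)]
      by (subst Bochner_Integration.integral_diff[symmetric]) (auto simp: left_diff_distrib)
    also have "\<dots> = 0" using assms that by (simp add: is_inverse_fourier_def)
    finally show ?thesis .
  qed
  have "AE x in lborel. H x = 0"
  proof (rule AE_zero_of_gaussian_integrals)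
    have s: "schwartz (\<lambda>x::'a. complex_of_real (exp (- (norm x)\<^sup>2)))"
      using schwartz_gaussian[of 1 "0::'a"] by simp
    have "integrable lborel (\<lambda>x. K1 x * complex_of_real (exp (- (norm x)\<^sup>2)) - K2 x * complex_of_real (exp (- (norm x)\<^sup>2)))"
      by (intro Bochner_Integration.integrable_diff i s t)
    thus "integrable lborel H" by (simp add: H_def left_diff_distrib)
    fix n :: nat and x :: 'a
    assume "n > 0"
    hence "schwartz (\<lambda>y. complex_of_real (exp (- (norm y)\<^sup>2) * exp (- (pi * (real n)\<^sup>2) * (norm (y - x))\<^sup>2)))"
      by (intro schwartz_gaussian_product) simp
    from eq[OF this] show "(\<integral>y. H y * of_real (exp (- pi * (real n)\<^sup>2 * (norm (y - x))\<^sup>2)) \<partial>lborel) = 0"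
      by (simp add: H_def mult.assoc)
  qed
  thus ?thesis by eventually_elim (simp add: H_def)
qed

section \<open>Riesz potentials\<close>

text \<open>The value 0 at \<open>r = 0\<close> keeps \<open>cmod (rpow r z) = r powr Re z\<close> valid there.\<close>

definition rpow :: "real \<Rightarrow> complex \<Rightarrow> complex" where
  "rpow r z = (if r = 0 then 0 else exp (z * of_real (ln r)))"

lemma norm_rpow: "0 \<le> r \<Longrightarrow> cmod (rpow r z) = r powr Re z"
  by (simp add: rpow_def powr_def)

lemma rpow_mult: "0 \<le> r \<Longrightarrow> 0 \<le> s \<Longrightarrow> rpow (r * s) z = rpow r z * rpow s z"
  by (auto simp: rpow_def ln_mult ring_distribs exp_add)

lemma rpow_measurable [measurable]:
  assumes [measurable]: "f \<in> borel_measurable M" "g \<in> borel_measurable M"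
  shows "(\<lambda>x. rpow (f x) (g x)) \<in> borel_measurable M"
  unfolding rpow_def by measurable

lemma rpow_power2: "0 \<le> r \<Longrightarrow> rpow (r\<^sup>2) z = rpow r (2 * z)"
  by (auto simp: rpow_def ln_realpow mult_ac)

text \<open>The power is a mixture of exp (- pi exp y r^2) over all y. The pi matches the Fourier
  convention, under which this family is mapped to itself, up to a factor, with y replaced by -
  y.\<close>

lemma gamma_rpow_mixture:
  fixes r :: real
  assumes k: "Re k > 0" and r: "r > 0"
  shows "has_bochner_integral lborel (\<lambda>y. exp (of_real y * (k / 2)) * of_real (exp (- pi * exp y * r\<^sup>2)))
    (Gamma (k / 2) * rpow pi (- k / 2) * rpow r (- k))"
proof -
  have "has_bochner_integral lborel (\<lambda>y. exp (of_real y * (k / 2)) * of_real (exp (- (pi * r\<^sup>2) * exp y)))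
      (Gamma (k / 2) * of_real (pi * r\<^sup>2) powr (- (k / 2)))"
    using k r by (intro has_bochner_integral_Gamma_exp_scaled) auto
  moreover have "of_real (pi * r\<^sup>2) powr (- (k / 2)) = rpow (pi * r\<^sup>2) (- (k / 2))"
  proof -
    have pos: "pi * r\<^sup>2 > 0" using r by simp
    thus ?thesis by (simp add: powr_def rpow_def Ln_of_real[OF pos] del: of_real_mult)
  qed
  moreover have "rpow (pi * r\<^sup>2) (- (k / 2)) = rpow pi (- k / 2) * rpow r (- k)"
    using r by (simp add: rpow_mult rpow_power2)
  ultimately show ?thesis by (simp add: mult_ac)
qed

lemma gaussian_mixture_integral:
  fixes g :: "'a::euclidean_space \<Rightarrow> complex"
  assumes decay: "\<And>n::nat. bounded (range (\<lambda>x. norm x ^ n *\<^sub>R g x))" and [measurable]: "g \<in> borel_measurable borel"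
    and k: "0 < Re k" "Re k < DIM('a)"
  shows "Gamma (k / 2) * rpow pi (- k / 2) * (\<integral>x. rpow (norm x) (- k) * g x \<partial>lborel) =
    (\<integral>y. exp (of_real y * (k / 2)) * (\<integral>x. of_real (exp (- pi * exp y * (norm x)\<^sup>2)) * g x \<partial>lborel) \<partial>lborel)"
proof -
  let ?c = "Gamma (k / 2) * rpow pi (- k / 2)"
  let ?F = "\<lambda>(x, y). exp (of_real y * (k / 2)) * of_real (exp (- pi * exp y * (norm x)\<^sup>2)) * g x"
  let ?F' = "\<lambda>x y. exp (of_real y * (k / 2)) * of_real (exp (- pi * exp y * (norm (x::'a))\<^sup>2)) * g x"
  have ne: "AE x in lborel. (x::'a) \<noteq> 0" by (rule AE_lborel_singleton)
  have mix: "has_bochner_integral lborel (?F' x) (?c * rpow (norm x) (- k) * g x)" if "x \<noteq> 0" for x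
    using k that by (intro has_bochner_integral_mult_left gamma_rpow_mixture) auto
  \<comment> \<open>Absolute convergence is checked with the same mixture at the exponent Re k,
    since taking moduli in the integrand replaces k by its real part.\<close>
  define k' where "k' = complex_of_real (Re k)"
  define c' where "c' = Gamma (k' / 2) * rpow pi (- k' / 2)"
  have mix': "(\<integral>y. norm (?F' x y) \<partial>lborel) = Re (c' * rpow (norm x) (- k')) * norm (g x)" if "x \<noteq> 0" for x
  proof -
    have "has_bochner_integral lborel (\<lambda>y. Re (exp (of_real y * (k' / 2)) * of_real (exp (- pi * exp y * (norm x)\<^sup>2))))
       (Re (c' * rpow (norm x) (- k')))"
      unfolding c'_def using k that
      by (intro has_bochner_integral_Re gamma_rpow_mixture) (auto simp: k'_def)
    hence hb: "has_bochner_integral lborel (\<lambda>y. Re (exp (of_real y * (k' / 2)) * of_real (exp (- pi * exp y * (norm x)\<^sup>2))) * norm (g x))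
       (Re (c' * rpow (norm x) (- k')) * norm (g x))"
      by (rule has_bochner_integral_mult_left)
    have eq: "Re (exp (of_real y * (k' / 2)) * of_real (exp (- pi * exp y * (norm x)\<^sup>2))) * norm (g x) = norm (?F' x y)" for y
    proof -
      have "exp (of_real y * (k' / 2)) = complex_of_real (exp (y * (Re k / 2)))"
        by (simp add: k'_def exp_of_real[symmetric])
      thus ?thesis by (simp add: norm_mult)
    qed
    show ?thesis using has_bochner_integral_integral_eq[OF hb] by (simp only: eq)
  qed
  have int: "integrable (lborel \<Otimes>\<^sub>M lborel) ?F"
  proof (rule lborel_pair.Fubini_integrable)
    show "?F \<in> borel_measurable (lborel \<Otimes>\<^sub>M lborel)" by measurable
    have i: "integrable lborel (\<lambda>x. cmod c' * (norm x powr (- Re k) * norm (g x)))"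
      using k by (intro integrable_mult_right integrable_norm_powr_rapid_decay decay) auto
    have a: "AE x in lborel. norm (\<integral>y. norm (?F (x, y)) \<partial>lborel) \<le> norm (cmod c' * (norm x powr (- Re k) * norm (g x)))"
      using ne
    proof eventually_elim
      case (elim x)
      have "\<bar>Re (c' * rpow (norm x) (- k'))\<bar> \<le> cmod (c' * rpow (norm x) (- k'))" by (rule abs_Re_le_cmod)
      also have "\<dots> = cmod c' * norm x powr (- Re k)" by (simp add: norm_mult norm_rpow k'_def)
      finally have "\<bar>Re (c' * rpow (norm x) (- k'))\<bar> * norm (g x) \<le> cmod c' * norm x powr (- Re k) * norm (g x)"
        by (rule mult_right_mono) simp
      thus ?case using mix'[OF elim] by (simp add: abs_mult mult.assoc)
    qed
    show "integrable lborel (\<lambda>x. \<integral>y. norm (?F (x, y)) \<partial>lborel)"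
      by (rule Bochner_Integration.integrable_bound[OF i _ a]) measurable
    show "AE x in lborel. integrable lborel (\<lambda>y. ?F (x, y))"
      using ne by eventually_elim (use mix in \<open>auto simp: has_bochner_integral_iff\<close>)
  qed
  have "?c * (\<integral>x. rpow (norm x) (- k) * g x \<partial>lborel) = (\<integral>x. ?c * (rpow (norm x) (- k) * g x) \<partial>lborel)"
    by (rule integral_mult_right_zero[symmetric])
  also have "\<dots> = (\<integral>x. (\<integral>y. ?F' x y \<partial>lborel) \<partial>lborel)"
  proof (rule integral_cong_AE)
    show "AE x in lborel. ?c * (rpow (norm x) (- k) * g x) = (\<integral>y. ?F' x y \<partial>lborel)"
      using ne by eventually_elim (use mix in \<open>auto simp: has_bochner_integral_iff mult.assoc\<close>)
  qed measurable
  also have "\<dots> = (\<integral>y. (\<integral>x. ?F' x y \<partial>lborel) \<partial>lborel)"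
    using lborel_pair.Fubini_integral[of ?F'] int by simp
  also have "\<dots> = (\<integral>y. exp (of_real y * (k / 2)) * (\<integral>x. of_real (exp (- pi * exp y * (norm x)\<^sup>2)) * g x \<partial>lborel) \<partial>lborel)"
    by (simp only: mult.assoc integral_mult_right_zero)
  finally show ?thesis .
qed

text \<open>Fubini reduces the identity to the transform of a single Gaussian. The rates v and 1 / v
  change places, which becomes a reflection in the logarithmic variable.\<close>

lemma gaussian_Parseval:
  fixes \<phi> :: "'a::euclidean_space \<Rightarrow> complex"
  assumes \<phi>: "integrable lborel \<phi>" and v: "v > 0"
  shows "(\<integral>\<xi>. of_real (exp (- pi * v * (norm \<xi>)\<^sup>2)) * fourier_inv \<phi> \<xi> \<partial>lborel) =
    of_real (v powr (- real DIM('a) / 2)) * (\<integral>x. of_real (exp (- pi * (norm x)\<^sup>2 / v)) * \<phi> x \<partial>lborel)"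
proof -
  have [measurable]: "\<phi> \<in> borel_measurable borel" using \<phi> by auto
  let ?e = "\<lambda>\<xi>::'a. complex_of_real (exp (- pi * v * (norm \<xi>)\<^sup>2))"
  let ?F = "\<lambda>\<xi> x. ?e \<xi> * (cis (2 * pi * (x \<bullet> \<xi>)) * \<phi> x)"
  have g: "integrable lborel (\<lambda>\<xi>::'a. exp (- pi * v * (norm \<xi>)\<^sup>2))" by (rule integrable_gaussian[OF v])
  have int: "integrable (lborel \<Otimes>\<^sub>M lborel) (\<lambda>(\<xi>, x). ?F \<xi> x)"
  proof (rule lborel_pair.Fubini_integrable)
    show "(\<lambda>(\<xi>, x). ?F \<xi> x) \<in> borel_measurable (lborel \<Otimes>\<^sub>M lborel)" unfolding cis_conv_exp by measurable
    show "AE \<xi> in lborel. integrable lborel (\<lambda>x. case (\<xi>, x) of (\<xi>, x) \<Rightarrow> ?F \<xi> x)"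
      using integrable_cis_mult[OF \<phi>] by auto
    show "integrable lborel (\<lambda>\<xi>. \<integral>x. norm (case (\<xi>, x) of (\<xi>, x) \<Rightarrow> ?F \<xi> x) \<partial>lborel)"
      using g by (simp add: norm_mult)
  qed
  have "(\<integral>\<xi>. ?e \<xi> * fourier_inv \<phi> \<xi> \<partial>lborel) = (\<integral>\<xi>. (\<integral>x. ?F \<xi> x \<partial>lborel) \<partial>lborel)"
    by (simp only: fourier_inv_def integral_mult_right_zero)
  also have "\<dots> = (\<integral>x. (\<integral>\<xi>. ?F \<xi> x \<partial>lborel) \<partial>lborel)"
    by (rule lborel_pair.Fubini_integral[OF int, symmetric])
  also have "\<dots> = (\<integral>x. of_real (v powr (- real DIM('a) / 2)) * (of_real (exp (- pi * (norm x)\<^sup>2 / v)) * \<phi> x) \<partial>lborel)"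
  proof (intro Bochner_Integration.integral_cong refl)
    fix x :: 'a
    have "(\<integral>\<xi>. ?F \<xi> x \<partial>lborel) = (\<integral>\<xi>. ?e \<xi> * cis (2 * pi * (x \<bullet> \<xi>)) \<partial>lborel) * \<phi> x"
      by (simp only: mult.assoc[symmetric] integral_mult_left_zero)
    also have "(\<integral>\<xi>. ?e \<xi> * cis (2 * pi * (x \<bullet> \<xi>)) \<partial>lborel) =
        of_real (v powr (- real DIM('a) / 2) * exp (- pi * (norm x)\<^sup>2 / v))"
      by (rule integral_gaussian_cis_euclidean[OF v])
    finally show "(\<integral>\<xi>. ?F \<xi> x \<partial>lborel) = of_real (v powr (- real DIM('a) / 2)) * (of_real (exp (- pi * (norm x)\<^sup>2 / v)) * \<phi> x)"
      by (simp only: of_real_mult mult.assoc)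
  qed
  also have "\<dots> = of_real (v powr (- real DIM('a) / 2)) * (\<integral>x. of_real (exp (- pi * (norm x)\<^sup>2 / v)) * \<phi> x \<partial>lborel)"
    by (rule integral_mult_right_zero)
  finally show ?thesis .
qed

text \<open>The argument of Riemann's functional equation: |\<xi>|^(-k) is expanded into Gaussians,
  each is transformed, and y is reflected. The factor exp (- y d / 2) from the Gaussian transform
  turns the exponent y k / 2 into - y k' / 2.\<close>

theorem riesz_functional_equation:
  fixes \<phi> :: "'a::euclidean_space \<Rightarrow> complex"
  assumes \<phi>: "schwartz \<phi>" and k: "0 < Re k" "Re k < DIM('a)"
  defines "k' \<equiv> of_nat DIM('a) - k"
  shows "Gamma (k / 2) * rpow pi (- k / 2) * (\<integral>\<xi>. rpow (norm \<xi>) (- k) * fourier_inv \<phi> \<xi> \<partial>lborel) =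
    Gamma (k' / 2) * rpow pi (- k' / 2) * (\<integral>x. rpow (norm x) (- k') * \<phi> x \<partial>lborel)"
proof -
  let ?G = "\<lambda>y. exp (of_real y * (k' / 2)) * (\<integral>x. of_real (exp (- pi * exp y * (norm x)\<^sup>2)) * \<phi> x \<partial>lborel)"
  have [measurable]: "\<phi> \<in> borel_measurable borel" by (rule schwartz_measurable[OF \<phi>])
  have "Gamma (k / 2) * rpow pi (- k / 2) * (\<integral>\<xi>. rpow (norm \<xi>) (- k) * fourier_inv \<phi> \<xi> \<partial>lborel) =
      (\<integral>y. exp (of_real y * (k / 2)) * (\<integral>\<xi>. of_real (exp (- pi * exp y * (norm \<xi>)\<^sup>2)) * fourier_inv \<phi> \<xi> \<partial>lborel) \<partial>lborel)"
    by (intro gaussian_mixture_integral fourier_inv_rapid_decay fourier_inv_measurable \<phi> k) measurable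
  also have "\<dots> = (\<integral>y. ?G (- y) \<partial>lborel)"
  proof (intro Bochner_Integration.integral_cong refl)
    fix y :: real
    have "exp (of_real y * (k / 2)) * of_real (exp y powr (- real DIM('a) / 2)) = exp (of_real (- y) * (k' / 2))"
      by (simp add: exp_powr_real exp_of_real[symmetric] exp_add[symmetric] k'_def field_simps)
    moreover have "- pi * (norm x)\<^sup>2 / exp y = - pi * exp (- y) * (norm x)\<^sup>2" for x :: 'a
      by (simp add: exp_minus field_simps)
    ultimately show "exp (of_real y * (k / 2)) * (\<integral>\<xi>. of_real (exp (- pi * exp y * (norm \<xi>)\<^sup>2)) * fourier_inv \<phi> \<xi> \<partial>lborel)
        = ?G (- y)"
      by (subst gaussian_Parseval[OF schwartz_integrable[OF \<phi>]]) (simp_all only: exp_gt_zero mult.assoc[symmetric])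
  qed
  also have "\<dots> = (\<integral>y. ?G y \<partial>lborel)"
    using lborel_integral_real_affine[of "-1" ?G 0] by simp
  also have "\<dots> = Gamma (k' / 2) * rpow pi (- k' / 2) * (\<integral>x. rpow (norm x) (- k') * \<phi> x \<partial>lborel)"
    using k by (intro gaussian_mixture_integral[symmetric] schwartz_bounded \<phi>) (auto simp: k'_def)
  finally show ?thesis .
qed

lemma integrable_min_powr:
  fixes h :: "'a::euclidean_space \<Rightarrow> real" and b1 b2 C1 C2 :: real
  assumes b: "0 < b1" "b1 < DIM('a)" "DIM('a) < b2" and [measurable]: "h \<in> borel_measurable borel"
    and h1: "AE x in lborel. \<bar>h x\<bar> \<le> C1 * norm x powr (- b1)" and h2: "AE x in lborel. \<bar>h x\<bar> \<le> C2 * norm x powr (- b2)"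
  shows "integrable lborel h"
proof (rule Bochner_Integration.integrable_bound)
  \<comment> \<open>The factor exp 1 comes from exp (1 - |x|^2) \<ge> 1 inside the unit ball, and 2
    powr (b2 / 2) from 1 + |x|^2 \<le> 2 |x|^2 outside it.\<close>
  let ?A = "\<lambda>x::'a. \<bar>C1\<bar> * exp 1 * (norm x powr (- b1) * exp (- (norm x)\<^sup>2))"
  let ?B = "\<lambda>x::'a. \<bar>C2\<bar> * 2 powr (b2 / 2) * (1 + (norm x)\<^sup>2) powr (- (b2 / 2))"
  show "integrable lborel (\<lambda>x. ?A x + ?B x)"
    using b by (intro Bochner_Integration.integrable_add integrable_mult_right integrable_norm_powr_gaussian
        integrable_inverse_one_plus_norm) auto
  show "AE x in lborel. norm (h x) \<le> norm (?A x + ?B x)"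
    using h1 h2
  proof eventually_elim
    case (elim x)
    have AB: "0 \<le> ?A x" "0 \<le> ?B x" by auto
    have "\<bar>h x\<bar> \<le> ?A x + ?B x"
    proof (cases "norm x \<le> 1")
      case True
      have "\<bar>h x\<bar> \<le> \<bar>C1\<bar> * norm x powr (- b1)"
        using elim(1) by (elim order_trans) (intro mult_right_mono; simp)
      also have "\<dots> \<le> \<bar>C1\<bar> * (exp (1 - (norm x)\<^sup>2) * norm x powr (- b1))"
      proof (intro mult_left_mono)
        have "1 \<le> exp (1 - (norm x)\<^sup>2)" using True by (simp add: power_le_one)
        thus "norm x powr (- b1) \<le> exp (1 - (norm x)\<^sup>2) * norm x powr (- b1)"
          using mult_right_mono[of 1 "exp (1 - (norm x)\<^sup>2)" "norm x powr (- b1)"] by simp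
      qed simp
      also have "\<dots> = ?A x" by (simp add: exp_diff exp_minus field_simps)
      finally show ?thesis using AB by linarith
    next
      case False
      hence n: "norm x > 1" by simp
      have "1 + (norm x)\<^sup>2 \<le> 2 * (norm x)\<^sup>2" using n one_le_power[of "norm x" 2] by simp
      hence "(2 * (norm x)\<^sup>2) powr (- (b2 / 2)) \<le> (1 + (norm x)\<^sup>2) powr (- (b2 / 2))"
        using b by (intro powr_mono2') (auto intro: add_pos_nonneg)
      moreover have "(2 * (norm x)\<^sup>2) powr (- (b2 / 2)) = 2 powr (- (b2 / 2)) * norm x powr (- b2)"
        using n by (simp add: powr_mult powr_powr flip: powr_numeral)
      ultimately have "2 powr (b2 / 2) * (2 powr (- (b2 / 2)) * norm x powr (- b2)) \<le> 2 powr (b2 / 2) * (1 + (norm x)\<^sup>2) powr (- (b2 / 2))"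
        by (intro mult_left_mono) auto
      hence "norm x powr (- b2) \<le> 2 powr (b2 / 2) * (1 + (norm x)\<^sup>2) powr (- (b2 / 2))"
        by (simp add: powr_minus field_simps)
      hence "\<bar>C2\<bar> * norm x powr (- b2) \<le> ?B x" by (simp add: mult.assoc mult_left_mono)
      moreover have "\<bar>h x\<bar> \<le> \<bar>C2\<bar> * norm x powr (- b2)"
        using elim(2) by (elim order_trans) (intro mult_right_mono; simp)
      ultimately show ?thesis using AB by linarith
    qed
    thus ?case using AB by simp
  qed
qed measurable

section \<open>The kernel\<close>

text \<open>All exponents have the same real part, so every power in the superposition has the
  modulus r powr (- a). One vertical line thus yields one pure power bound, for the symbol as well
  as for the kernel.\<close>

lemma norm_rpow_superposition_le:
  fixes u k :: "real \<Rightarrow> complex"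
  assumes u: "integrable lborel u" and [measurable]: "k \<in> borel_measurable borel" and k: "\<And>\<tau>. Re (k \<tau>) = a" and r: "0 \<le> r"
  shows "cmod (\<integral>\<tau>. u \<tau> * rpow r (- k \<tau>) \<partial>lborel) \<le> (\<integral>\<tau>. cmod (u \<tau>) \<partial>lborel) * r powr (- a)"
proof -
  have "cmod (\<integral>\<tau>. u \<tau> * rpow r (- k \<tau>) \<partial>lborel) \<le> (\<integral>\<tau>. cmod (u \<tau> * rpow r (- k \<tau>)) \<partial>lborel)"
    by (rule integral_norm_bound)
  also have "\<dots> = (\<integral>\<tau>. cmod (u \<tau>) * r powr (- a) \<partial>lborel)"
    using r by (simp add: norm_mult norm_rpow k)
  also have "\<dots> = (\<integral>\<tau>. cmod (u \<tau>) \<partial>lborel) * r powr (- a)" by (rule integral_mult_left_zero)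
  finally show ?thesis .
qed

lemma rpow_superposition_measurable:
  fixes u k :: "real \<Rightarrow> complex"
  assumes [measurable]: "u \<in> borel_measurable borel" "k \<in> borel_measurable borel"
  shows "(\<lambda>x::'a::euclidean_space. \<integral>\<tau>. u \<tau> * rpow (norm x) (- k \<tau>) \<partial>lborel) \<in> borel_measurable borel"
  by measurable

lemma rpow_superposition_integral:
  fixes u k :: "real \<Rightarrow> complex" and g :: "'a::euclidean_space \<Rightarrow> complex"
  assumes u: "integrable lborel u" and [measurable]: "k \<in> borel_measurable borel" and k: "\<And>\<tau>. Re (k \<tau>) = a"
    and [measurable]: "g \<in> borel_measurable borel" and g: "integrable lborel (\<lambda>x. norm x powr (- a) * norm (g x))"
  shows "(\<integral>x. (\<integral>\<tau>. u \<tau> * rpow (norm x) (- k \<tau>) \<partial>lborel) * g x \<partial>lborel) =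
    (\<integral>\<tau>. u \<tau> * (\<integral>x. rpow (norm x) (- k \<tau>) * g x \<partial>lborel) \<partial>lborel)"
proof -
  have [measurable]: "u \<in> borel_measurable borel" using u by auto
  let ?F = "\<lambda>\<tau> x. u \<tau> * (rpow (norm x) (- k \<tau>) * g x)"
  have rg: "integrable lborel (\<lambda>x. rpow (norm x) (- k \<tau>) * g x)" for \<tau>
    using g by (rule Bochner_Integration.integrable_bound) (auto simp: norm_mult norm_rpow k)
  have int: "integrable (lborel \<Otimes>\<^sub>M lborel) (\<lambda>(\<tau>, x). ?F \<tau> x)"
  proof (rule lborel_pair.Fubini_integrable)
    show "(\<lambda>(\<tau>, x). ?F \<tau> x) \<in> borel_measurable (lborel \<Otimes>\<^sub>M lborel)" by measurable
    show "AE \<tau> in lborel. integrable lborel (\<lambda>x. case (\<tau>, x) of (\<tau>, x) \<Rightarrow> ?F \<tau> x)"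
      using rg by auto
    have "(\<lambda>\<tau>. \<integral>x. norm (case (\<tau>, x) of (\<tau>, x) \<Rightarrow> ?F \<tau> x) \<partial>lborel) =
        (\<lambda>\<tau>. cmod (u \<tau>) * (\<integral>x. norm x powr (- a) * norm (g x) \<partial>lborel))"
      by (simp add: norm_mult norm_rpow k)
    thus "integrable lborel (\<lambda>\<tau>. \<integral>x. norm (case (\<tau>, x) of (\<tau>, x) \<Rightarrow> ?F \<tau> x) \<partial>lborel)"
      using u by simp
  qed
  have "(\<integral>x. (\<integral>\<tau>. u \<tau> * rpow (norm x) (- k \<tau>) \<partial>lborel) * g x \<partial>lborel) = (\<integral>x. (\<integral>\<tau>. ?F \<tau> x \<partial>lborel) \<partial>lborel)"
    by (simp only: mult.assoc[symmetric] integral_mult_left_zero)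
  also have "\<dots> = (\<integral>\<tau>. (\<integral>x. ?F \<tau> x \<partial>lborel) \<partial>lborel)"
    by (rule lborel_pair.Fubini_integral[OF int])
  also have "\<dots> = (\<integral>\<tau>. u \<tau> * (\<integral>x. rpow (norm x) (- k \<tau>) * g x \<partial>lborel) \<partial>lborel)"
    by (simp only: integral_mult_right_zero)
  finally show ?thesis .
qed

text \<open>This is pi^(k - d/2) Gamma ((d - k) / 2) / Gamma (k / 2), kept as the quotient of the
  factors on the two sides of the functional equation.\<close>

definition riesz_const :: "nat \<Rightarrow> complex \<Rightarrow> complex" where
  "riesz_const d k = Gamma ((of_nat d - k) / 2) * rpow pi (- (of_nat d - k) / 2) / (Gamma (k / 2) * rpow pi (- k / 2))"

lemma riesz_kernel:
  fixes \<phi> :: "'a::euclidean_space \<Rightarrow> complex"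
  assumes \<phi>: "schwartz \<phi>" and k: "0 < Re k" "Re k < DIM('a)"
  shows "(\<integral>\<xi>. rpow (norm \<xi>) (- k) * fourier_inv \<phi> \<xi> \<partial>lborel) =
    riesz_const DIM('a) k * (\<integral>x. rpow (norm x) (- (of_nat DIM('a) - k)) * \<phi> x \<partial>lborel)"
proof -
  have "k / 2 \<notin> \<int>\<^sub>\<le>\<^sub>0" using k by (auto elim!: nonpos_Ints_cases' simp: complex_eq_iff)
  hence "Gamma (k / 2) * rpow pi (- k / 2) \<noteq> 0" by (auto simp: Gamma_eq_zero_iff rpow_def)
  thus ?thesis using riesz_functional_equation[OF \<phi> k]
    by (simp add: riesz_const_def eq_divide_eq mult_ac)
qed

lemma borel_measurable_Gamma_complex [measurable]: "(Gamma :: complex \<Rightarrow> complex) \<in> borel_measurable borel"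
proof -
  have [measurable]: "(rGamma :: complex \<Rightarrow> complex) \<in> borel_measurable borel"
    by (intro borel_measurable_continuous_onI continuous_on_rGamma)
  have "(\<lambda>z::complex. inverse (rGamma z)) \<in> borel_measurable borel" by measurable
  thus ?thesis by (simp add: Gamma_def[abs_def])
qed

lemma riesz_const_measurable [measurable]: "riesz_const d \<in> borel_measurable borel"
  unfolding riesz_const_def[abs_def] by measurable

lemma tempered_norm_powr:
  fixes f :: "'a::euclidean_space \<Rightarrow> complex" and a :: real
  assumes [measurable]: "f \<in> borel_measurable borel" and a: "0 \<le> a" "a < DIM('a)"
    and f: "AE x in lborel. norm (f x) \<le> C * norm x powr (- a)"
  shows "tempered f"
  unfolding tempered_def
proof (intro conjI allI impI)
  fix \<phi> :: "'a \<Rightarrow> complex" assume \<phi>: "schwartz \<phi>"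
  have [measurable]: "\<phi> \<in> borel_measurable borel" by (rule schwartz_measurable[OF \<phi>])
  have "integrable lborel (\<lambda>x. C * (norm x powr (- a) * norm (\<phi> x)))"
    using a by (intro integrable_mult_right integrable_norm_powr_rapid_decay schwartz_bounded[OF \<phi>]) auto
  thus "integrable lborel (\<lambda>x. f x * \<phi> x)"
  proof (rule Bochner_Integration.integrable_bound)
    show "AE x in lborel. norm (f x * \<phi> x) \<le> norm (C * (norm x powr (- a) * norm (\<phi> x)))"
      using f
    proof eventually_elim
      case (elim x)
      have "norm (f x * \<phi> x) \<le> (C * norm x powr (- a)) * norm (\<phi> x)"
        unfolding norm_mult using elim by (rule mult_right_mono) simp
      also have "\<dots> \<le> norm (C * (norm x powr (- a) * norm (\<phi> x)))" by (simp add: mult.assoc)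
      finally show ?case .
    qed
  qed measurable
qed simp

text \<open>The Riesz identity is integrated against \<open>w\<close>, with Fubini on both sides.
  There are two integrability conditions because the Riesz constant may grow along the line.
  \<open>m\<close> is prescribed off the origin only, since \<open>rpow\<close> is 0 at base 0
  whatever the symbol does there.\<close>

lemma is_inverse_fourier_superposition:
  fixes w k :: "real \<Rightarrow> complex" and m :: "'a::euclidean_space \<Rightarrow> complex"
  assumes w: "integrable lborel w" and [measurable]: "k \<in> borel_measurable borel" and k: "\<And>\<tau>. Re (k \<tau>) = a"
    and a: "0 < a" "a < DIM('a)"
    and wc: "integrable lborel (\<lambda>\<tau>. w \<tau> * riesz_const DIM('a) (k \<tau>))"
    and m: "\<And>\<xi>. \<xi> \<noteq> 0 \<Longrightarrow> m \<xi> = (\<integral>\<tau>. w \<tau> * rpow (norm \<xi>) (- k \<tau>) \<partial>lborel)"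
  shows "is_inverse_fourier m (\<lambda>x. \<integral>\<tau>. w \<tau> * riesz_const DIM('a) (k \<tau>) * rpow (norm x) (- (of_nat DIM('a) - k \<tau>)) \<partial>lborel)"
    (is "is_inverse_fourier m ?K")
proof -
  have [measurable]: "w \<in> borel_measurable borel" using w by auto
  let ?m = "\<lambda>\<xi>::'a. \<integral>\<tau>. w \<tau> * rpow (norm \<xi>) (- k \<tau>) \<partial>lborel"
  let ?k' = "\<lambda>\<tau>. of_nat DIM('a) - k \<tau>"
  have k': "Re (?k' \<tau>) = real DIM('a) - a" for \<tau> by (simp add: k)
  have mm[measurable]: "m \<in> borel_measurable borel"
  proof -
    have "(\<lambda>\<xi>. if \<xi> = 0 then m 0 else ?m \<xi>) \<in> borel_measurable borel"
      using rpow_superposition_measurable[of w k] by measurable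
    moreover have "(\<lambda>\<xi>. if \<xi> = 0 then m 0 else ?m \<xi>) = m" using m by auto
    ultimately show ?thesis by simp
  qed
  have mK[measurable]: "?K \<in> borel_measurable borel"
    by (rule rpow_superposition_measurable) measurable
  have "AE \<xi> in lborel. \<xi> \<noteq> (0::'a)" by (rule AE_lborel_singleton)
  hence mb: "AE \<xi> in lborel. norm (m \<xi>) \<le> (\<integral>\<tau>. cmod (w \<tau>) \<partial>lborel) * norm \<xi> powr (- a)"
    by eventually_elim (simp add: m norm_rpow_superposition_le[OF w _ k])
  have tm: "tempered m"
    using mb a by (intro tempered_norm_powr[of m a]) auto
  have bK: "norm (?K x) \<le> (\<integral>\<tau>. cmod (w \<tau> * riesz_const DIM('a) (k \<tau>)) \<partial>lborel) * norm x powr (- (real DIM('a) - a))" for x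
    by (rule norm_rpow_superposition_le[OF wc _ k']) auto
  have tK: "tempered ?K"
    by (rule tempered_norm_powr[OF mK _ _ AE_I2[OF bK]]) (use a in auto)
  have "(\<integral>x. ?K x * \<phi> x \<partial>lborel) = (\<integral>\<xi>. m \<xi> * (\<integral>x. cis (2 * pi * (x \<bullet> \<xi>)) * \<phi> x \<partial>lborel) \<partial>lborel)"
    if \<phi>: "schwartz \<phi>" for \<phi>
  proof -
    have [measurable]: "\<phi> \<in> borel_measurable borel" by (rule schwartz_measurable[OF \<phi>])
    have [measurable]: "fourier_inv \<phi> \<in> borel_measurable borel" by (rule fourier_inv_measurable) measurable
    have "(\<integral>x. ?K x * \<phi> x \<partial>lborel) =
        (\<integral>\<tau>. w \<tau> * riesz_const DIM('a) (k \<tau>) * (\<integral>x. rpow (norm x) (- ?k' \<tau>) * \<phi> x \<partial>lborel) \<partial>lborel)"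
    proof (rule rpow_superposition_integral[OF wc _ k'])
      show "integrable lborel (\<lambda>x. norm x powr (- (real DIM('a) - a)) * norm (\<phi> x))"
        using a by (intro integrable_norm_powr_rapid_decay schwartz_bounded[OF \<phi>]) auto
    qed measurable
    also have "\<dots> = (\<integral>\<tau>. w \<tau> * (\<integral>\<xi>. rpow (norm \<xi>) (- k \<tau>) * fourier_inv \<phi> \<xi> \<partial>lborel) \<partial>lborel)"
      using riesz_kernel[OF \<phi>] a k by (simp only: mult.assoc)
    also have "\<dots> = (\<integral>\<xi>. ?m \<xi> * fourier_inv \<phi> \<xi> \<partial>lborel)"
    proof (rule rpow_superposition_integral[OF w _ k, symmetric])
      show "integrable lborel (\<lambda>x. norm x powr (- a) * norm (fourier_inv \<phi> x))"
        using a by (intro integrable_norm_powr_rapid_decay fourier_inv_rapid_decay[OF \<phi>]) auto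
    qed measurable
    also have "\<dots> = (\<integral>\<xi>. m \<xi> * fourier_inv \<phi> \<xi> \<partial>lborel)"
    proof (rule integral_cong_AE)
      show "AE \<xi> in lborel. ?m \<xi> * fourier_inv \<phi> \<xi> = m \<xi> * fourier_inv \<phi> \<xi>"
        using AE_lborel_singleton[of "0::'a"] by eventually_elim (simp add: m)
      show "(\<lambda>\<xi>. ?m \<xi> * fourier_inv \<phi> \<xi>) \<in> borel_measurable lborel"
        using rpow_superposition_measurable[of w k] by measurable
    qed measurable
    finally show ?thesis by (simp add: fourier_inv_def)
  qed
  thus ?thesis using tm tK by (simp add: is_inverse_fourier_def)
qed

text \<open>Real shifts of \<omega> act on exp (- s \<omega>) by pure powers. In the application the
  shifts are \<alpha> ln t and \<beta> ln |\<xi>|, which is the source of both the Riesz kernels and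
  the scaling in time.\<close>

lemma mb_integrand_shift:
  "r > 0 \<Longrightarrow> mb_integrand \<alpha> (\<omega> + of_real (c * ln r)) s = mb_integrand \<alpha> \<omega> s * rpow r (- (of_real c * s))"
  by (simp add: mb_integrand_def rpow_def ring_distribs exp_diff exp_minus exp_add field_simps)

lemma norm_riesz_const_polynomial:
  assumes "0 < a" "a < real d"
  obtains C N where "0 < C" "\<And>y. cmod (riesz_const d (Complex a y)) \<le> C * (1 + \<bar>y\<bar>) ^ N"
proof -
  obtain C N where C: "0 < C"
    "\<And>y. cmod (Gamma (Complex ((real d - a) / 2) y)) \<le> C * (1 + \<bar>y\<bar>) ^ N * cmod (Gamma (Complex (a / 2) y))"
    using norm_Gamma_ratio_polynomial[of "(real d - a) / 2" "a / 2"] assms by auto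
  define D where "D = C * (pi powr (- (real d - a) / 2) / pi powr (- a / 2))"
  have "cmod (riesz_const d (Complex a y)) \<le> D * (1 + \<bar>y\<bar>) ^ N" for y
  proof -
    let ?y = "y / 2"
    \<comment> \<open>Conjugation gives the two Gamma factors the same imaginary part, as their
      comparison along vertical lines demands.\<close>
    have e1: "(of_nat d - Complex a y) / 2 = cnj (Complex ((real d - a) / 2) ?y)" "Complex a y / 2 = Complex (a / 2) ?y"
      by (simp_all add: complex_eq_iff)
    have nz: "Gamma (Complex (a / 2) ?y) \<noteq> 0"
    proof -
      have "Complex (a / 2) ?y \<notin> \<int>\<^sub>\<le>\<^sub>0"
        using assms by (auto elim!: nonpos_Ints_cases' simp: complex_eq_iff)
      thus ?thesis by (simp add: Gamma_eq_zero_iff)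
    qed
    have n1: "cmod (rpow pi (- (of_nat d - Complex a y) / 2)) = pi powr (- (real d - a) / 2)"
      and n2: "cmod (rpow pi (- Complex a y / 2)) = pi powr (- a / 2)"
      by (simp_all add: norm_rpow)
    have "cmod (riesz_const d (Complex a y)) = cmod (Gamma (Complex ((real d - a) / 2) ?y)) / cmod (Gamma (Complex (a / 2) ?y)) *
        (pi powr (- (real d - a) / 2) / pi powr (- a / 2))"
      unfolding riesz_const_def norm_mult norm_divide n1 n2 unfolding e1 cnj_Gamma[symmetric] complex_mod_cnj by simp
    also have "\<dots> \<le> C * (1 + \<bar>y\<bar>) ^ N * (pi powr (- (real d - a) / 2) / pi powr (- a / 2))"
    proof (rule mult_right_mono)
      have "cmod (Gamma (Complex ((real d - a) / 2) ?y)) / cmod (Gamma (Complex (a / 2) ?y)) \<le> C * (1 + \<bar>?y\<bar>) ^ N"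
        using C(2)[of ?y] nz by (simp add: divide_le_eq)
      also have "C * (1 + \<bar>?y\<bar>) ^ N \<le> C * (1 + \<bar>y\<bar>) ^ N"
        using C(1) by (intro mult_left_mono power_mono) auto
      finally show "cmod (Gamma (Complex ((real d - a) / 2) ?y)) / cmod (Gamma (Complex (a / 2) ?y)) \<le> C * (1 + \<bar>y\<bar>) ^ N" .
    qed simp
    also have "\<dots> = D * (1 + \<bar>y\<bar>) ^ N" by (simp only: D_def mult_ac)
    finally show ?thesis .
  qed
  moreover have "D > 0" using C(1) by (simp add: D_def)
  ultimately show ?thesis using that by blast
qed

lemma integrable_mb_riesz:
  fixes \<omega> :: complex
  assumes "\<alpha> > 0" "\<bar>Im \<omega>\<bar> < pi - \<alpha> * pi / 2" "0 < \<gamma>" "\<gamma> < 1" "\<beta> > 0" "\<beta> * \<gamma> < real d"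
  shows "integrable lborel (\<lambda>y. mb_integrand \<alpha> \<omega> (Complex \<gamma> y) * riesz_const d (of_real \<beta> * Complex \<gamma> y))"
proof -
  have sin: "sin (pi * \<gamma>) \<noteq> 0" using sin_gt_zero[of "pi * \<gamma>"] assms by simp
  define \<delta> where "\<delta> = pi - \<alpha> * pi / 2 - \<bar>Im \<omega>\<bar>"
  obtain D where D: "\<And>y. cmod (mb_integrand \<alpha> \<omega> (Complex \<gamma> y)) \<le> D * ((1 + \<bar>y\<bar>) * exp (- \<delta> * \<bar>y\<bar>))"
    using norm_mb_integrand_vertical_le[OF \<open>\<alpha> > 0\<close> \<open>\<gamma> < 1\<close> sin, of \<omega>] unfolding \<delta>_def by blast
  obtain C N where C: "0 < C" "\<And>y. cmod (riesz_const d (Complex (\<beta> * \<gamma>) y)) \<le> C * (1 + \<bar>y\<bar>) ^ N"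
    using norm_riesz_const_polynomial[of "\<beta> * \<gamma>" d] assms by auto
  have "integrable lborel (\<lambda>y. (D * C * (1 + \<beta>) ^ N) * ((1 + \<bar>y\<bar>) ^ (N + 1) * exp (- \<delta> * \<bar>y\<bar>)))"
    using assms by (intro integrable_mult_right integrable_poly_exp_minus_abs) (simp add: \<delta>_def)
  thus ?thesis
  proof (rule Bochner_Integration.integrable_bound)
    have "(\<lambda>y. mb_integrand \<alpha> \<omega> (Complex \<gamma> y)) \<in> borel_measurable borel"
      using integrable_mb_integrand[OF assms(1,2,4) sin] by auto
    moreover have "(\<lambda>y. of_real \<beta> * Complex \<gamma> y) \<in> borel_measurable borel"
      unfolding Complex_eq by measurable
    ultimately show "(\<lambda>y. mb_integrand \<alpha> \<omega> (Complex \<gamma> y) * riesz_const d (of_real \<beta> * Complex \<gamma> y)) \<in> borel_measurable lborel"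
      by measurable
    show "AE y in lborel. norm (mb_integrand \<alpha> \<omega> (Complex \<gamma> y) * riesz_const d (of_real \<beta> * Complex \<gamma> y))
        \<le> norm ((D * C * (1 + \<beta>) ^ N) * ((1 + \<bar>y\<bar>) ^ (N + 1) * exp (- \<delta> * \<bar>y\<bar>)))"
    proof (rule AE_I2)
      fix y :: real
      have "of_real \<beta> * Complex \<gamma> y = Complex (\<beta> * \<gamma>) (\<beta> * y)" by (simp add: complex_eq_iff)
      hence "cmod (riesz_const d (of_real \<beta> * Complex \<gamma> y)) \<le> C * (1 + \<bar>\<beta> * y\<bar>) ^ N" using C(2) by simp
      also have "\<dots> \<le> C * ((1 + \<beta>) * (1 + \<bar>y\<bar>)) ^ N"
        using C(1) assms by (intro mult_left_mono power_mono) (auto simp: abs_mult algebra_simps)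
      finally have 1: "cmod (riesz_const d (of_real \<beta> * Complex \<gamma> y)) \<le> C * ((1 + \<beta>) * (1 + \<bar>y\<bar>)) ^ N" .
      have "norm (mb_integrand \<alpha> \<omega> (Complex \<gamma> y) * riesz_const d (of_real \<beta> * Complex \<gamma> y))
        \<le> (D * ((1 + \<bar>y\<bar>) * exp (- \<delta> * \<bar>y\<bar>))) * (C * ((1 + \<beta>) * (1 + \<bar>y\<bar>)) ^ N)"
        unfolding norm_mult by (intro mult_mono D 1 order_trans[OF norm_ge_zero D]) auto
      also have "\<dots> = (D * C * (1 + \<beta>) ^ N) * ((1 + \<bar>y\<bar>) ^ (N + 1) * exp (- \<delta> * \<bar>y\<bar>))"
        by (simp add: power_mult_distrib mult_ac)
      finally show "norm (mb_integrand \<alpha> \<omega> (Complex \<gamma> y) * riesz_const d (of_real \<beta> * Complex \<gamma> y))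
        \<le> norm ((D * C * (1 + \<beta>) ^ N) * ((1 + \<bar>y\<bar>) ^ (N + 1) * exp (- \<delta> * \<bar>y\<bar>)))"
        unfolding real_norm_def by (rule order_trans[OF _ abs_ge_self])
    qed
  qed
qed


lemma
  fixes c :: real and a :: "'a::euclidean_space"
  assumes c: "c \<noteq> 0"
  shows nn_integral_lborel_affine:
      "f \<in> borel_measurable borel \<Longrightarrow>
        (\<integral>\<^sup>+x. f (a + c *\<^sub>R x) \<partial>lborel) = ennreal (1 / \<bar>c\<bar> ^ DIM('a)) * (\<integral>\<^sup>+x. f x \<partial>lborel)"
    and AE_lborel_affine:
      "AE x in lborel. P x \<Longrightarrow> AE x in lborel. P (a + c *\<^sub>R x)"
proof -
  have m: "(\<lambda>x. a + c *\<^sub>R x) \<in> measurable lborel borel" by simp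
  have L: "lborel = density (distr lborel borel (\<lambda>x. a + c *\<^sub>R x)) (\<lambda>_. ennreal (\<bar>c\<bar> ^ DIM('a)))"
    using lborel_affine[OF c, of a] by (simp add: ennreal_power)
  show nn: "(\<integral>\<^sup>+x. f (a + c *\<^sub>R x) \<partial>lborel) = ennreal (1 / \<bar>c\<bar> ^ DIM('a)) * (\<integral>\<^sup>+x. f x \<partial>lborel)"
    if [measurable]: "f \<in> borel_measurable borel" for f
  proof -
    have "(\<integral>\<^sup>+x. f x \<partial>lborel) = ennreal (\<bar>c\<bar> ^ DIM('a)) * (\<integral>\<^sup>+x. f (a + c *\<^sub>R x) \<partial>lborel)"
      by (subst L) (simp add: nn_integral_density nn_integral_distr nn_integral_cmult)
    hence "ennreal (1 / \<bar>c\<bar> ^ DIM('a)) * (\<integral>\<^sup>+x. f x \<partial>lborel) =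
        (ennreal (1 / \<bar>c\<bar> ^ DIM('a)) * ennreal (\<bar>c\<bar> ^ DIM('a))) * (\<integral>\<^sup>+x. f (a + c *\<^sub>R x) \<partial>lborel)"
      by (simp add: mult.assoc)
    also have "ennreal (1 / \<bar>c\<bar> ^ DIM('a)) * ennreal (\<bar>c\<bar> ^ DIM('a)) = 1"
      using c by (subst ennreal_mult[symmetric]) auto
    finally show ?thesis by simp
  qed
  show "AE x in lborel. P (a + c *\<^sub>R x)" if P: "AE x in lborel. P x" for P
  proof -
    obtain N where N: "{x \<in> space lborel. \<not> P x} \<subseteq> N" "emeasure lborel N = 0" and [measurable]: "N \<in> sets borel"
      using P by (rule AE_E) auto
    have "(\<integral>\<^sup>+x. indicator N (a + c *\<^sub>R x) \<partial>lborel) = 0"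
      using N(2) by (subst nn) auto
    hence "AE x in lborel. indicator N (a + c *\<^sub>R x) = (0::ennreal)"
      by (subst (asm) nn_integral_0_iff_AE) auto
    thus ?thesis by eventually_elim (use N(1) in \<open>auto simp: indicator_def split: if_splits\<close>)
  qed
qed

text \<open>\<psi> is the angle of the ray measured from the negative axis, as an argument of the
  form - exp \<omega> asks for, and the case distinction selects a representative modulo 2 pi. Then
  |\<psi>| = ||\<mu> - \<nu>| - 1| pi, which is why the two bounds on |\<mu> - \<nu>| are symmetric
  about 1.\<close>

lemma ray_angle:
  assumes "\<mu> \<in> {-1<..1}" "\<nu> \<in> {-1<..1}" "\<bar>\<mu> - \<nu>\<bar> > \<alpha> / 2" "\<bar>\<mu> - \<nu>\<bar> < 2 - \<alpha> / 2"
  obtains \<psi> where "cis ((\<nu> - \<mu>) * pi) = - cis \<psi>" "\<bar>\<psi>\<bar> < pi - \<alpha> * pi / 2"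
proof -
  define \<psi> where "\<psi> = (if \<nu> \<ge> \<mu> then (\<nu> - \<mu> - 1) * pi else (\<nu> - \<mu> + 1) * pi)"
  have "cis ((\<nu> - \<mu>) * pi) = - cis \<psi>"
    by (auto simp: \<psi>_def complex_eq_iff algebra_simps cos_diff sin_diff cos_add sin_add)
  moreover have "\<bar>\<psi>\<bar> < pi - \<alpha> * pi / 2"
  proof -
    have "\<bar>\<psi>\<bar> = \<bar>\<bar>\<mu> - \<nu>\<bar> - 1\<bar> * pi" by (auto simp: \<psi>_def abs_mult)
    also have "\<dots> < (1 - \<alpha> / 2) * pi"
    proof (rule mult_strict_right_mono)
      show "\<bar>\<bar>\<mu> - \<nu>\<bar> - 1\<bar> < 1 - \<alpha> / 2" unfolding abs_less_iff[of "\<bar>\<mu> - \<nu>\<bar> - 1"] using assms(3,4) by linarith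
    qed simp
    finally show ?thesis by (simp add: algebra_simps)
  qed
  ultimately show ?thesis using that by blast
qed

section \<open>The symbol and its inverse transform\<close>

definition ml_symbol :: "real \<Rightarrow> real \<Rightarrow> real \<Rightarrow> real \<Rightarrow> real \<Rightarrow> 'a::euclidean_space \<Rightarrow> complex" where
  "ml_symbol \<alpha> \<beta> \<mu> \<nu> t \<xi> = mittag_leffler \<alpha> \<alpha> (cis ((\<nu> - \<mu>) * pi) * complex_of_real (t powr \<alpha> * norm \<xi> powr \<beta>))"

lemma kernel_W_eq: "kernel_W \<alpha> \<beta> \<mu> \<nu> t = inverse_fourier (ml_symbol \<alpha> \<beta> \<mu> \<nu> t)"
  by (simp add: kernel_W_def ml_symbol_def[abs_def])

text \<open>A single explicit K shows that the choice operator has something to choose, and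
  uniqueness then fixes the choice up to a null set.\<close>

lemma inverse_fourier_eq:
  assumes "is_inverse_fourier m K"
  shows "AE x in lborel. inverse_fourier m x = K x" "inverse_fourier m \<in> borel_measurable borel"
proof -
  have *: "is_inverse_fourier m (inverse_fourier m)"
    unfolding inverse_fourier_def by (rule someI[of "is_inverse_fourier m", OF assms])
  show "AE x in lborel. inverse_fourier m x = K x" using * assms by (rule is_inverse_fourier_unique)
  show "inverse_fourier m \<in> borel_measurable borel"
    using * by (auto simp: is_inverse_fourier_def intro: tempered_measurable)
qed

text \<open>For an integrable symbol the distributional inverse is the classical integral, which is
  bounded. This serves the endpoint p = 1 and q infinite, where a bounded kernel is
  required.\<close>

lemma is_inverse_fourier_integrable:
  fixes m :: "'a::euclidean_space \<Rightarrow> complex"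
  assumes m: "integrable lborel m" and tm: "tempered m"
  shows "is_inverse_fourier m (fourier_inv m)"
proof -
  have [measurable]: "m \<in> borel_measurable borel" using m by auto
  have [measurable]: "fourier_inv m \<in> borel_measurable borel" by (rule fourier_inv_measurable) measurable
  have "tempered (fourier_inv m)"
  proof (rule tempered_norm_powr[where a = 0])
    show "AE x in lborel. norm (fourier_inv m x) \<le> (\<integral>x. norm (m x) \<partial>lborel) * norm x powr (- 0)"
      using AE_lborel_singleton[of "0::'a"] by eventually_elim (simp add: norm_fourier_inv_le)
  qed auto
  moreover have "(\<integral>x. fourier_inv m x * \<phi> x \<partial>lborel) = (\<integral>\<xi>. m \<xi> * (\<integral>x. cis (2 * pi * (x \<bullet> \<xi>)) * \<phi> x \<partial>lborel) \<partial>lborel)"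
    if \<phi>: "schwartz \<phi>" for \<phi>
  proof -
    have i\<phi>: "integrable lborel \<phi>" by (rule schwartz_integrable[OF \<phi>])
    have [measurable]: "\<phi> \<in> borel_measurable borel" by (rule schwartz_measurable[OF \<phi>])
    let ?F = "\<lambda>x \<xi>. cis (2 * pi * (\<xi> \<bullet> x)) * m \<xi> * \<phi> x"
    have int: "integrable (lborel \<Otimes>\<^sub>M lborel) (\<lambda>(x, \<xi>). ?F x \<xi>)"
    proof (rule lborel_pair.Fubini_integrable)
      show "(\<lambda>(x, \<xi>). ?F x \<xi>) \<in> borel_measurable (lborel \<Otimes>\<^sub>M lborel)" unfolding cis_conv_exp by measurable
      show "AE x in lborel. integrable lborel (\<lambda>\<xi>. case (x, \<xi>) of (x, \<xi>) \<Rightarrow> ?F x \<xi>)"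
        using integrable_cis_mult[OF m] by auto
      show "integrable lborel (\<lambda>x. \<integral>\<xi>. norm (case (x, \<xi>) of (x, \<xi>) \<Rightarrow> ?F x \<xi>) \<partial>lborel)"
        using i\<phi> by (simp add: norm_mult)
    qed
    have "(\<integral>x. fourier_inv m x * \<phi> x \<partial>lborel) = (\<integral>x. (\<integral>\<xi>. ?F x \<xi> \<partial>lborel) \<partial>lborel)"
      by (simp only: fourier_inv_def integral_mult_left_zero)
    also have "\<dots> = (\<integral>\<xi>. (\<integral>x. ?F x \<xi> \<partial>lborel) \<partial>lborel)"
      by (rule lborel_pair.Fubini_integral[OF int, symmetric])
    also have "\<dots> = (\<integral>\<xi>. m \<xi> * (\<integral>x. cis (2 * pi * (x \<bullet> \<xi>)) * \<phi> x \<partial>lborel) \<partial>lborel)"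
      by (simp only: integral_mult_right_zero[symmetric] inner_commute mult_ac)
    finally show ?thesis .
  qed
  ultimately show ?thesis using tm by (simp add: is_inverse_fourier_def)
qed

section \<open>The kernel for a fixed ray\<close>

locale ml_kernel =
  fixes \<alpha> \<beta> \<mu> \<nu> \<psi> :: real
  assumes \<alpha>: "\<alpha> > 0" and \<beta>: "\<beta> > 0"
    and \<psi>: "cis ((\<nu> - \<mu>) * pi) = - cis \<psi>" "\<bar>\<psi>\<bar> < pi - \<alpha> * pi / 2"
begin

text \<open>The Mellin-Barnes density when t and |\<xi>| are both 1: there \<omega> reduces to i
  \<psi>, and - exp \<omega> is the unit vector of the ray.\<close>

definition weight :: "real \<Rightarrow> real \<Rightarrow> complex" where
  "weight \<gamma> y = mb_integrand \<alpha> (Complex 0 \<psi>) (Complex \<gamma> y) / (2 * pi)"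

definition expo :: "real \<Rightarrow> real \<Rightarrow> complex" where
  "expo \<gamma> y = of_real \<beta> * Complex \<gamma> y"

text \<open>The symbol at time 1 with each power replaced by its Riesz kernel. The line \<gamma>
  stays a parameter because every line gives another pointwise bound.\<close>

definition kern :: "real \<Rightarrow> 'a::euclidean_space \<Rightarrow> complex" where
  "kern \<gamma> x = (\<integral>y. weight \<gamma> y * riesz_const DIM('a) (expo \<gamma> y) * rpow (norm x) (- (of_nat DIM('a) - expo \<gamma> y)) \<partial>lborel)"

lemma expo_measurable [measurable]: "expo \<gamma> \<in> borel_measurable borel"
  unfolding expo_def[abs_def] Complex_eq by measurable

lemma Re_expo: "Re (expo \<gamma> y) = \<beta> * \<gamma>"
  by (simp add: expo_def)

lemma weight_shift:
  assumes "t > 0"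
  shows "weight \<gamma> y * rpow t (- (of_real \<alpha> * Complex \<gamma> y)) =
    mb_integrand \<alpha> (Complex 0 \<psi> + of_real (\<alpha> * ln t)) (Complex \<gamma> y) / (2 * pi)"
  unfolding weight_def mb_integrand_shift[OF assms] by simp

lemma integrable_weight_shift:
  assumes "0 < \<gamma>" "\<gamma> < 1" "t > 0"
  shows "integrable lborel (\<lambda>y. weight \<gamma> y * rpow t (- (of_real \<alpha> * Complex \<gamma> y)))"
proof -
  have "sin (pi * \<gamma>) \<noteq> 0" using sin_gt_zero[of "pi * \<gamma>"] assms by simp
  thus ?thesis unfolding weight_shift[OF \<open>t > 0\<close>]
    using \<alpha> \<psi> assms by (intro integrable_divide integrable_mb_integrand) auto
qed

lemma integrable_weight_shift_riesz:
  assumes "0 < \<gamma>" "\<gamma> < 1" "\<beta> * \<gamma> < real d" "t > 0"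
  shows "integrable lborel (\<lambda>y. weight \<gamma> y * rpow t (- (of_real \<alpha> * Complex \<gamma> y)) * riesz_const d (expo \<gamma> y))"
proof -
  have "integrable lborel (\<lambda>y. mb_integrand \<alpha> (Complex 0 \<psi> + of_real (\<alpha> * ln t)) (Complex \<gamma> y) * riesz_const d (expo \<gamma> y) / (2 * pi))"
    unfolding expo_def using \<alpha> \<beta> \<psi> assms by (intro integrable_divide integrable_mb_riesz) auto
  thus ?thesis unfolding weight_shift[OF \<open>t > 0\<close>] by simp
qed

lemma ml_symbol_eq:
  assumes "0 < \<gamma>" "\<gamma> < 1" "t > 0" "\<xi> \<noteq> 0"
  shows "ml_symbol \<alpha> \<beta> \<mu> \<nu> t \<xi> =
    (\<integral>y. weight \<gamma> y * rpow t (- (of_real \<alpha> * Complex \<gamma> y)) * rpow (norm \<xi>) (- expo \<gamma> y) \<partial>lborel)"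
proof -
  let ?\<omega>' = "Complex 0 \<psi> + of_real (\<alpha> * ln t)"
  let ?\<omega> = "?\<omega>' + of_real (\<beta> * ln (norm \<xi>))"
  have "exp ?\<omega> = cis \<psi> * complex_of_real (t powr \<alpha> * norm \<xi> powr \<beta>)"
    using assms by (simp add: exp_add cis_conv_exp Complex_eq powr_def exp_of_real[symmetric])
  hence "ml_symbol \<alpha> \<beta> \<mu> \<nu> t \<xi> = mittag_leffler \<alpha> \<alpha> (- exp ?\<omega>)"
    by (simp add: ml_symbol_def \<psi>)
  also have "\<dots> = (\<integral>y. mb_integrand \<alpha> ?\<omega> (Complex \<gamma> y) \<partial>lborel) / (2 * pi)"
    using \<alpha> \<psi> assms by (intro mittag_leffler_Mellin_Barnes) auto
  also have "\<dots> = (\<integral>y. mb_integrand \<alpha> ?\<omega> (Complex \<gamma> y) / (2 * pi) \<partial>lborel)"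
    by (rule integral_divide_zero[symmetric])
  also have "\<dots> = (\<integral>y. weight \<gamma> y * rpow t (- (of_real \<alpha> * Complex \<gamma> y)) * rpow (norm \<xi>) (- expo \<gamma> y) \<partial>lborel)"
  proof (intro Bochner_Integration.integral_cong refl)
    fix y :: real
    have n: "norm \<xi> > 0" using assms by simp
    show "mb_integrand \<alpha> ?\<omega> (Complex \<gamma> y) / (2 * pi) =
        weight \<gamma> y * rpow t (- (of_real \<alpha> * Complex \<gamma> y)) * rpow (norm \<xi>) (- expo \<gamma> y)"
      unfolding mb_integrand_shift[OF n] weight_shift[OF \<open>t > 0\<close>] expo_def by simp
  qed
  finally show ?thesis .
qed

lemma norm_ml_symbol_le:
  assumes "0 < \<gamma>" "\<gamma> < 1"
  obtains C where "\<And>\<xi>::'a::euclidean_space. \<xi> \<noteq> 0 \<Longrightarrow> cmod (ml_symbol \<alpha> \<beta> \<mu> \<nu> 1 \<xi>) \<le> C * norm \<xi> powr (- (\<beta> * \<gamma>))"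
proof -
  have "cmod (ml_symbol \<alpha> \<beta> \<mu> \<nu> 1 \<xi>) \<le>
      (\<integral>y. cmod (weight \<gamma> y * rpow 1 (- (of_real \<alpha> * Complex \<gamma> y))) \<partial>lborel) * norm \<xi> powr (- (\<beta> * \<gamma>))"
    if "\<xi> \<noteq> 0" for \<xi> :: 'a
    unfolding ml_symbol_eq[OF assms zero_less_one that]
    by (rule norm_rpow_superposition_le[OF integrable_weight_shift[OF assms zero_less_one] expo_measurable Re_expo]) simp
  thus ?thesis using that by blast
qed

lemma kern_measurable [measurable]: "kern \<gamma> \<in> borel_measurable borel"
proof -
  have [measurable]: "weight \<gamma> \<in> borel_measurable borel"
    unfolding weight_def[abs_def] mb_integrand_def Complex_eq
  proof -
    have [measurable]: "(rGamma :: complex \<Rightarrow> complex) \<in> borel_measurable borel"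
      by (intro borel_measurable_continuous_onI continuous_on_rGamma)
    have [measurable]: "(sin :: complex \<Rightarrow> complex) \<in> borel_measurable borel"
      by (intro borel_measurable_continuous_onI continuous_intros)
    show "(\<lambda>y. complex_of_real pi * rGamma (complex_of_real \<alpha> * (1 - (complex_of_real \<gamma> + \<i> * complex_of_real y))) *
          exp (- (complex_of_real \<gamma> + \<i> * complex_of_real y) * (complex_of_real 0 + \<i> * complex_of_real \<psi>)) /
          sin (complex_of_real pi * (complex_of_real \<gamma> + \<i> * complex_of_real y)) / complex_of_real (2 * pi))
        \<in> borel_measurable borel" by measurable
  qed
  show ?thesis unfolding kern_def[abs_def] by (rule rpow_superposition_measurable) measurable
qed

lemma norm_kern_le:
  assumes "0 < \<gamma>" "\<gamma> < 1" "\<beta> * \<gamma> < DIM('a)"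
  obtains C where "\<And>x::'a::euclidean_space. cmod (kern \<gamma> x) \<le> C * norm x powr (- (DIM('a) - \<beta> * \<gamma>))"
proof -
  have i: "integrable lborel (\<lambda>y. weight \<gamma> y * riesz_const DIM('a) (expo \<gamma> y))"
    using integrable_weight_shift_riesz[OF assms zero_less_one] by (simp add: rpow_def)
  have "cmod (kern \<gamma> x) \<le> (\<integral>y. cmod (weight \<gamma> y * riesz_const DIM('a) (expo \<gamma> y)) \<partial>lborel) *
      norm x powr (- (DIM('a) - \<beta> * \<gamma>))" for x :: 'a
    unfolding kern_def by (rule norm_rpow_superposition_le[OF i]) (auto simp: Re_expo)
  thus ?thesis using that by blast
qed

text \<open>The dilation is read off under the integral sign. With s = \<gamma> + i y, t^(-\<alpha>
  s) equals t^(-\<alpha> d / \<beta>) times the power - (d - \<beta> s) of t^(-\<alpha> / \<beta>),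
  and the latter merges with the same power of |x|.\<close>

lemma is_inverse_fourier_kern:
  assumes \<gamma>: "0 < \<gamma>" "\<gamma> < 1" "\<beta> * \<gamma> < DIM('a)" and t: "t > 0"
  shows "is_inverse_fourier (ml_symbol \<alpha> \<beta> \<mu> \<nu> t)
    (\<lambda>x::'a::euclidean_space. of_real (t powr (- (\<alpha> / \<beta> * DIM('a)))) * kern \<gamma> (t powr (- (\<alpha> / \<beta>)) *\<^sub>R x))"
proof -
  let ?w = "\<lambda>y. weight \<gamma> y * rpow t (- (of_real \<alpha> * Complex \<gamma> y))"
  have "is_inverse_fourier (ml_symbol \<alpha> \<beta> \<mu> \<nu> t)
    (\<lambda>x::'a. \<integral>y. ?w y * riesz_const DIM('a) (expo \<gamma> y) * rpow (norm x) (- (of_nat DIM('a) - expo \<gamma> y)) \<partial>lborel)"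
    using \<gamma> t \<beta> integrable_weight_shift[OF \<gamma>(1,2) t] integrable_weight_shift_riesz[OF \<gamma> t]
    by (intro is_inverse_fourier_superposition[where a = "\<beta> * \<gamma>"] ml_symbol_eq) (auto simp: Re_expo)
  moreover have "(\<integral>y. ?w y * riesz_const DIM('a) (expo \<gamma> y) * rpow (norm x) (- (of_nat DIM('a) - expo \<gamma> y)) \<partial>lborel) =
      of_real (t powr (- (\<alpha> / \<beta> * DIM('a)))) * kern \<gamma> (t powr (- (\<alpha> / \<beta>)) *\<^sub>R x)" for x :: 'a
    unfolding kern_def integral_mult_right_zero[symmetric]
  proof (intro Bochner_Integration.integral_cong refl)
    fix y :: real
    let ?k' = "- (of_nat DIM('a) - expo \<gamma> y)"
    have "rpow t (- (of_real \<alpha> * Complex \<gamma> y)) =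
        of_real (t powr (- (\<alpha> / \<beta> * DIM('a)))) * rpow (t powr (- (\<alpha> / \<beta>))) ?k'"
    proof -
      have "- (of_real \<alpha> * Complex \<gamma> y) * of_real (ln t) =
          complex_of_real (- (\<alpha> / \<beta> * DIM('a)) * ln t) + ?k' * of_real (- (\<alpha> / \<beta>) * ln t)"
        using \<beta> by (simp add: expo_def field_simps)
      hence "exp (- (of_real \<alpha> * Complex \<gamma> y) * of_real (ln t)) =
          of_real (exp (- (\<alpha> / \<beta> * DIM('a)) * ln t)) * exp (?k' * of_real (- (\<alpha> / \<beta>) * ln t))"
        by (simp only: exp_add exp_of_real)
      thus ?thesis using t by (simp add: rpow_def powr_def)
    qed
    moreover have "rpow (norm (t powr (- (\<alpha> / \<beta>)) *\<^sub>R x)) ?k' = rpow (t powr (- (\<alpha> / \<beta>))) ?k' * rpow (norm x) ?k'"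
      by (simp add: rpow_mult)
    ultimately show "?w y * riesz_const DIM('a) (expo \<gamma> y) * rpow (norm x) ?k' =
        of_real (t powr (- (\<alpha> / \<beta> * DIM('a)))) * (weight \<gamma> y * riesz_const DIM('a) (expo \<gamma> y) *
          rpow (norm (t powr (- (\<alpha> / \<beta>)) *\<^sub>R x)) ?k')"
      by (simp only: mult_ac)
  qed
  ultimately show ?thesis by simp
qed

text \<open>Both functions are inverse transforms of the same symbol at time 1, so uniqueness takes
  the place of moving the contour in the kernel integral.\<close>

lemma kern_AE_eq:
  assumes "0 < \<gamma>" "\<gamma> < 1" "\<beta> * \<gamma> < DIM('a)" and "0 < \<delta>" "\<delta> < 1" "\<beta> * \<delta> < DIM('a)"
  shows "AE x in lborel. kern \<gamma> x = kern \<delta> (x::'a::euclidean_space)"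
  using is_inverse_fourier_unique[OF is_inverse_fourier_kern[OF assms(1-3), of 1] is_inverse_fourier_kern[OF assms(4-6), of 1]]
  by simp

lemma integrable_kern_powr:
  assumes \<theta>: "0 < \<theta>" "\<theta> < 1" "\<theta> < \<beta> / DIM('a)" and \<gamma>: "0 < \<gamma>" "\<gamma> < 1" "\<beta> * \<gamma> < DIM('a)"
  shows "integrable lborel (\<lambda>x::'a::euclidean_space. cmod (kern \<gamma> x) powr (1 / (1 - \<theta>)))"
proof -
  let ?d = "real DIM('a)"
  have d: "?d > 0" by simp
  have \<theta>d: "0 < ?d * \<theta>" "?d * \<theta> < ?d" "?d * \<theta> < \<beta>"
  proof -
    show "0 < ?d * \<theta>" by (rule mult_pos_pos[OF d \<theta>(1)])
    show "?d * \<theta> < ?d" using mult_strict_left_mono[OF \<theta>(2) d] by simp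
    show "?d * \<theta> < \<beta>" using \<theta>(3) by (simp add: pos_less_divide_eq[OF d] mult.commute)
  qed
  \<comment> \<open>The line b / \<beta> is admissible for b below both d and \<beta>. Its bound to
    the power s is a multiple of |x|^(- (d - b) s), and (d - b) s = d at b = d \<theta>. So
    \<open>b1\<close> gives integrability at the origin and \<open>b2\<close> at infinity.\<close>
  obtain b1 where b1: "?d * \<theta> < b1" "b1 < min ?d \<beta>" using dense[of "?d * \<theta>" "min ?d \<beta>"] \<theta>d by auto
  define b2 where "b2 = ?d * \<theta> / 2"
  have b2: "0 < b2" "b2 < ?d * \<theta>" using \<theta>d(1) unfolding b2_def by linarith+
  define s where "s = 1 / (1 - \<theta>)"
  have s: "s > 0" "(1 - \<theta>) * s = 1" using \<theta> by (auto simp: s_def)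
  have bound: "\<exists>C. AE x in lborel. \<bar>cmod (kern \<gamma> (x::'a)) powr s\<bar> \<le> C * norm x powr (- ((?d - b) * s))"
    if b: "0 < b" "b < ?d" "b < \<beta>" for b
  proof -
    have g: "0 < b / \<beta>" "b / \<beta> < 1" "\<beta> * (b / \<beta>) < ?d" using b \<beta> by auto
    obtain C where C: "\<And>x::'a. cmod (kern (b / \<beta>) x) \<le> C * norm x powr (- (?d - \<beta> * (b / \<beta>)))"
      using norm_kern_le[OF g] by blast
    have "AE x in lborel. \<bar>cmod (kern \<gamma> (x::'a)) powr s\<bar> \<le> (\<bar>C\<bar> powr s) * norm x powr (- ((?d - b) * s))"
      using kern_AE_eq[OF \<gamma> g]
    proof eventually_elim
      case (elim x)
      have "cmod (kern \<gamma> x) \<le> \<bar>C\<bar> * norm x powr (- (?d - b))"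
        using C[of x] \<beta> unfolding elim by (elim order_trans) (simp add: mult_right_mono)
      hence "cmod (kern \<gamma> x) powr s \<le> (\<bar>C\<bar> * norm x powr (- (?d - b))) powr s"
        using s by (intro powr_mono2) auto
      thus ?case by (simp add: powr_mult powr_powr algebra_simps)
    qed
    thus ?thesis by blast
  qed
  obtain C1 where C1: "AE x in lborel. \<bar>cmod (kern \<gamma> (x::'a)) powr s\<bar> \<le> C1 * norm x powr (- ((?d - b1) * s))"
    using bound[of b1] b1 \<theta>d by auto
  obtain C2 where C2: "AE x in lborel. \<bar>cmod (kern \<gamma> (x::'a)) powr s\<bar> \<le> C2 * norm x powr (- ((?d - b2) * s))"
    using bound[of b2] b2 \<theta>d by auto
  have ds: "?d * (1 - \<theta>) * s = ?d" using s by (simp add: mult.assoc)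
  have "(?d - b1) * s < ?d * (1 - \<theta>) * s" using b1 s by (intro mult_strict_right_mono) (auto simp: algebra_simps)
  moreover have "?d * (1 - \<theta>) * s < (?d - b2) * s" using b2 s by (intro mult_strict_right_mono) (auto simp: algebra_simps)
  moreover have "0 < (?d - b1) * s" using b1 s by (intro mult_pos_pos) auto
  ultimately show ?thesis unfolding s_def[symmetric] ds
    by (intro integrable_min_powr[OF _ _ _ _ C1 C2]) auto
qed

lemma kern_bounded:
  assumes "\<beta> > DIM('a)" and \<gamma>: "0 < \<gamma>" "\<gamma> < 1" "\<beta> * \<gamma> < DIM('a)"
  obtains M where "AE x in lborel. cmod (kern \<gamma> (x::'a::euclidean_space)) \<le> M"
proof -
  let ?d = "real DIM('a)"
  let ?m = "ml_symbol \<alpha> \<beta> \<mu> \<nu> 1 :: 'a \<Rightarrow> complex"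
  have d: "?d > 0" by simp
  have K: "is_inverse_fourier ?m (kern \<gamma>)" using is_inverse_fourier_kern[OF \<gamma>, of 1] by simp
  hence t: "tempered ?m" by (simp add: is_inverse_fourier_def)
  have [measurable]: "?m \<in> borel_measurable borel" using t by (rule tempered_measurable)
  have bound: "\<exists>C. AE \<xi> in lborel. \<bar>cmod (?m \<xi>)\<bar> \<le> C * norm \<xi> powr (- b)" if b: "0 < b" "b < \<beta>" for b
  proof -
    have g: "0 < b / \<beta>" "b / \<beta> < 1" using b \<beta> by auto
    obtain C where C: "\<And>\<xi>::'a. \<xi> \<noteq> 0 \<Longrightarrow> cmod (?m \<xi>) \<le> C * norm \<xi> powr (- (\<beta> * (b / \<beta>)))"
      using norm_ml_symbol_le[OF g] by blast
    have "AE \<xi> in lborel. \<bar>cmod (?m \<xi>)\<bar> \<le> C * norm \<xi> powr (- b)"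
      using AE_lborel_singleton[of "0::'a"] by eventually_elim (use C \<beta> in auto)
    thus ?thesis by blast
  qed
  \<comment> \<open>Integrability of the symbol at infinity takes decay faster than |\<xi>|^(-d),
    which the strip provides because \<beta> > d; the exponent d / 2 handles the origin.\<close>
  obtain b2 where b2: "?d < b2" "b2 < \<beta>" using dense assms(1) by blast
  obtain C1 where C1: "AE \<xi> in lborel. \<bar>cmod (?m \<xi>)\<bar> \<le> C1 * norm \<xi> powr (- (?d / 2))"
    using bound[of "?d / 2"] assms(1) d by auto
  obtain C2 where C2: "AE \<xi> in lborel. \<bar>cmod (?m \<xi>)\<bar> \<le> C2 * norm \<xi> powr (- b2)"
    using bound[of b2] b2 d by auto
  have "integrable lborel (\<lambda>\<xi>. cmod (?m \<xi>))"
    using b2 by (intro integrable_min_powr[OF _ _ _ _ C1 C2]) auto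
  hence im: "integrable lborel ?m" by (subst (asm) integrable_norm_iff) auto
  have "AE x in lborel. kern \<gamma> (x::'a) = fourier_inv ?m x"
    by (rule is_inverse_fourier_unique[OF K is_inverse_fourier_integrable[OF im t]])
  hence "AE x in lborel. cmod (kern \<gamma> (x::'a)) \<le> (\<integral>x. norm (?m x) \<partial>lborel)"
    by eventually_elim (simp add: norm_fourier_inv_le)
  thus ?thesis using that by blast
qed

end

definition scaled_kernel :: "real \<Rightarrow> real \<Rightarrow> ('a::euclidean_space \<Rightarrow> complex) \<Rightarrow> real \<Rightarrow> 'a \<Rightarrow> complex" where
  "scaled_kernel \<alpha> \<beta> K t x = of_real (t powr (- (\<alpha> / \<beta> * DIM('a)))) * K (t powr (- (\<alpha> / \<beta>)) *\<^sub>R x)"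

text \<open>\<open>K\<close> is chosen before t, so every constant derived from it is uniform in
  time. The angle of the ray and the auxiliary line no longer appear; uniqueness has absorbed
  them.\<close>

theorem kernel_W_structure:
  fixes \<alpha> \<beta> \<mu> \<nu> \<theta> :: real
  assumes "\<beta> > 0" "\<alpha> > 0" "\<mu> \<in> {-1<..1}" "\<nu> \<in> {-1<..1}" "\<bar>\<mu> - \<nu>\<bar> > \<alpha> / 2" "\<bar>\<mu> - \<nu>\<bar> < 2 - \<alpha> / 2"
    and \<theta>: "0 < \<theta>" "\<theta> < \<beta> / DIM('a)"
  shows "\<exists>K :: 'a::euclidean_space \<Rightarrow> complex. K \<in> borel_measurable borel \<and>
    (\<forall>t>0. (AE x in lborel. kernel_W \<alpha> \<beta> \<mu> \<nu> t x = scaled_kernel \<alpha> \<beta> K t x) \<and>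
      (kernel_W \<alpha> \<beta> \<mu> \<nu> t :: 'a \<Rightarrow> complex) \<in> borel_measurable borel) \<and>
    (\<theta> < 1 \<longrightarrow> integrable lborel (\<lambda>x. cmod (K x) powr (1 / (1 - \<theta>)))) \<and>
    (\<theta> = 1 \<longrightarrow> (\<exists>M. AE x in lborel. cmod (K x) \<le> M))"
proof -
  obtain \<psi> where \<psi>: "cis ((\<nu> - \<mu>) * pi) = - cis \<psi>" "\<bar>\<psi>\<bar> < pi - \<alpha> * pi / 2"
    using ray_angle[OF assms(3-6)] by blast
  interpret ml_kernel \<alpha> \<beta> \<mu> \<nu> \<psi> using assms(1,2) \<psi> by unfold_locales
  let ?d = "real DIM('a)"
  \<comment> \<open>Any admissible line may represent the kernel; half of the smaller of 1 and d /
    \<beta> is strictly below both.\<close>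
  define \<gamma> where "\<gamma> = min 1 (?d / \<beta>) / 2"
  have \<gamma>: "0 < \<gamma>" "\<gamma> < 1" using assms(1) by (auto simp: \<gamma>_def)
  have "\<beta> * \<gamma> \<le> \<beta> * (?d / \<beta> / 2)" using assms(1) by (intro mult_left_mono) (auto simp: \<gamma>_def)
  also have "\<dots> < ?d" using assms(1) by simp
  finally have \<gamma>': "\<beta> * \<gamma> < ?d" .
  note inv = is_inverse_fourier_kern[OF \<gamma> \<gamma>']
  show ?thesis
  proof (intro exI[of _ "kern \<gamma>"] conjI allI impI)
    show "kern \<gamma> \<in> borel_measurable borel" by measurable
    show "AE x in lborel. kernel_W \<alpha> \<beta> \<mu> \<nu> t x = scaled_kernel \<alpha> \<beta> (kern \<gamma>) t (x::'a)"
      "(kernel_W \<alpha> \<beta> \<mu> \<nu> t :: 'a \<Rightarrow> complex) \<in> borel_measurable borel" if "t > 0" for t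
      unfolding kernel_W_eq scaled_kernel_def using inverse_fourier_eq[OF inv[OF that]] by auto
    show "integrable lborel (\<lambda>x::'a. cmod (kern \<gamma> x) powr (1 / (1 - \<theta>)))" if "\<theta> < 1"
      using integrable_kern_powr[OF \<theta>(1) that \<theta>(2) \<gamma> \<gamma>'] .
    show "\<exists>M. AE x in lborel. cmod (kern \<gamma> (x::'a)) \<le> M" if "\<theta> = 1"
    proof -
      have "\<beta> > ?d" using \<theta>(2) that by (simp add: field_simps)
      thus ?thesis using kern_bounded[OF _ \<gamma> \<gamma>'] by blast
    qed
  qed
qed

section \<open>Hoelder, Minkowski and Young inequalities\<close>

lemma borel_measurable_epow [measurable]:
  assumes [measurable]: "f \<in> borel_measurable M"
  shows "(\<lambda>x. epow (f x) a) \<in> borel_measurable M"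
  unfolding epow_def by measurable

lemma epow_ennreal: "0 \<le> x \<Longrightarrow> epow (ennreal x) a = ennreal (x powr a)"
  by (simp add: epow_def)

lemma epow_top [simp]: "epow \<infinity> a = \<infinity>" "epow top a = \<infinity>"
  by (simp_all add: epow_def)

lemma epow_0 [simp]: "epow 0 a = 0"
  by (simp add: epow_def)

lemma epow_1 [simp]: "epow x 1 = x"
  by (cases x) (simp_all add: epow_def)

lemma epow_mono: "0 \<le> a \<Longrightarrow> x \<le> y \<Longrightarrow> epow x a \<le> epow y a"
  by (cases x; cases y) (auto simp: epow_ennreal powr_mono2 top_unique)

lemma epow_eq_0_iff [simp]: "epow x a = 0 \<longleftrightarrow> x = 0"
  by (cases x) (auto simp: epow_ennreal)

lemma epow_less_top_iff [simp]: "epow x a < top \<longleftrightarrow> x < top"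
  by (cases x) (auto simp: epow_ennreal)

lemma epow_mult: "epow (x * y) a = epow x a * epow y a"
proof (cases "x = 0 \<or> y = 0")
  case False
  then show ?thesis
    by (cases x; cases y) (auto simp: epow_ennreal powr_mult ennreal_mult[symmetric] ennreal_mult_top
        ennreal_top_mult ennreal_mult_eq_top_iff)
qed auto

lemma epow_add: "x \<noteq> \<infinity> \<or> 0 \<le> a \<and> 0 \<le> b \<Longrightarrow> epow x (a + b) = epow x a * epow x b"
  by (cases x) (auto simp: epow_ennreal powr_add ennreal_mult[symmetric])

lemma epow_epow: "epow (epow x a) b = epow x (a * b)"
  by (cases x) (simp_all add: epow_ennreal powr_powr)

text \<open>With this variant, Hoelder's inequality also holds when some of the exponents vanish.\<close>

definition hpow :: "ennreal \<Rightarrow> real \<Rightarrow> ennreal" where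
  "hpow x a = (if a = 0 then 1 else epow x a)"

lemma hpow_0 [simp]: "hpow x 0 = 1"
  by (simp add: hpow_def)

lemma hpow_1 [simp]: "hpow x 1 = x"
  by (simp add: hpow_def)

lemma borel_measurable_hpow [measurable]:
  assumes [measurable]: "f \<in> borel_measurable M"
  shows "(\<lambda>x. hpow (f x) a) \<in> borel_measurable M"
  unfolding hpow_def by measurable

lemma hpow_mono: "0 \<le> a \<Longrightarrow> x \<le> y \<Longrightarrow> hpow x a \<le> hpow y a"
  by (auto simp: hpow_def epow_mono)

text \<open>Both functions are divided by their integrals, the weighted inequality between geometric
  and arithmetic mean is integrated, and \<open>K\<close> undoes the normalisation. Integrals equal
  to 0 or infinity are settled beforehand.\<close>

lemma nn_integral_Hoelder:
  assumes [measurable]: "f \<in> borel_measurable M" "g \<in> borel_measurable M" and "0 \<le> a" "0 \<le> b" "a + b = 1"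
  shows "(\<integral>\<^sup>+x. hpow (f x) a * hpow (g x) b \<partial>M) \<le> hpow (\<integral>\<^sup>+x. f x \<partial>M) a * hpow (\<integral>\<^sup>+x. g x \<partial>M) b"
proof -
  consider "a = 0" | "b = 0" | "a > 0" "b > 0" using assms by linarith
  then show ?thesis
  proof cases
    case 3
    define A B where "A = (\<integral>\<^sup>+x. f x \<partial>M)" and "B = (\<integral>\<^sup>+x. g x \<partial>M)"
    show ?thesis
    proof (cases "A = 0 \<or> B = 0 \<or> A = top \<or> B = top")
      case True
      then consider "A = 0" | "B = 0" | "A = top" "B \<noteq> 0" | "B = top" "A \<noteq> 0" by blast
      thus ?thesis
      proof cases
        case 1
        hence "AE x in M. f x = 0" by (simp add: A_def nn_integral_0_iff_AE)
        hence "AE x in M. hpow (f x) a * hpow (g x) b = 0" by eventually_elim (use 3 in \<open>simp add: hpow_def\<close>)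
        hence "(\<integral>\<^sup>+x. hpow (f x) a * hpow (g x) b \<partial>M) = 0" by (subst nn_integral_0_iff_AE) auto
        thus ?thesis by simp
      next
        case 2
        hence "AE x in M. g x = 0" by (simp add: B_def nn_integral_0_iff_AE)
        hence "AE x in M. hpow (f x) a * hpow (g x) b = 0" by eventually_elim (use 3 in \<open>simp add: hpow_def\<close>)
        hence "(\<integral>\<^sup>+x. hpow (f x) a * hpow (g x) b \<partial>M) = 0" by (subst nn_integral_0_iff_AE) auto
        thus ?thesis by simp
      qed (use \<open>a > 0\<close> \<open>b > 0\<close> in \<open>auto simp: A_def B_def hpow_def ennreal_top_mult ennreal_mult_top\<close>)
    next
      case False
      then obtain A' B' where AB: "A = ennreal A'" "B = ennreal B'" "A' > 0" "B' > 0"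
        by (cases A; cases B) auto
      define K where "K = A' powr a * B' powr b"
      have K: "K > 0" using AB by (simp add: K_def)
      have pt: "hpow u a * hpow v b \<le> ennreal (K * a / A') * u + ennreal (K * b / B') * v" for u v
      proof (cases "u = top \<or> v = top")
        case True
        thus ?thesis using 3 AB K by (auto simp: ennreal_mult_top)
      next
        case False
        then obtain u' v' where uv: "u = ennreal u'" "v = ennreal v'" "u' \<ge> 0" "v' \<ge> 0"
          by (cases u; cases v) auto
        have "(u' / A') powr a * (v' / B') powr b \<le> a * (u' / A') + b * (v' / B')"
        proof (cases "u' = 0 \<or> v' = 0")
          case True
          thus ?thesis using uv AB 3 by (auto intro!: add_nonneg_nonneg mult_nonneg_nonneg divide_nonneg_pos)
        next
          case False
          thus ?thesis using uv AB 3 assms by (intro Youngs_inequality_0) auto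
        qed
        hence "K * ((u' / A') powr a * (v' / B') powr b) \<le> K * (a * (u' / A') + b * (v' / B'))"
          using K by (intro mult_left_mono) auto
        moreover have "K * ((u' / A') powr a * (v' / B') powr b) = u' powr a * v' powr b"
          using uv AB by (simp add: K_def powr_divide)
        ultimately have "u' powr a * v' powr b \<le> K * a / A' * u' + K * b / B' * v'"
          by (simp add: algebra_simps)
        thus ?thesis using 3 uv AB K
          by (simp add: hpow_def epow_ennreal ennreal_mult[symmetric] ennreal_plus[symmetric] ennreal_leI
              del: ennreal_plus)
      qed
      have "(\<integral>\<^sup>+x. hpow (f x) a * hpow (g x) b \<partial>M) \<le>
          (\<integral>\<^sup>+x. ennreal (K * a / A') * f x + ennreal (K * b / B') * g x \<partial>M)"
        by (intro nn_integral_mono pt)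
      also have "\<dots> = ennreal (K * a / A') * A + ennreal (K * b / B') * B"
        by (subst nn_integral_add) (auto simp: nn_integral_cmult A_def B_def)
      also have "\<dots> = ennreal (K * a / A' * A' + K * b / B' * B')"
        using AB K 3 by (simp add: ennreal_mult[symmetric] ennreal_plus[symmetric] del: ennreal_plus)
      also have "K * a / A' * A' + K * b / B' * B' = K * (a + b)" using AB by (simp add: distrib_left)
      also have "K * (a + b) = K" using assms by simp
      also have "ennreal K = hpow A a * hpow B b"
        using 3 AB by (simp add: hpow_def K_def epow_ennreal ennreal_mult)
      finally show ?thesis by (simp add: A_def B_def)
    qed
  qed (use assms in auto)
qed

lemma hpow_mult: "hpow (x * y) a = hpow x a * hpow y a"
  by (simp add: hpow_def epow_mult)

lemma hpow_hpow: "0 \<le> a \<Longrightarrow> 0 \<le> b \<Longrightarrow> hpow (hpow x a) b = hpow x (a * b)"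
  by (auto simp: hpow_def epow_epow epow_ennreal[of 1, simplified])

lemma nn_integral_Hoelder3:
  assumes [measurable]: "f \<in> borel_measurable M" "g \<in> borel_measurable M" "h \<in> borel_measurable M"
    and "0 \<le> a" "0 \<le> b" "0 \<le> c" "a + b + c = 1"
  shows "(\<integral>\<^sup>+x. hpow (f x) a * (hpow (g x) b * hpow (h x) c) \<partial>M) \<le>
    hpow (\<integral>\<^sup>+x. f x \<partial>M) a * (hpow (\<integral>\<^sup>+x. g x \<partial>M) b * hpow (\<integral>\<^sup>+x. h x \<partial>M) c)"
proof (cases "b + c = 0")
  case True
  hence "b = 0" "c = 0" "a = 1" using assms by auto
  thus ?thesis by simp
next
  case False
  \<comment> \<open>Hoelder is applied twice: first with the exponents a and e, then inside with b /
    e and c / e, which again sum to 1.\<close>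
  define e where "e = b + c"
  have e: "e > 0" using False assms by (simp add: e_def)
  have eq: "hpow u b * hpow v c = hpow (hpow u (b / e) * hpow v (c / e)) e" for u v
    using assms e by (simp add: hpow_mult hpow_hpow)
  have "(\<integral>\<^sup>+x. hpow (f x) a * (hpow (g x) b * hpow (h x) c) \<partial>M) =
      (\<integral>\<^sup>+x. hpow (f x) a * hpow (hpow (g x) (b / e) * hpow (h x) (c / e)) e \<partial>M)"
    by (simp add: eq)
  also have "\<dots> \<le> hpow (\<integral>\<^sup>+x. f x \<partial>M) a * hpow (\<integral>\<^sup>+x. hpow (g x) (b / e) * hpow (h x) (c / e) \<partial>M) e"
    by (intro nn_integral_Hoelder) (use assms in \<open>auto simp: e_def\<close>)
  also have "\<dots> \<le> hpow (\<integral>\<^sup>+x. f x \<partial>M) a * hpow (hpow (\<integral>\<^sup>+x. g x \<partial>M) (b / e) * hpow (\<integral>\<^sup>+x. h x \<partial>M) (c / e)) e"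
    using assms e
    by (intro mult_left_mono hpow_mono nn_integral_Hoelder) (auto simp: e_def add_divide_distrib[symmetric])
  also have "\<dots> = hpow (\<integral>\<^sup>+x. f x \<partial>M) a * (hpow (\<integral>\<^sup>+x. g x \<partial>M) b * hpow (\<integral>\<^sup>+x. h x \<partial>M) c)"
    by (simp add: eq)
  finally show ?thesis .
qed

text \<open>With a(s) the norm of the slice, Hoelder in s with the weight a(s)^(1 - q) bounds H^q by
  A^(q - 1) times the integral of h^q a^(1 - q), and Tonelli turns the x-integral of the latter into
  at most A. The norm of \<open>H\<close> is never divided by, so it may be infinite a
  priori.\<close>

lemma nn_integral_Minkowski:
  assumes "sigma_finite_measure M" "sigma_finite_measure N" and "1 < q"
    and [measurable]: "(\<lambda>(s, x). h s x) \<in> borel_measurable (M \<Otimes>\<^sub>M N)"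
  shows "epow (\<integral>\<^sup>+x. epow (\<integral>\<^sup>+s. h s x \<partial>M) q \<partial>N) (1 / q) \<le> (\<integral>\<^sup>+s. epow (\<integral>\<^sup>+x. epow (h s x) q \<partial>N) (1 / q) \<partial>M)"
proof -
  interpret M: sigma_finite_measure M by fact
  interpret N: sigma_finite_measure N by fact
  interpret pair_sigma_finite M N ..
  define a where "a = (\<lambda>s. epow (\<integral>\<^sup>+x. epow (h s x) q \<partial>N) (1 / q))"
  define A where "A = (\<integral>\<^sup>+s. a s \<partial>M)"
  define H where "H = (\<lambda>x. \<integral>\<^sup>+s. h s x \<partial>M)"
  have [measurable]: "a \<in> borel_measurable M" unfolding a_def by measurable
  have [measurable]: "H \<in> borel_measurable N" unfolding H_def by measurable
  show ?thesis
  proof (cases "A = top")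
    case True
    thus ?thesis by (simp add: A_def a_def)
  next
    case False
    hence fin: "AE s in M. a s \<noteq> top" using nn_integral_PInf_AE[of a M] by (simp add: A_def)
    have aq: "epow (a s) q = (\<integral>\<^sup>+x. epow (h s x) q \<partial>N)" for s
      using \<open>1 < q\<close> by (simp add: a_def epow_epow)
    define w where "w = (\<lambda>s. epow (a s) (1 - q))"
    have [measurable]: "w \<in> borel_measurable M" unfolding w_def by measurable
    \<comment> \<open>Where a(s) = 0 the weight is 0 by convention, and the inequality holds because
      the slice vanishes for almost every x. That null set depends on s, so the two quantifiers are
      exchanged afterwards.\<close>
    have "AE s in M. AE x in N. h s x \<le> hpow (epow (h s x) q * w s) (1 / q) * hpow (a s) (1 - 1 / q)"
      using fin AE_space
    proof eventually_elim
      case (elim s)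
      hence [measurable]: "s \<in> space M" by simp
      show ?case
      proof (cases "a s = 0")
        case True
        hence "(\<integral>\<^sup>+x. epow (h s x) q \<partial>N) = 0" using aq[of s] by simp
        hence "AE x in N. epow (h s x) q = 0" by (subst (asm) nn_integral_0_iff_AE) auto
        thus ?thesis by eventually_elim auto
      next
        case False
        then obtain a' where a': "a s = ennreal a'" "a' > 0" using elim by (cases "a s") auto
        have "hpow (epow (h s x) q * w s) (1 / q) * hpow (a s) (1 - 1 / q) =
            epow (epow (h s x) q) (1 / q) * (epow (epow (a s) (1 - q)) (1 / q) * epow (a s) (1 - 1 / q))" for x
          using \<open>1 < q\<close> by (simp add: hpow_def epow_mult w_def mult.assoc)
        also have "\<dots> x = h s x * epow (a s) ((1 - q) * (1 / q) + (1 - 1 / q))" for x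
          using \<open>1 < q\<close> a' by (subst epow_add) (auto simp: epow_epow)
        also have "\<dots> x = h s x" for x
        proof -
          have "(1 - q) * (1 / q) + (1 - 1 / q) = 0" using \<open>1 < q\<close> by (simp add: field_simps)
          thus ?thesis using a' by (simp add: epow_ennreal)
        qed
        finally show ?thesis by simp
      qed
    qed
    hence "AE x in N. AE s in M. h s x \<le> hpow (epow (h s x) q * w s) (1 / q) * hpow (a s) (1 - 1 / q)"
      by (subst (asm) AE_commute) auto
    hence "AE x in N. epow (H x) q \<le> (\<integral>\<^sup>+s. epow (h s x) q * w s \<partial>M) * epow A (q - 1)"
    proof (rule AE_mp, intro AE_I2 impI)
      fix x assume x[measurable]: "x \<in> space N"
        and "AE s in M. h s x \<le> hpow (epow (h s x) q * w s) (1 / q) * hpow (a s) (1 - 1 / q)"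
      hence "H x \<le> (\<integral>\<^sup>+s. hpow (epow (h s x) q * w s) (1 / q) * hpow (a s) (1 - 1 / q) \<partial>M)"
        unfolding H_def by (intro nn_integral_mono_AE)
      also have "\<dots> \<le> hpow (\<integral>\<^sup>+s. epow (h s x) q * w s \<partial>M) (1 / q) * hpow A (1 - 1 / q)"
        unfolding A_def using \<open>1 < q\<close> by (intro nn_integral_Hoelder) auto
      finally have "epow (H x) q \<le> epow (hpow (\<integral>\<^sup>+s. epow (h s x) q * w s \<partial>M) (1 / q) * hpow A (1 - 1 / q)) q"
        using \<open>1 < q\<close> by (intro epow_mono) auto
      also have "\<dots> = (\<integral>\<^sup>+s. epow (h s x) q * w s \<partial>M) * epow A (q - 1)"
        using \<open>1 < q\<close> by (simp add: hpow_def epow_mult epow_epow left_diff_distrib)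
      finally show "epow (H x) q \<le> (\<integral>\<^sup>+s. epow (h s x) q * w s \<partial>M) * epow A (q - 1)" .
    qed
    hence 1: "(\<integral>\<^sup>+x. epow (H x) q \<partial>N) \<le> (\<integral>\<^sup>+x. (\<integral>\<^sup>+s. epow (h s x) q * w s \<partial>M) * epow A (q - 1) \<partial>N)"
      by (rule nn_integral_mono_AE)
    have "(\<integral>\<^sup>+x. (\<integral>\<^sup>+s. epow (h s x) q * w s \<partial>M) \<partial>N) = (\<integral>\<^sup>+s. (\<integral>\<^sup>+x. epow (h s x) q * w s \<partial>N) \<partial>M)"
      by (rule Fubini') measurable
    also have "\<dots> = (\<integral>\<^sup>+s. epow (a s) q * w s \<partial>M)"
      by (intro nn_integral_cong) (simp add: nn_integral_multc aq)
    also have "\<dots> \<le> A" unfolding A_def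
    proof (rule nn_integral_mono_AE)
      show "AE s in M. epow (a s) q * w s \<le> a s" using fin
        by eventually_elim (simp add: w_def epow_add[symmetric])
    qed
    finally have "(\<integral>\<^sup>+x. (\<integral>\<^sup>+s. epow (h s x) q * w s \<partial>M) \<partial>N) * epow A (q - 1) \<le> epow A 1 * epow A (q - 1)"
      by (intro mult_right_mono) auto
    also have "epow A 1 * epow A (q - 1) = epow A q" using \<open>1 < q\<close> by (subst epow_add[symmetric]) auto
    finally have "(\<integral>\<^sup>+x. epow (H x) q \<partial>N) \<le> epow A q"
      using 1 by (subst (asm) nn_integral_multc) auto
    hence "epow (\<integral>\<^sup>+x. epow (H x) q \<partial>N) (1 / q) \<le> epow (epow A q) (1 / q)"
      using \<open>1 < q\<close> by (intro epow_mono) auto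
    also have "\<dots> = A" using \<open>1 < q\<close> by (simp add: epow_epow)
    finally show ?thesis by (simp add: H_def A_def a_def)
  qed
qed

section \<open>Young's convolution inequality\<close>

lemma recip_ennreal: "x > 0 \<Longrightarrow> recip (ennreal x) = 1 / x"
  using divide_ennreal[of 1 x] by (simp add: recip_def)

lemma recip_top: "recip top = 0"
  by (simp add: recip_def)

lemma hpow_add: "0 \<le> a \<Longrightarrow> 0 \<le> b \<Longrightarrow> hpow x (a + b) = hpow x a * hpow x b"
  by (cases "a = 0"; cases "b = 0") (simp_all add: hpow_def epow_add add_nonneg_eq_0_iff)

lemma nn_integral_lborel_reflect:
  fixes f :: "'a::euclidean_space \<Rightarrow> ennreal"
  assumes "f \<in> borel_measurable borel"
  shows "(\<integral>\<^sup>+y. f (x - y) \<partial>lborel) = (\<integral>\<^sup>+y. f y \<partial>lborel)"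
  using nn_integral_lborel_affine[of "-1" f x] assms by simp

text \<open>The exponents iq, 1 - 1 / P and 1 / P - iq sum to 1, and the relation for 1 / S makes
  the total powers of u and v equal to 1. Here iq plays the part of 1 / Q, with 0 for Q
  infinite.\<close>

lemma hpow_Young_split:
  fixes u v :: real
  assumes "0 \<le> u" "0 \<le> v" and iq: "0 \<le> iq" and P: "P \<ge> 1" and S: "S > 0" and rel: "1 / S = 1 - 1 / P + iq" and c: "iq < 1 / P"
  shows "ennreal u * ennreal v \<le> hpow (epow (ennreal u) S * epow (ennreal v) P) iq *
    (hpow (epow (ennreal u) S) (1 - 1 / P) * hpow (epow (ennreal v) P) (1 / P - iq))"
proof (cases "u = 0 \<or> v = 0")
  case True
  thus ?thesis by auto
next
  case False
  hence uv: "u > 0" "v > 0" using assms by auto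
  have h: "hpow (epow (ennreal z) T) a = ennreal (z powr (T * a))" if "z > 0" for z T a
    using that by (simp add: hpow_def epow_ennreal powr_powr)
  have "hpow (epow (ennreal u) S * epow (ennreal v) P) iq * (hpow (epow (ennreal u) S) (1 - 1 / P) * hpow (epow (ennreal v) P) (1 / P - iq))
     = ennreal (u powr (S * iq) * v powr (P * iq) * (u powr (S * (1 - 1 / P)) * v powr (P * (1 / P - iq))))"
    using uv by (simp add: hpow_mult h ennreal_mult)
  also have "u powr (S * iq) * v powr (P * iq) * (u powr (S * (1 - 1 / P)) * v powr (P * (1 / P - iq))) =
      u powr (S * (1 / S)) * v powr (P * iq + P * (1 / P - iq))"
    unfolding rel by (simp add: powr_add[symmetric] algebra_simps)
  also have "\<dots> = u * v" using uv S P by (simp add: algebra_simps)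
  finally show ?thesis using uv by (simp add: ennreal_mult)
qed

text \<open>Of the three Hoelder factors only the first still depends on x. For finite Q it is
  integrated by Tonelli afterwards; for iq = 0 it is 1, and a bound uniform in x remains.\<close>

lemma Young_pointwise:
  fixes k f :: "'a::euclidean_space \<Rightarrow> real"
  assumes [measurable]: "k \<in> borel_measurable borel" "f \<in> borel_measurable borel"
    and "\<And>x. 0 \<le> k x" "\<And>x. 0 \<le> f x"
    and iq: "0 \<le> iq" and P: "P \<ge> 1" and S: "S > 0" and rel: "1 / S = 1 - 1 / P + iq" and c: "iq < 1 / P"
  shows "(\<integral>\<^sup>+y. ennreal (k (x - y)) * ennreal (f y) \<partial>lborel) \<le>
    hpow (\<integral>\<^sup>+y. epow (ennreal (k (x - y))) S * epow (ennreal (f y)) P \<partial>lborel) iq *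
    (hpow (\<integral>\<^sup>+y. epow (ennreal (k y)) S \<partial>lborel) (1 - 1 / P) * hpow (\<integral>\<^sup>+y. epow (ennreal (f y)) P \<partial>lborel) (1 / P - iq))"
proof -
  have "(\<integral>\<^sup>+y. ennreal (k (x - y)) * ennreal (f y) \<partial>lborel) \<le>
      (\<integral>\<^sup>+y. hpow (epow (ennreal (k (x - y))) S * epow (ennreal (f y)) P) iq *
        (hpow (epow (ennreal (k (x - y))) S) (1 - 1 / P) * hpow (epow (ennreal (f y)) P) (1 / P - iq)) \<partial>lborel)"
    by (intro nn_integral_mono hpow_Young_split assms)
  also have "\<dots> \<le> hpow (\<integral>\<^sup>+y. epow (ennreal (k (x - y))) S * epow (ennreal (f y)) P \<partial>lborel) iq *
    (hpow (\<integral>\<^sup>+y. epow (ennreal (k (x - y))) S \<partial>lborel) (1 - 1 / P) * hpow (\<integral>\<^sup>+y. epow (ennreal (f y)) P \<partial>lborel) (1 / P - iq))"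
    using iq P c by (intro nn_integral_Hoelder3) auto
  also have "(\<integral>\<^sup>+y. epow (ennreal (k (x - y))) S \<partial>lborel) = (\<integral>\<^sup>+y. epow (ennreal (k y)) S \<partial>lborel)"
    by (rule nn_integral_lborel_reflect) measurable
  finally show ?thesis .
qed

lemma Young_convolution:
  fixes k f :: "'a::euclidean_space \<Rightarrow> real"
  assumes [measurable]: "k \<in> borel_measurable borel" "f \<in> borel_measurable borel"
    and nn: "\<And>x. 0 \<le> k x" "\<And>x. 0 \<le> f x"
    and PQ: "1 \<le> P" "P < Q" and S: "S > 0" and rel: "1 / S = 1 - 1 / P + 1 / Q"
  shows "epow (\<integral>\<^sup>+x. epow (\<integral>\<^sup>+y. ennreal (k (x - y)) * ennreal (f y) \<partial>lborel) Q \<partial>lborel) (1 / Q) \<le>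
    epow (\<integral>\<^sup>+y. epow (ennreal (k y)) S \<partial>lborel) (1 / S) * epow (\<integral>\<^sup>+y. epow (ennreal (f y)) P \<partial>lborel) (1 / P)"
proof -
  define A B where "A = (\<integral>\<^sup>+y. epow (ennreal (k y)) S \<partial>lborel)" and "B = (\<integral>\<^sup>+y. epow (ennreal (f y)) P \<partial>lborel)"
  let ?J = "\<lambda>x. \<integral>\<^sup>+y. epow (ennreal (k (x - y))) S * epow (ennreal (f y)) P \<partial>lborel"
  define E where "E = hpow A (1 - 1 / P) * hpow B (1 / P - 1 / Q)"
  have Q: "Q > 1" "1 / Q < 1 / P" using PQ by (auto simp: field_simps)
  have "(\<integral>\<^sup>+x. epow (\<integral>\<^sup>+y. ennreal (k (x - y)) * ennreal (f y) \<partial>lborel) Q \<partial>lborel) \<le> (\<integral>\<^sup>+x. ?J x * epow E Q \<partial>lborel)"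
  proof (intro nn_integral_mono)
    fix x :: 'a
    have "epow (\<integral>\<^sup>+y. ennreal (k (x - y)) * ennreal (f y) \<partial>lborel) Q \<le> epow (hpow (?J x) (1 / Q) * E) Q"
      unfolding E_def A_def B_def using Q PQ nn S rel by (intro epow_mono Young_pointwise) auto
    also have "\<dots> = ?J x * epow E Q" using Q by (simp add: hpow_def epow_mult epow_epow)
    finally show "epow (\<integral>\<^sup>+y. ennreal (k (x - y)) * ennreal (f y) \<partial>lborel) Q \<le> ?J x * epow E Q" .
  qed
  also have "\<dots> = (\<integral>\<^sup>+x. ?J x \<partial>lborel) * epow E Q"
    by (rule nn_integral_multc) measurable
  also have "(\<integral>\<^sup>+x. ?J x \<partial>lborel) = (\<integral>\<^sup>+y. (\<integral>\<^sup>+x. epow (ennreal (k (x - y))) S * epow (ennreal (f y)) P \<partial>lborel) \<partial>lborel)"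
    by (rule lborel_pair.Fubini') measurable
  also have "\<dots> = (\<integral>\<^sup>+y. A * epow (ennreal (f y)) P \<partial>lborel)"
  proof (intro nn_integral_cong)
    fix y :: 'a
    have "(\<integral>\<^sup>+x. epow (ennreal (k (x - y))) S \<partial>lborel) = A"
      unfolding A_def using nn_integral_lborel_affine[of 1 "\<lambda>x. epow (ennreal (k x)) S" "- y"] by simp
    thus "(\<integral>\<^sup>+x. epow (ennreal (k (x - y))) S * epow (ennreal (f y)) P \<partial>lborel) = A * epow (ennreal (f y)) P"
      by (subst nn_integral_multc) auto
  qed
  also have "\<dots> = A * B" unfolding B_def by (rule nn_integral_cmult) measurable
  finally have "epow (\<integral>\<^sup>+x. epow (\<integral>\<^sup>+y. ennreal (k (x - y)) * ennreal (f y) \<partial>lborel) Q \<partial>lborel) (1 / Q) \<le>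
      epow (A * B * epow E Q) (1 / Q)"
    using Q by (intro epow_mono) auto
  also have "\<dots> = hpow A (1 / Q) * hpow B (1 / Q) * E"
    using Q by (simp add: epow_mult epow_epow hpow_def)
  also have "\<dots> = (hpow A (1 / Q) * hpow A (1 - 1 / P)) * (hpow B (1 / Q) * hpow B (1 / P - 1 / Q))"
    by (simp add: E_def mult_ac)
  also have "\<dots> = hpow A (1 / Q + (1 - 1 / P)) * hpow B (1 / Q + (1 / P - 1 / Q))"
    using Q PQ by (subst (1 2) hpow_add) auto
  also have "\<dots> = hpow A (1 / S) * hpow B (1 / P)" by (simp add: rel add.commute)
  also have "\<dots> = epow A (1 / S) * epow B (1 / P)" using S PQ by (simp add: hpow_def)
  finally show ?thesis by (simp add: A_def B_def)
qed

lemma Hoelder_convolution: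
  fixes k f :: "'a::euclidean_space \<Rightarrow> real"
  assumes "k \<in> borel_measurable borel" "f \<in> borel_measurable borel"
    and nn: "\<And>x. 0 \<le> k x" "\<And>x. 0 \<le> f x"
    and P: "1 \<le> P" and S: "S > 0" and rel: "1 / S = 1 - 1 / P"
  shows "(\<integral>\<^sup>+y. ennreal (k (x - y)) * ennreal (f y) \<partial>lborel) \<le>
    epow (\<integral>\<^sup>+y. epow (ennreal (k y)) S \<partial>lborel) (1 / S) * epow (\<integral>\<^sup>+y. epow (ennreal (f y)) P \<partial>lborel) (1 / P)"
proof -
  have "1 - 1 / P \<noteq> 0" using S rel[symmetric] by simp
  thus ?thesis using Young_pointwise[OF assms(1-4), of 0 P S x] P S rel by (simp add: hpow_def)
qed

text \<open>A function that is not integrable has Bochner integral 0, so the bound holds for every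
  f. The convolution and the time integral of the solution are thus estimated for arbitrary
  measurable F.\<close>

lemma ennreal_norm_integral_le:
  fixes f :: "'b \<Rightarrow> complex"
  shows "ennreal (norm (\<integral>x. f x \<partial>M)) \<le> (\<integral>\<^sup>+x. ennreal (norm (f x)) \<partial>M)"
proof (cases "integrable M f")
  case True
  thus ?thesis by (rule integral_norm_bound_ennreal)
next
  case False
  thus ?thesis by (simp add: not_integrable_integral_eq)
qed

section \<open>Time integrals with a power weight\<close>

lemma nn_integral_powr_interval:
  assumes a: "a > -1" and t: "t > 0"
  shows "(\<integral>\<^sup>+s. indicator {0..t} s * ennreal ((t - s) powr a) \<partial>lborel) = ennreal (t powr (a + 1) / (a + 1))"
proof -
  have "(\<integral>\<^sup>+s. indicator {0..t} s * ennreal ((t - s) powr a) \<partial>lborel) =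
      (\<integral>\<^sup>+s. (\<lambda>u. indicator {0..t} u * ennreal (u powr a)) (t - s) \<partial>lborel)"
    by (intro nn_integral_cong) (auto simp: indicator_def)
  also have "\<dots> = (\<integral>\<^sup>+u. indicator {0..t} u * ennreal (u powr a) \<partial>lborel)"
    by (rule nn_integral_lborel_reflect) measurable
  also have "\<dots> = (\<integral>\<^sup>+u. ennreal (indicator {0..t} u * u powr a) \<partial>lborel)"
    by (intro nn_integral_cong) (auto simp: indicator_def)
  also have "\<dots> = ennreal (t powr (a + 1) / (a + 1))"
    using has_integral_powr_from_0[of a t] a t by (intro nn_integral_has_integral_lebesgue) auto
  finally show ?thesis .
qed

lemma Lp_norm_half_line:
  fixes g :: "real \<Rightarrow> ennreal"
  assumes "R > 0"
  shows "Lp_norm (ennreal R) (restrict_space lborel {0..}) g = epow (\<integral>\<^sup>+s. epow (g s) R * indicator {0..} s \<partial>lborel) (1 / R)"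
  using assms by (simp add: Lp_norm_def recip_ennreal nn_integral_restrict_space)

text \<open>The condition on \<open>e\<close> makes the Riemann-Liouville kernel \<open>s powr e\<close> locally
  integrable to the power dual to \<open>r\<close>.\<close>

lemma time_Hoelder:
  fixes e :: real and r :: ennreal
  assumes r: "1 \<le> r" and e: "recip r < e + 1"
  shows "\<exists>C>0. \<forall>t>0. \<forall>g\<in>borel_measurable borel.
      (\<integral>\<^sup>+s. indicator {0..t} s * ennreal ((t - s) powr e) * g s \<partial>lborel) \<le>
      ennreal (C * t powr (e + 1 - recip r)) * Lp_norm r (restrict_space lborel {0..}) g"
proof -
  \<comment> \<open>The endpoints are direct: for r infinite the weight is integrated, and for r = 1
    the condition forces e > 0, so the weight is largest at s = 0.\<close>
  consider "r = top" | "r = 1" | R where "r = ennreal R" "R > 1"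
    using r by (cases r) (auto simp: ennreal_eq_1 one_ennreal.rep_eq le_less)
  thus ?thesis
  proof cases
    case 1
    hence e1: "e > -1" using e by (simp add: recip_top)
    show ?thesis
    proof (intro exI[of _ "1 / (e + 1)"] conjI allI ballI impI)
      fix t :: real and g :: "real \<Rightarrow> ennreal"
      assume t: "t > 0" and [measurable]: "g \<in> borel_measurable borel"
      define M where "M = Lp_norm r (restrict_space lborel {0..}) g"
      have "AE s in restrict_space lborel {0..}. g s \<le> M"
        unfolding M_def Lp_norm_def using 1 esssup_AE[of g "restrict_space lborel {0..}"] by simp
      hence "AE s in lborel. 0 \<le> s \<longrightarrow> g s \<le> M"
        by (subst (asm) AE_restrict_space_iff) auto
      hence "(\<integral>\<^sup>+s. indicator {0..t} s * ennreal ((t - s) powr e) * g s \<partial>lborel) \<le>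
          (\<integral>\<^sup>+s. indicator {0..t} s * ennreal ((t - s) powr e) * M \<partial>lborel)"
        by (intro nn_integral_mono_AE) (auto elim!: eventually_mono simp: indicator_def intro: mult_left_mono)
      also have "\<dots> = ennreal (t powr (e + 1) / (e + 1)) * M"
        using nn_integral_powr_interval[OF e1 t] by (subst nn_integral_multc) auto
      finally show "(\<integral>\<^sup>+s. indicator {0..t} s * ennreal ((t - s) powr e) * g s \<partial>lborel) \<le>
          ennreal (1 / (e + 1) * t powr (e + 1 - recip r)) * M"
        using 1 by (simp add: recip_top)
    qed (use e1 in auto)
  next
    case 2
    have r1: "recip r = 1" using 2 recip_ennreal[of 1] by simp
    hence e0: "e > 0" using e by simp
    show ?thesis
    proof (intro exI[of _ 1] conjI allI ballI impI)
      fix t :: real and g :: "real \<Rightarrow> ennreal"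
      assume t: "t > 0" and [measurable]: "g \<in> borel_measurable borel"
      have "(\<integral>\<^sup>+s. indicator {0..t} s * ennreal ((t - s) powr e) * g s \<partial>lborel) \<le>
          (\<integral>\<^sup>+s. ennreal (t powr e) * (epow (g s) 1 * indicator {0..} s) \<partial>lborel)"
      proof (intro nn_integral_mono)
        fix s
        show "indicator {0..t} s * ennreal ((t - s) powr e) * g s \<le> ennreal (t powr e) * (epow (g s) 1 * indicator {0..} s)"
          using e0 by (auto simp: indicator_def intro!: mult_right_mono ennreal_leI powr_mono2)
      qed
      also have "\<dots> = ennreal (t powr e) * (\<integral>\<^sup>+s. epow (g s) 1 * indicator {0..} s \<partial>lborel)"
        by (rule nn_integral_cmult) measurable
      also have "(\<integral>\<^sup>+s. epow (g s) 1 * indicator {0..} s \<partial>lborel) = Lp_norm r (restrict_space lborel {0..}) g"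
        using Lp_norm_half_line[of 1 g] 2 by simp
      finally show "(\<integral>\<^sup>+s. indicator {0..t} s * ennreal ((t - s) powr e) * g s \<partial>lborel) \<le>
          ennreal (1 * t powr (e + 1 - recip r)) * Lp_norm r (restrict_space lborel {0..}) g"
        using r1 by simp
    qed simp
  next
    case (3 R)
    have r1: "recip r = 1 / R" using 3 by (simp add: recip_ennreal)
    \<comment> \<open>\<open>R'\<close> is dual to R, and e R' > -1 is the condition on e multiplied
      by \<open>R'\<close>. \<open>C\<close> is the constant in the integral of (t - s)^(e R'),
      raised to the power 1 / R'.\<close>
    define R' where "R' = 1 / (1 - 1 / R)"
    have R': "R' > 0" "1 / R' = 1 - 1 / R" "R' * (1 - 1 / R) = 1" using 3 by (auto simp: R'_def)
    have eR: "e * R' > -1"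
    proof -
      have "- (1 - 1 / R) * R' < e * R'" using e r1 R' by (intro mult_strict_right_mono) auto
      also have "- (1 - 1 / R) * R' = - (R' * (1 - 1 / R))" by (simp add: algebra_simps)
      finally show ?thesis using R'(3) by simp
    qed
    define C where "C = (1 / (e * R' + 1)) powr (1 - 1 / R)"
    show ?thesis
    proof (intro exI[of _ C] conjI allI ballI impI)
      show "C > 0" using eR by (simp add: C_def)
      fix t :: real and g :: "real \<Rightarrow> ennreal"
      assume t: "t > 0" and [measurable]: "g \<in> borel_measurable borel"
      have "(\<integral>\<^sup>+s. indicator {0..t} s * ennreal ((t - s) powr e) * g s \<partial>lborel) \<le>
          (\<integral>\<^sup>+s. hpow (indicator {0..t} s * ennreal ((t - s) powr (e * R'))) (1 - 1 / R) * hpow (epow (g s) R * indicator {0..} s) (1 / R) \<partial>lborel)"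
      proof (intro nn_integral_mono)
        fix s :: real
        show "indicator {0..t} s * ennreal ((t - s) powr e) * g s \<le>
            hpow (indicator {0..t} s * ennreal ((t - s) powr (e * R'))) (1 - 1 / R) * hpow (epow (g s) R * indicator {0..} s) (1 / R)"
        proof (cases "s \<in> {0..t}")
          case True
          have "hpow (epow (g s) R) (1 / R) = g s" using 3 by (simp add: hpow_def epow_epow)
          moreover have "hpow (ennreal ((t - s) powr (e * R'))) (1 - 1 / R) = ennreal ((t - s) powr e)"
            using 3 R' by (simp add: hpow_def epow_ennreal powr_powr mult.assoc)
          ultimately show ?thesis using True by simp
        qed simp
      qed
      also have "\<dots> \<le> hpow (\<integral>\<^sup>+s. indicator {0..t} s * ennreal ((t - s) powr (e * R')) \<partial>lborel) (1 - 1 / R) *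
          hpow (\<integral>\<^sup>+s. epow (g s) R * indicator {0..} s \<partial>lborel) (1 / R)"
        using 3 by (intro nn_integral_Hoelder) auto
      also have "hpow (\<integral>\<^sup>+s. epow (g s) R * indicator {0..} s \<partial>lborel) (1 / R) = Lp_norm r (restrict_space lborel {0..}) g"
        using 3 by (simp add: Lp_norm_half_line hpow_def)
      also have "hpow (\<integral>\<^sup>+s. indicator {0..t} s * ennreal ((t - s) powr (e * R')) \<partial>lborel) (1 - 1 / R) = ennreal (C * t powr (e + 1 - recip r))"
      proof -
        have "(e * R' + 1) * (1 - 1 / R) = e * (R' * (1 - 1 / R)) + (1 - 1 / R)" by (simp add: algebra_simps)
        hence "(e * R' + 1) * (1 - 1 / R) = e + 1 - recip r" using R' r1 by simp
        hence "(t powr (e * R' + 1) / (e * R' + 1)) powr (1 - 1 / R) = C * t powr (e + 1 - recip r)"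
          using eR t by (simp add: C_def powr_divide powr_powr)
        thus ?thesis using 3 eR t
          by (subst nn_integral_powr_interval[OF eR t]) (simp add: hpow_def epow_ennreal)
      qed
      finally show "(\<integral>\<^sup>+s. indicator {0..t} s * ennreal ((t - s) powr e) * g s \<partial>lborel) \<le>
          ennreal (C * t powr (e + 1 - recip r)) * Lp_norm r (restrict_space lborel {0..}) g" .
    qed
  qed
qed


section \<open>Convolution with the scaled kernel\<close>

lemma scaled_kernel_measurable:
  assumes "K \<in> borel_measurable borel" "f \<in> borel_measurable M" "g \<in> borel_measurable M"
  shows "(\<lambda>z. scaled_kernel \<alpha> \<beta> K (f z) (g z)) \<in> borel_measurable M"
proof -
  note [measurable] = assms
  have "(\<lambda>z. f z powr (- (\<alpha> / \<beta>)) *\<^sub>R g z) \<in> borel_measurable M" by measurable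
  from measurable_compose[OF this assms(1)]
  have [measurable]: "(\<lambda>z. K (f z powr (- (\<alpha> / \<beta>)) *\<^sub>R g z)) \<in> borel_measurable M" .
  show ?thesis unfolding scaled_kernel_def by measurable
qed

text \<open>The change of variables contributes t^(\<alpha> d / \<beta>) to the power 1 / S against
  the prefactor t^(-\<alpha> d / \<beta>). With 1 / S = 1 - \<theta> the net exponent is - \<alpha>
  d \<theta> / \<beta>.\<close>

lemma scaled_kernel_Lp:
  fixes K :: "'a::euclidean_space \<Rightarrow> complex"
  assumes [measurable]: "K \<in> borel_measurable borel" and t: "t > 0" and S: "S > 0"
  shows "epow (\<integral>\<^sup>+x. epow (ennreal (cmod (scaled_kernel \<alpha> \<beta> K t x))) S \<partial>lborel) (1 / S) =
    ennreal (t powr (- (\<alpha> / \<beta> * DIM('a) * (1 - 1 / S)))) * epow (\<integral>\<^sup>+x. epow (ennreal (cmod (K x))) S \<partial>lborel) (1 / S)"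
proof -
  let ?d = "real DIM('a)" and ?c = "t powr (- (\<alpha> / \<beta>))"
  have c: "?c \<noteq> 0" using t by simp
  have "(\<integral>\<^sup>+x. epow (ennreal (cmod (scaled_kernel \<alpha> \<beta> K t x))) S \<partial>lborel) =
      (\<integral>\<^sup>+x. epow (ennreal (t powr (- (\<alpha> / \<beta> * ?d)))) S * epow (ennreal (cmod (K (?c *\<^sub>R x)))) S \<partial>lborel)"
    by (intro nn_integral_cong) (simp add: scaled_kernel_def norm_mult ennreal_mult epow_mult)
  also have "\<dots> = epow (ennreal (t powr (- (\<alpha> / \<beta> * ?d)))) S * (\<integral>\<^sup>+x. epow (ennreal (cmod (K (?c *\<^sub>R x)))) S \<partial>lborel)"
    by (rule nn_integral_cmult) measurable
  also have "(\<integral>\<^sup>+x. epow (ennreal (cmod (K (?c *\<^sub>R x)))) S \<partial>lborel) =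
      ennreal (1 / \<bar>?c\<bar> ^ DIM('a)) * (\<integral>\<^sup>+x. epow (ennreal (cmod (K x))) S \<partial>lborel)"
    using nn_integral_lborel_affine[OF c, of "\<lambda>x. epow (ennreal (cmod (K x))) S" 0] by simp
  also have "1 / \<bar>?c\<bar> ^ DIM('a) = t powr (\<alpha> / \<beta> * ?d)"
  proof -
    have "\<bar>?c\<bar> ^ DIM('a) = t powr (- (\<alpha> / \<beta> * ?d))"
      using t by (simp add: powr_realpow[symmetric] powr_powr)
    thus ?thesis by (simp only: powr_minus_divide) simp
  qed
  finally have "epow (\<integral>\<^sup>+x. epow (ennreal (cmod (scaled_kernel \<alpha> \<beta> K t x))) S \<partial>lborel) (1 / S) =
      ennreal (t powr (- (\<alpha> / \<beta> * ?d)) * t powr (\<alpha> / \<beta> * ?d * (1 / S))) * epow (\<integral>\<^sup>+x. epow (ennreal (cmod (K x))) S \<partial>lborel) (1 / S)"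
    using S by (simp add: epow_mult epow_epow epow_ennreal powr_powr ennreal_mult mult.assoc)
  also have "t powr (- (\<alpha> / \<beta> * ?d)) * t powr (\<alpha> / \<beta> * ?d * (1 / S)) = t powr (- (\<alpha> / \<beta> * ?d * (1 - 1 / S)))"
  proof -
    have "- X + X * (1 / S) = - (X * (1 - 1 / S))" for X :: real by (simp add: algebra_simps)
    thus ?thesis by (simp only: powr_add[symmetric])
  qed
  finally show ?thesis .
qed

lemma scaled_kernel_convolution_le:
  fixes K :: "'a::euclidean_space \<Rightarrow> complex" and p q :: ennreal and \<theta> :: real
  assumes [measurable]: "K \<in> borel_measurable borel"
    and pq: "1 \<le> p" "p < q" and \<theta>: "\<theta> = recip p - recip q"
    and K1: "\<theta> < 1 \<longrightarrow> integrable lborel (\<lambda>x. cmod (K x) powr (1 / (1 - \<theta>)))"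
    and K2: "\<theta> = 1 \<longrightarrow> (\<exists>M. AE x in lborel. cmod (K x) \<le> M)"
  shows "\<exists>N>0. \<forall>t>0. \<forall>f\<in>borel_measurable borel.
    (q \<noteq> top \<longrightarrow>
      epow (\<integral>\<^sup>+x. epow (\<integral>\<^sup>+y. ennreal (cmod (scaled_kernel \<alpha> \<beta> K t (x - y))) * ennreal (cmod (f y)) \<partial>lborel) (enn2real q) \<partial>lborel) (recip q)
        \<le> ennreal (N * t powr (- (\<alpha> / \<beta> * DIM('a) * \<theta>))) * space_norm p f) \<and>
    (q = top \<longrightarrow> (\<forall>x.
      (\<integral>\<^sup>+y. ennreal (cmod (scaled_kernel \<alpha> \<beta> K t (x - y))) * ennreal (cmod (f y)) \<partial>lborel)
        \<le> ennreal (N * t powr (- (\<alpha> / \<beta> * DIM('a) * \<theta>))) * space_norm p f))"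
proof -
  let ?d = "real DIM('a)"
  obtain P where P: "p = ennreal P" "P \<ge> 1" using pq by (cases p) (auto simp: top_unique)
  have rp: "recip p = 1 / P" using P by (simp add: recip_ennreal)
  have sn: "space_norm p f = epow (\<integral>\<^sup>+y. epow (ennreal (cmod (f y))) P \<partial>lborel) (1 / P)" for f :: "'a \<Rightarrow> complex"
    using P rp by (simp only: space_norm_def Lp_norm_def) simp
  have rq: "0 \<le> recip q" by (simp add: recip_def)
  have \<theta>1: "\<theta> \<le> 1 / P" "1 / P \<le> 1" using rq P(2) by (simp_all add: \<theta> rp)
  have [measurable]: "scaled_kernel \<alpha> \<beta> K t \<in> borel_measurable borel" for t
    using scaled_kernel_measurable[of K "\<lambda>x. t" borel "\<lambda>x. x" \<alpha> \<beta>] by simp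
  show ?thesis
  proof (cases "\<theta> < 1")
    case True
    define S where "S = 1 / (1 - \<theta>)"
    have S: "S > 0" "1 / S = 1 - \<theta>" using True by (auto simp: S_def)
    define A where "A = epow (\<integral>\<^sup>+x. epow (ennreal (cmod (K x))) S \<partial>lborel) (1 / S)"
    have "(\<integral>\<^sup>+x. epow (ennreal (cmod (K x))) S \<partial>lborel) = (\<integral>\<^sup>+x. ennreal (cmod (K x) powr S) \<partial>lborel)"
      by (intro nn_integral_cong) (simp add: epow_ennreal)
    also have "\<dots> < top"
      using K1[rule_format, OF True] by (subst nn_integral_eq_integral) (auto simp: S_def)
    finally have "A < top" by (simp add: A_def)
    \<comment> \<open>Adding 1 keeps the constant positive even if \<open>K\<close> vanishes almost
      everywhere.\<close>
    hence A: "A \<le> ennreal (enn2real A + 1)"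
      by (cases A) (auto intro!: ennreal_leI)
    have k: "epow (\<integral>\<^sup>+x. epow (ennreal (cmod (scaled_kernel \<alpha> \<beta> K t x))) S \<partial>lborel) (1 / S) \<le>
        ennreal ((enn2real A + 1) * t powr (- (\<alpha> / \<beta> * ?d * \<theta>)))" if "t > 0" for t
    proof -
      have "epow (\<integral>\<^sup>+x. epow (ennreal (cmod (scaled_kernel \<alpha> \<beta> K t x))) S \<partial>lborel) (1 / S) =
          ennreal (t powr (- (\<alpha> / \<beta> * ?d * \<theta>))) * A"
        using scaled_kernel_Lp[OF _ that S(1), of K \<alpha> \<beta>] S(2) by (simp add: A_def)
      also have "\<dots> \<le> ennreal (t powr (- (\<alpha> / \<beta> * ?d * \<theta>))) * ennreal (enn2real A + 1)"
        using A by (intro mult_left_mono) auto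
      also have "\<dots> = ennreal (t powr (- (\<alpha> / \<beta> * ?d * \<theta>)) * (enn2real A + 1))"
        by (rule ennreal_mult[symmetric]) auto
      finally show ?thesis by (simp only: mult.commute)
    qed
    show ?thesis
    proof (intro exI[of _ "enn2real A + 1"] conjI allI ballI impI)
      show "enn2real A + 1 > 0" by (simp add: add_nonneg_pos)
      fix t :: real and f :: "'a \<Rightarrow> complex"
      assume t: "t > 0" and [measurable]: "f \<in> borel_measurable borel"
      {
        assume "q \<noteq> top"
        then obtain Q where Q: "q = ennreal Q" "P < Q" using pq P by (cases q) (auto simp: ennreal_less_iff)
        have rq: "recip q = 1 / Q" using Q P by (simp add: recip_ennreal)
        have "epow (\<integral>\<^sup>+x. epow (\<integral>\<^sup>+y. ennreal (cmod (scaled_kernel \<alpha> \<beta> K t (x - y))) * ennreal (cmod (f y)) \<partial>lborel) Q \<partial>lborel) (1 / Q)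
           \<le> epow (\<integral>\<^sup>+x. epow (ennreal (cmod (scaled_kernel \<alpha> \<beta> K t x))) S \<partial>lborel) (1 / S) * space_norm p f"
          unfolding sn using P Q S rp rq \<theta> by (intro Young_convolution) auto
        also have "\<dots> \<le> ennreal ((enn2real A + 1) * t powr (- (\<alpha> / \<beta> * ?d * \<theta>))) * space_norm p f"
          by (intro mult_right_mono k t) auto
        finally show "epow (\<integral>\<^sup>+x. epow (\<integral>\<^sup>+y. ennreal (cmod (scaled_kernel \<alpha> \<beta> K t (x - y))) * ennreal (cmod (f y)) \<partial>lborel) (enn2real q) \<partial>lborel) (recip q)
          \<le> ennreal ((enn2real A + 1) * t powr (- (\<alpha> / \<beta> * ?d * \<theta>))) * space_norm p f"
          using Q P rq by simp
      }
      fix x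
      assume "q = top"
      hence "\<theta> = 1 / P" by (simp add: \<theta> rp recip_top)
      hence "(\<integral>\<^sup>+y. ennreal (cmod (scaled_kernel \<alpha> \<beta> K t (x - y))) * ennreal (cmod (f y)) \<partial>lborel)
        \<le> epow (\<integral>\<^sup>+x. epow (ennreal (cmod (scaled_kernel \<alpha> \<beta> K t x))) S \<partial>lborel) (1 / S) * space_norm p f"
        unfolding sn using P S by (intro Hoelder_convolution) auto
      also have "\<dots> \<le> ennreal ((enn2real A + 1) * t powr (- (\<alpha> / \<beta> * ?d * \<theta>))) * space_norm p f"
        by (intro mult_right_mono k t) auto
      finally show "(\<integral>\<^sup>+y. ennreal (cmod (scaled_kernel \<alpha> \<beta> K t (x - y))) * ennreal (cmod (f y)) \<partial>lborel)
        \<le> ennreal ((enn2real A + 1) * t powr (- (\<alpha> / \<beta> * ?d * \<theta>))) * space_norm p f" .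
    qed
  next
    case False
    \<comment> \<open>As \<theta> \<le> 1 / P \<le> 1, the value \<theta> = 1 leaves only p = 1 and
      q infinite, where a bound for the kernel is multiplied by the L^1 norm.\<close>
    hence \<theta>eq: "\<theta> = 1" and "1 / P = 1" using \<theta>1 by linarith+
    hence P1: "P = 1" by (simp add: divide_eq_1_iff)
    have q: "q = top"
    proof (rule ccontr)
      assume "q \<noteq> top"
      then obtain Q where Q: "q = ennreal Q" "P < Q" using pq P by (cases q) (auto simp: ennreal_less_iff)
      hence "recip q > 0" using P by (simp add: recip_ennreal)
      thus False using \<theta> \<theta>eq rp P1 by simp
    qed
    obtain M where M: "AE x in lborel. cmod (K x) \<le> M" using K2[rule_format, OF \<theta>eq] by blast
    show ?thesis
    proof (intro exI[of _ "\<bar>M\<bar> + 1"] conjI allI ballI impI)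
      show "\<bar>M\<bar> + 1 > 0" by simp
      fix t :: real and f :: "'a \<Rightarrow> complex" and x :: 'a
      assume t: "t > 0" and [measurable]: "f \<in> borel_measurable borel"
      let ?b = "t powr (- (\<alpha> / \<beta> * ?d * \<theta>))"
      have "AE z in lborel. cmod (K (0 + (t powr (- (\<alpha> / \<beta>))) *\<^sub>R z)) \<le> M"
        using t by (intro AE_lborel_affine M) simp
      hence "AE z in lborel. cmod (scaled_kernel \<alpha> \<beta> K t z) \<le> (\<bar>M\<bar> + 1) * ?b"
      proof eventually_elim
        case (elim z)
        have "cmod (scaled_kernel \<alpha> \<beta> K t z) = ?b * cmod (K ((t powr (- (\<alpha> / \<beta>))) *\<^sub>R z))"
          by (simp add: scaled_kernel_def norm_mult \<theta>eq)
        also have "\<dots> \<le> ?b * (\<bar>M\<bar> + 1)" using elim by (intro mult_left_mono) auto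
        finally show ?case by (simp add: mult.commute)
      qed
      hence "AE y in lborel. cmod (scaled_kernel \<alpha> \<beta> K t (x + (-1) *\<^sub>R y)) \<le> (\<bar>M\<bar> + 1) * ?b"
        by (intro AE_lborel_affine) auto
      hence "(\<integral>\<^sup>+y. ennreal (cmod (scaled_kernel \<alpha> \<beta> K t (x - y))) * ennreal (cmod (f y)) \<partial>lborel) \<le>
          (\<integral>\<^sup>+y. ennreal ((\<bar>M\<bar> + 1) * ?b) * ennreal (cmod (f y)) \<partial>lborel)"
        by (intro nn_integral_mono_AE) (auto elim!: eventually_mono intro!: mult_right_mono ennreal_leI)
      also have "\<dots> = ennreal ((\<bar>M\<bar> + 1) * ?b) * (\<integral>\<^sup>+y. ennreal (cmod (f y)) \<partial>lborel)"
        by (rule nn_integral_cmult) measurable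
      also have "(\<integral>\<^sup>+y. ennreal (cmod (f y)) \<partial>lborel) = space_norm p f" by (simp add: sn P1)
      finally show "(\<integral>\<^sup>+y. ennreal (cmod (scaled_kernel \<alpha> \<beta> K t (x - y))) * ennreal (cmod (f y)) \<partial>lborel)
        \<le> ennreal ((\<bar>M\<bar> + 1) * ?b) * space_norm p f" .
    qed (use q in auto)
  qed
qed

text \<open>The kernel is fixed only up to a null set. Reflection and translation preserve null
  sets, so the convolution is nevertheless determined at every single point x.\<close>

lemma conv_cong_AE:
  fixes f :: "'a::euclidean_space \<Rightarrow> complex"
  assumes [measurable]: "K1 \<in> borel_measurable borel" "K2 \<in> borel_measurable borel" "f \<in> borel_measurable borel"
    and eq: "AE x in lborel. K1 x = K2 x"
  shows "conv K1 f x = conv K2 f x"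
  unfolding conv_def
proof (rule integral_cong_AE)
  have "AE y in lborel. K1 (x + (-1) *\<^sub>R y) = K2 (x + (-1) *\<^sub>R y)"
    by (rule AE_lborel_affine[OF _ eq]) simp
  hence "AE y in lborel. K1 (x - y) = K2 (x - y)" by simp
  thus "AE y in lborel. K1 (x - y) * f y = K2 (x - y) * f y" by eventually_elim simp
qed measurable

text \<open>The angle (\<nu> - \<mu>) pi of the ray counts modulo 2 pi, so a distance above \<alpha>
  pi / 2 from the positive axis is expressed by a lower and an upper bound on |\<mu> - \<nu>|.
  Measurability is part of the conclusion so that the space norm is that of a measurable
  function.\<close>

theorem theorem4p2:
  fixes \<alpha> \<beta> \<mu> \<nu> :: real and p q r :: ennreal
  assumes "\<beta> > 0"
    and "\<mu> \<in> {-1<..1}" and "\<nu> \<in> {-1<..1}"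
    and "\<bar>\<mu> - \<nu>\<bar> > \<alpha> / 2" and "\<bar>\<mu> - \<nu>\<bar> < 2 - \<alpha> / 2"
    and "\<alpha> \<in> {0<..<2}"
    and "ennreal (1 / \<alpha>) < r" and "1 \<le> r"
    and "1 \<le> p" and "p < q"
    and "recip p - recip q < \<beta> / DIM('a) * (1 - 1 / \<alpha> * recip r)"
  shows "\<exists>C>0. \<forall>F :: real \<Rightarrow> 'a::euclidean_space \<Rightarrow> complex.
    set_borel_measurable borel ({0..} \<times> UNIV) (\<lambda>(s, x). F s x) \<longrightarrow>
    (\<forall>t>0. sol_w \<alpha> \<beta> \<mu> \<nu> F t \<in> borel_measurable lborel \<and>
       space_norm q (sol_w \<alpha> \<beta> \<mu> \<nu> F t) \<le>
         ennreal (C * t powr (\<alpha> / \<beta> * DIM('a) * (\<beta> / DIM('a) - (recip p - recip q)) - recip r))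
         * mixed_norm r p F)"
proof -
  let ?d = "real DIM('a)"
  have \<alpha>: "\<alpha> > 0" using assms(6) by simp
  have d: "?d > 0" by simp
  define \<theta> where "\<theta> = recip p - recip q"
  obtain P where P: "p = ennreal P" "P \<ge> 1" using assms(9,10) by (cases p) (auto simp: top_unique)
  have "recip q < recip p"
  proof (cases q)
    case (real Q)
    hence "P < Q" using P assms(10) by (simp add: ennreal_less_iff)
    thus ?thesis using P real by (simp add: recip_ennreal field_simps)
  next
    case top
    thus ?thesis using P by (simp add: recip_ennreal recip_top)
  qed
  hence \<theta>0: "\<theta> > 0" by (simp add: \<theta>_def)
  have rr: "recip r \<ge> 0" by (simp add: recip_def)
  \<comment> \<open>\<open>e\<close> is the total power of t - s: \<alpha> - 1 from the weight in
    the solution formula and the rest from the scaling of the kernel. The hypothesis on 1/p - 1/q is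
    equivalent to recip r < e + 1.\<close>
  define e where "e = \<alpha> - 1 - \<alpha> / \<beta> * ?d * \<theta>"
  have "\<alpha> / \<beta> * ?d * \<theta> < \<alpha> / \<beta> * ?d * (\<beta> / ?d * (1 - 1 / \<alpha> * recip r))"
    using assms(1,11) \<alpha> d by (intro mult_strict_left_mono) (auto simp: \<theta>_def)
  also have "\<dots> = \<alpha> - recip r" using assms(1) \<alpha> d by (simp add: field_simps)
  finally have e: "recip r < e + 1" by (simp add: e_def)
  have "\<beta> / ?d * (1 - 1 / \<alpha> * recip r) \<le> \<beta> / ?d * 1"
    using assms(1) \<alpha> d rr by (intro mult_left_mono) auto
  hence \<theta>\<beta>: "\<theta> < \<beta> / ?d" using assms(11) by (simp add: \<theta>_def)
  obtain K :: "'a \<Rightarrow> complex" where mK[measurable]: "K \<in> borel_measurable borel"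
    and KW: "\<forall>t>0. (AE x in lborel. kernel_W \<alpha> \<beta> \<mu> \<nu> t x = scaled_kernel \<alpha> \<beta> K t x) \<and>
      (kernel_W \<alpha> \<beta> \<mu> \<nu> t :: 'a \<Rightarrow> complex) \<in> borel_measurable borel"
    and K1: "\<theta> < 1 \<longrightarrow> integrable lborel (\<lambda>x. cmod (K x) powr (1 / (1 - \<theta>)))"
    and K2: "\<theta> = 1 \<longrightarrow> (\<exists>M. AE x in lborel. cmod (K x) \<le> M)"
    using kernel_W_structure[where 'a='a, OF assms(1) \<alpha> assms(2-5) \<theta>0 \<theta>\<beta>] by (elim exE conjE)
  note K = KW[rule_format, THEN conjunct1] and mW = KW[rule_format, THEN conjunct2]
  obtain N where N: "N > 0" and N_bound: "\<forall>t>0. \<forall>f\<in>borel_measurable borel.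
    (q \<noteq> top \<longrightarrow>
      epow (\<integral>\<^sup>+x. epow (\<integral>\<^sup>+y. ennreal (cmod (scaled_kernel \<alpha> \<beta> K t (x - y))) * ennreal (cmod (f y)) \<partial>lborel) (enn2real q) \<partial>lborel) (recip q)
        \<le> ennreal (N * t powr (- (\<alpha> / \<beta> * ?d * \<theta>))) * space_norm p f) \<and>
    (q = top \<longrightarrow> (\<forall>x.
      (\<integral>\<^sup>+y. ennreal (cmod (scaled_kernel \<alpha> \<beta> K t (x - y))) * ennreal (cmod (f y)) \<partial>lborel)
        \<le> ennreal (N * t powr (- (\<alpha> / \<beta> * ?d * \<theta>))) * space_norm p f))"
    using scaled_kernel_convolution_le[OF mK assms(9,10) \<theta>_def K1 K2, of \<alpha> \<beta>]
    by (elim exE conjE)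
  note Nq = N_bound[rule_format, THEN conjunct1, rule_format]
    and Ninf = N_bound[rule_format, THEN conjunct2, rule_format]
  obtain C where C: "C > 0" and C_bound: "\<forall>t>0. \<forall>g\<in>borel_measurable borel.
      (\<integral>\<^sup>+s. indicator {0..t} s * ennreal ((t - s) powr e) * g s \<partial>lborel) \<le>
      ennreal (C * t powr (e + 1 - recip r)) * Lp_norm r (restrict_space lborel {0..}) g"
    using time_Hoelder[OF assms(8) e] by (elim exE conjE)
  note time = C_bound[rule_format]
  have main: "sol_w \<alpha> \<beta> \<mu> \<nu> F t \<in> borel_measurable lborel \<and>
       space_norm q (sol_w \<alpha> \<beta> \<mu> \<nu> F t) \<le>
         ennreal (N * C * t powr (\<alpha> / \<beta> * DIM('a) * (\<beta> / DIM('a) - (recip p - recip q)) - recip r))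
         * mixed_norm r p F"
    if F: "set_borel_measurable borel ({0..} \<times> UNIV) (\<lambda>(s, x). F s x)" and t: "t > 0"
    for F :: "real \<Rightarrow> 'a \<Rightarrow> complex" and t :: real
  proof -
    \<comment> \<open>F is known to be measurable at nonnegative times only. Its extension by 0 is
      jointly measurable everywhere and agrees with F wherever the time integral looks.\<close>
    define G where "G = (\<lambda>s x. indicator {0..} s *\<^sub>R F s x)"
    have "(\<lambda>z. indicator ({0..} \<times> UNIV) z *\<^sub>R (case z of (s, x) \<Rightarrow> F s x)) \<in> borel_measurable (borel \<Otimes>\<^sub>M borel)"
      using F by (simp add: set_borel_measurable_def borel_prod)
    moreover have "(\<lambda>z. indicator ({0..} \<times> UNIV) z *\<^sub>R (case z of (s, x) \<Rightarrow> F s x)) = (\<lambda>(s, x). G s x)"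
      by (auto simp: G_def indicator_def fun_eq_iff)
    ultimately have mG: "(\<lambda>z. G (fst z) (snd z)) \<in> borel_measurable (borel \<Otimes>\<^sub>M borel)"
      by (simp add: case_prod_unfold)
    have mG'[measurable]: "(\<lambda>z. G (f z) (g z)) \<in> borel_measurable M"
      if [measurable]: "f \<in> borel_measurable M" "g \<in> borel_measurable M" for f g and M :: "'z measure"
      using measurable_compose[OF _ mG, of "\<lambda>z. (f z, g z)" M] by simp
    have mGs: "G s \<in> borel_measurable borel" for s
      using mG'[of "\<lambda>x. s" borel "\<lambda>x. x"] by simp
    have FG: "F s = G s" if "s \<ge> 0" for s using that by (simp add: G_def fun_eq_iff)
    have mk: "(\<lambda>z. scaled_kernel \<alpha> \<beta> K (f z) (g z)) \<in> borel_measurable M"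
      if "f \<in> borel_measurable M" "g \<in> borel_measurable M" for f g and M :: "'z measure"
      by (rule scaled_kernel_measurable[OF mK that])
    \<comment> \<open>\<open>kernel_W\<close> is chosen separately at each time, which says nothing
      about joint measurability in time and space. The scaled kernel has it by its formula, and
      replacing one by the other leaves each convolution unchanged.\<close>
    define A where "A = (\<lambda>x s. indicator {0..t} s *\<^sub>R (complex_of_real ((t - s) powr (\<alpha> - 1)) * conv (scaled_kernel \<alpha> \<beta> K (t - s)) (G s) x))"
    have sol: "sol_w \<alpha> \<beta> \<mu> \<nu> F t x = cis (- \<mu> * pi) * (\<integral>s. A x s \<partial>lborel)" for x
      unfolding sol_w_def set_lebesgue_integral_def A_def
    proof (intro arg_cong[where f = "\<lambda>z. cis (- \<mu> * pi) * z"] Bochner_Integration.integral_cong refl)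
      fix s :: real
      \<comment> \<open>At s = t the scaling says nothing about the kernel, but there (t - s) powr
        (\<alpha> - 1) is 0 by the value of \<open>powr\<close> at base 0.\<close>
      consider "s \<notin> {0..t}" | "s = t" | "0 \<le> s" "s < t" by force
      thus "indicator {0..t} s *\<^sub>R (complex_of_real ((t - s) powr (\<alpha> - 1)) * conv (kernel_W \<alpha> \<beta> \<mu> \<nu> (t - s)) (F s) x) =
          indicator {0..t} s *\<^sub>R (complex_of_real ((t - s) powr (\<alpha> - 1)) * conv (scaled_kernel \<alpha> \<beta> K (t - s)) (G s) x)"
      proof cases
        case 3
        have "conv (kernel_W \<alpha> \<beta> \<mu> \<nu> (t - s)) (F s) x = conv (scaled_kernel \<alpha> \<beta> K (t - s)) (G s) x"
          unfolding FG[OF 3(1)]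
        proof (rule conv_cong_AE)
          show "scaled_kernel \<alpha> \<beta> K (t - s) \<in> borel_measurable borel"
            using mk[of "\<lambda>x. t - s" borel "\<lambda>x. x"] by simp
        qed (use 3 mW K mGs in auto)
        thus ?thesis by simp
      qed auto
    qed
    define h where "h = (\<lambda>s x. \<integral>\<^sup>+y. ennreal (cmod (scaled_kernel \<alpha> \<beta> K (t - s) (x - y))) * ennreal (cmod (G s y)) \<partial>lborel)"
    define H where "H = (\<lambda>s x. indicator {0..t} s * ennreal ((t - s) powr (\<alpha> - 1)) * h s x)"
    have mA: "(\<lambda>(x, s). A x s) \<in> borel_measurable (lborel \<Otimes>\<^sub>M lborel)"
      unfolding A_def conv_def using mk by measurable
    have mh: "(\<lambda>(s, x). h s x) \<in> borel_measurable (lborel \<Otimes>\<^sub>M lborel)"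
      unfolding h_def using mk by measurable
    have mH: "(\<lambda>(s, x). H s x) \<in> borel_measurable (lborel \<Otimes>\<^sub>M lborel)"
      unfolding H_def using mh by measurable
    have "(\<lambda>x. \<integral>s. A x s \<partial>lborel) \<in> borel_measurable lborel"
      using mA by (rule lborel.borel_measurable_lebesgue_integral)
    hence meas: "sol_w \<alpha> \<beta> \<mu> \<nu> F t \<in> borel_measurable lborel"
      unfolding sol[abs_def] by measurable
    have bound: "ennreal (cmod (sol_w \<alpha> \<beta> \<mu> \<nu> F t x)) \<le> (\<integral>\<^sup>+s. H s x \<partial>lborel)" for x
    proof -
      have "ennreal (cmod (sol_w \<alpha> \<beta> \<mu> \<nu> F t x)) \<le> (\<integral>\<^sup>+s. ennreal (cmod (A x s)) \<partial>lborel)"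
        unfolding sol norm_mult norm_cis mult_1_left by (rule ennreal_norm_integral_le)
      also have "\<dots> \<le> (\<integral>\<^sup>+s. H s x \<partial>lborel)"
      proof (intro nn_integral_mono)
        fix s :: real
        have "ennreal (cmod (conv (scaled_kernel \<alpha> \<beta> K (t - s)) (G s) x)) \<le> h s x"
          unfolding conv_def h_def
          using ennreal_norm_integral_le[of lborel "\<lambda>y. scaled_kernel \<alpha> \<beta> K (t - s) (x - y) * G s y"]
          by (simp add: norm_mult ennreal_mult)
        thus "ennreal (cmod (A x s)) \<le> H s x"
          unfolding A_def H_def by (auto simp: indicator_def norm_mult ennreal_mult intro: mult_left_mono)
      qed
      finally show ?thesis .
    qed
    define g where "g = (\<lambda>s. space_norm p (G s))"
    have mg: "g \<in> borel_measurable borel"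
    proof -
      have "g = (\<lambda>s. epow (\<integral>\<^sup>+y. epow (ennreal (cmod (G s y))) P \<partial>lborel) (recip p))"
        using P by (simp add: g_def space_norm_def Lp_norm_def fun_eq_iff)
      thus ?thesis by simp
    qed
    have mixed: "mixed_norm r p F = Lp_norm r (restrict_space lborel {0..}) g"
    proof -
      have "Lp_norm r (restrict_space lborel {0..}) (\<lambda>s. space_norm p (F s)) = Lp_norm r (restrict_space lborel {0..}) g"
      proof -
        have "esssup (restrict_space lborel {0..}) (\<lambda>s. space_norm p (F s)) = esssup (restrict_space lborel {0..}) g"
        proof (rule esssup_AE_cong)
          show mgr: "g \<in> borel_measurable (restrict_space lborel {0..})"
            using mg by (intro measurable_restrict_space1) simp
          have eq: "space_norm p (F s) = g s" if "s \<in> space (restrict_space lborel {0..})" for s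
            using that by (simp add: g_def FG space_restrict_space)
          show "(\<lambda>s. space_norm p (F s)) \<in> borel_measurable (restrict_space lborel {0..})"
            using mgr by (subst measurable_cong[OF eq])
          show "AE s in restrict_space lborel {0..}. space_norm p (F s) = g s"
            by (rule AE_I2) (rule eq)
        qed
        moreover have "(\<integral>\<^sup>+s. epow (space_norm p (F s)) (enn2real r) \<partial>restrict_space lborel {0..}) =
            (\<integral>\<^sup>+s. epow (g s) (enn2real r) \<partial>restrict_space lborel {0..})"
          by (intro nn_integral_cong) (auto simp: g_def FG space_restrict_space)
        ultimately show ?thesis by (simp add: Lp_norm_def)
      qed
      thus ?thesis by (simp add: mixed_norm_def)
    qed
    \<comment> \<open>The bound on \<open>Z\<close> is asked for s < t only, because the weight is 0
      at s = t. \<open>Z\<close> is left open so that it can be a pointwise value for q infinite and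
      the norm of a slice for q finite.\<close>
    have slice: "indicator {0..t} s * ennreal ((t - s) powr (\<alpha> - 1)) * Z \<le>
        ennreal N * (indicator {0..t} s * ennreal ((t - s) powr e) * g s)"
      if Z: "s < t \<Longrightarrow> Z \<le> ennreal (N * (t - s) powr (- (\<alpha> / \<beta> * ?d * \<theta>))) * g s" for s Z
    proof (cases "s \<in> {0..<t}")
      case True
      have "ennreal ((t - s) powr (\<alpha> - 1)) * Z \<le>
          ennreal ((t - s) powr (\<alpha> - 1)) * (ennreal (N * (t - s) powr (- (\<alpha> / \<beta> * ?d * \<theta>))) * g s)"
        using Z True by (intro mult_left_mono) auto
      also have "\<dots> = ennreal ((t - s) powr (\<alpha> - 1) * (N * (t - s) powr (- (\<alpha> / \<beta> * ?d * \<theta>)))) * g s"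
        using N by (simp add: ennreal_mult mult.assoc)
      also have "(t - s) powr (\<alpha> - 1) * (N * (t - s) powr (- (\<alpha> / \<beta> * ?d * \<theta>))) = N * (t - s) powr e"
      proof -
        have "e = (\<alpha> - 1) + - (\<alpha> / \<beta> * ?d * \<theta>)" by (simp add: e_def)
        thus ?thesis by (simp only: powr_add mult_ac)
      qed
      finally show ?thesis using True N by (simp add: ennreal_mult mult.assoc)
    next
      case False
      hence "s \<notin> {0..t} \<or> s = t" by auto
      thus ?thesis by auto
    qed
    have total: "(\<integral>\<^sup>+s. ennreal N * (indicator {0..t} s * ennreal ((t - s) powr e) * g s) \<partial>lborel) \<le>
        ennreal (N * C * t powr (\<alpha> / \<beta> * ?d * (\<beta> / ?d - (recip p - recip q)) - recip r)) * mixed_norm r p F"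
    proof -
      have "(\<integral>\<^sup>+s. ennreal N * (indicator {0..t} s * ennreal ((t - s) powr e) * g s) \<partial>lborel) =
          ennreal N * (\<integral>\<^sup>+s. indicator {0..t} s * ennreal ((t - s) powr e) * g s \<partial>lborel)"
        using mg by (intro nn_integral_cmult) measurable
      also have "\<dots> \<le> ennreal N * (ennreal (C * t powr (e + 1 - recip r)) * mixed_norm r p F)"
        unfolding mixed by (intro mult_left_mono time t mg) auto
      also have "\<dots> = ennreal (N * C * t powr (e + 1 - recip r)) * mixed_norm r p F"
        using N C by (simp add: ennreal_mult mult.assoc)
      also have "e + 1 - recip r = \<alpha> / \<beta> * ?d * (\<beta> / ?d - (recip p - recip q)) - recip r"
        using assms(1) d by (simp add: e_def \<theta>_def field_simps)
      finally show ?thesis .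
    qed
    have "space_norm q (sol_w \<alpha> \<beta> \<mu> \<nu> F t) \<le>
        (\<integral>\<^sup>+s. ennreal N * (indicator {0..t} s * ennreal ((t - s) powr e) * g s) \<partial>lborel)"
    proof (cases "q = top")
      case True
      have "ennreal (cmod (sol_w \<alpha> \<beta> \<mu> \<nu> F t x)) \<le>
          (\<integral>\<^sup>+s. ennreal N * (indicator {0..t} s * ennreal ((t - s) powr e) * g s) \<partial>lborel)" for x
      proof -
        have "(\<integral>\<^sup>+s. H s x \<partial>lborel) \<le> (\<integral>\<^sup>+s. ennreal N * (indicator {0..t} s * ennreal ((t - s) powr e) * g s) \<partial>lborel)"
          unfolding H_def
        proof (intro nn_integral_mono slice)
          fix s assume "s < t"
          thus "h s x \<le> ennreal (N * (t - s) powr (- (\<alpha> / \<beta> * ?d * \<theta>))) * g s"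
            unfolding h_def g_def using True by (intro Ninf mGs) auto
        qed
        thus ?thesis using bound[of x] by (rule order_trans[rotated])
      qed
      hence "esssup lborel (\<lambda>x. ennreal (cmod (sol_w \<alpha> \<beta> \<mu> \<nu> F t x))) \<le>
          (\<integral>\<^sup>+s. ennreal N * (indicator {0..t} s * ennreal ((t - s) powr e) * g s) \<partial>lborel)"
        using meas by (intro esssup_I AE_I2) auto
      thus ?thesis using True by (simp add: space_norm_def Lp_norm_def)
    next
      case False
      then obtain Q where Q: "q = ennreal Q" "P < Q" using assms(10) P by (cases q) (auto simp: ennreal_less_iff)
      have rq: "recip q = 1 / Q" and Q1: "1 < Q" using Q P by (auto simp: recip_ennreal)
      have "space_norm q (sol_w \<alpha> \<beta> \<mu> \<nu> F t) = epow (\<integral>\<^sup>+x. epow (ennreal (cmod (sol_w \<alpha> \<beta> \<mu> \<nu> F t x))) Q \<partial>lborel) (1 / Q)"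
        using Q Q1 rq by (simp add: space_norm_def Lp_norm_def)
      also have "\<dots> \<le> epow (\<integral>\<^sup>+x. epow (\<integral>\<^sup>+s. H s x \<partial>lborel) Q \<partial>lborel) (1 / Q)"
        using Q1 bound by (intro epow_mono nn_integral_mono) auto
      \<comment> \<open>The space norm moves inside the time integral, so that Young's inequality
        can be used at each fixed s.\<close>
      also have "\<dots> \<le> (\<integral>\<^sup>+s. epow (\<integral>\<^sup>+x. epow (H s x) Q \<partial>lborel) (1 / Q) \<partial>lborel)"
        by (rule nn_integral_Minkowski[OF sigma_finite_lborel sigma_finite_lborel Q1 mH])
      also have "\<dots> \<le> (\<integral>\<^sup>+s. ennreal N * (indicator {0..t} s * ennreal ((t - s) powr e) * g s) \<partial>lborel)"
      proof (intro nn_integral_mono)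
        fix s :: real
        have [measurable]: "h s \<in> borel_measurable borel" using measurable_compose[OF _ mh, of "\<lambda>x. (s, x)" borel] by simp
        let ?c = "indicator {0..t} s * ennreal ((t - s) powr (\<alpha> - 1))"
        have "epow (\<integral>\<^sup>+x. epow (H s x) Q \<partial>lborel) (1 / Q) = epow (epow ?c Q * (\<integral>\<^sup>+x. epow (h s x) Q \<partial>lborel)) (1 / Q)"
          unfolding H_def epow_mult[of ?c] by (subst nn_integral_cmult) auto
        also have "\<dots> = ?c * epow (\<integral>\<^sup>+x. epow (h s x) Q \<partial>lborel) (1 / Q)"
          using Q1 by (simp add: epow_mult[of "epow ?c Q"] epow_epow)
        also have "\<dots> \<le> ennreal N * (indicator {0..t} s * ennreal ((t - s) powr e) * g s)"
        proof (rule slice)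
          assume "s < t"
          thus "epow (\<integral>\<^sup>+x. epow (h s x) Q \<partial>lborel) (1 / Q) \<le> ennreal (N * (t - s) powr (- (\<alpha> / \<beta> * ?d * \<theta>))) * g s"
            using Nq[of "t - s" "G s"] mGs[of s] Q Q1 rq unfolding h_def g_def by auto
        qed
        finally show "epow (\<integral>\<^sup>+x. epow (H s x) Q \<partial>lborel) (1 / Q) \<le> ennreal N * (indicator {0..t} s * ennreal ((t - s) powr e) * g s)" .
      qed
      finally show ?thesis .
    qed
    with total meas show ?thesis by (auto intro: order_trans)
  qed
  show ?thesis
    by (rule exI[of _ "N * C"]) (use N C main in auto)
qed

end
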